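(* Let $n\ge 2$ be an integer and let $NUE_n$ be the set of minimal, non-uniquely ergodic interval exchange transformations with flips on $n$ intervals. Then $$\left[\frac{n-1}{2}\right]-1\le \operatorname{Hdim}(NUE_n),$$ where $[\cdot]$ denotes the integer part.
   Context: Let $\mathcal A$ be an alphabet with $n$ letters. A generalized permutation is a pair $\hat\pi=(\pi_0,\pi_1)$, where $\pi_0:\mathcal A\to\{1,\dots,n\}$ is a bijection and $\pi_1:\mathcal A\to\{-n,\dots,-1,1,\dots,n\}$ is a map such that $|\pi_1|:\mathcal A\to\{1,\dots,n\}$ is a bijection. Write $\pi_1=\theta|\pi_1|$ with $\theta\in\{-1,1\}^{\mathcal A}$; the flip set is $F=\{\alpha\in\mathcal A:\theta_\alpha=-1\}$. Let $\lambda=(\lambda_\alpha)_{\alpha\in\mathcal A}$ be a vector of positive lengths with $\sum_\alpha\lambda_\alpha=1$. The interval $I=[0,1)$ is partitioned into the intervals $I_\alpha=[a_\alpha,a_\alpha+\lambda_\alpha)$ with $a_\alpha=\sum_{\pi_0(\beta)<\pi_0(\alpha)}\lambda_\beta$. The interval exchange transformation with flips on $n$ intervals ($n$-fIET) given by $(\hat\pi,\lambda)$, where the flip set $F$ is required to be non-empty, is the map $f:\bigcup_\alpha\operatorname{int}(I_\alpha)\to I$ defined on $\operatorname{int}(I_\alpha)$ by $f(x)=x+w_\alpha$ with $w_\alpha=\sum_{|\pi_1|(\beta)<|\pi_1|(\alpha)}\lambda_\beta-\sum_{\pi_0(\beta)<\pi_0(\alpha)}\lambda_\beta$ if $\alpha\notin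 F$, and $f(x)=w_\alpha-x$ with $w_\alpha=\sum_{|\pi_1|(\beta)\le|\pi_1|(\alpha)}\lambda_\beta+\sum_{\pi_0(\beta)<\pi_0(\alpha)}\lambda_\beta$ if $\alpha\in F$. It is injective. The orbit of $x$ is the set of all $f^k(x)$, $k\in\mathbb Z$, that are defined. Since $f$ is not defined at the endpoints of the intervals $I_\alpha$, some orbits stop; $f$ is called minimal if every orbit for which $f^k(x)$ is defined for all $k\ge0$ or for all $k\le 0$ is dense in $I$. An invariant measure of $f$ is a Borel probability measure $\mu$ on $I$ giving zero mass to the finite set where $f$ is not defined and satisfying $\mu(f^{-1}(A))=\mu(A)$ for all Borel $A$; $f$ is uniquely ergodic if it has a unique invariant measure (necessarily Lebesgue measure, which is always invariant), and non-uniquely ergodic otherwise. The set of $n$-fIETs is parametrized by the finitely many generalized permutations $\hat\pi$ with $F\neq\emptyset$ together with $\lambda$ in the open simplex $\{\lambda\in\mathbb R_{>0}^{\mathcal A}:\sum\lambda_\alpha=1\}$, a subset of an $(n-1)$-dimensional affine space (identified with $\mathbb R^{n-1}$). $\operatorname{Hdim}$ is the Hausdorff dimension of a subset of this finite union of simplices with respect to the Euclidean metric (i.e. the maximum over $\hat\pi$ of the dimensions of the slices), with the convention $\operatorname{Hdim}(\emptyset)=0$. *)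

theory Defs
  imports "HOL-Analysis.Analysis" "HOL-Probability.Probability_Measure"
begin

section \<open>Hausdorff dimension\<close>

text \<open>
  The cases \<open>U = {}\<close> and \<open>s = 0\<close> implement the conventions
  \<open>diam({})^s = 0\<close> and \<open>0^0 = 1\<close> (so that the \<open>0\<close>-dimensional measure counts points),
  since \<open>0 powr 0 = 0\<close> in the library.
\<close>

definition hausdorff_gauge :: "real \<Rightarrow> 'm::metric_space set \<Rightarrow> real" where
  "hausdorff_gauge s U = (if U = {} then 0 else if s = 0 then 1 else diameter U powr s)"

text \<open>Boundedness is demanded explicitly, because \<^const>\<open>diameter\<close> is only meaningful for bounded sets.\<close>

definition hausdorff_covers :: "real \<Rightarrow> 'm::metric_space set \<Rightarrow> (nat \<Rightarrow> 'm set) set" where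
  "hausdorff_covers \<delta> X =
     {U. X \<subseteq> (\<Union>i. U i) \<and> (\<forall>i. bounded (U i) \<and> diameter (U i) \<le> \<delta>)}"

definition hausdorff_premeasure :: "real \<Rightarrow> real \<Rightarrow> 'm::metric_space set \<Rightarrow> ennreal" where
  "hausdorff_premeasure \<delta> s X =
     (INF U \<in> hausdorff_covers \<delta> X. \<Sum>i. ennreal (hausdorff_gauge s (U i)))"

definition hausdorff_measure :: "real \<Rightarrow> 'm::metric_space set \<Rightarrow> ennreal" where
  "hausdorff_measure s X = (SUP \<delta> \<in> {0<..}. hausdorff_premeasure \<delta> s X)"

definition hausdorff_dim :: "'m::metric_space set \<Rightarrow> ereal" where
  "hausdorff_dim X = (INF s \<in> {s. 0 \<le> s \<and> hausdorff_measure s X = 0}. ereal s)"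

lemma hausdorff_dim_nonneg: "0 \<le> hausdorff_dim X"
  unfolding hausdorff_dim_def by (auto intro!: INF_greatest)

lemma hausdorff_dim_empty: "hausdorff_dim ({} :: 'm::metric_space set) = 0"
proof (rule antisym[OF _ hausdorff_dim_nonneg])
  have "hausdorff_premeasure \<delta> 0 ({} :: 'm set) = 0" if "\<delta> > 0" for \<delta>
  proof -
    have "(\<lambda>_. {}) \<in> hausdorff_covers \<delta> ({} :: 'm set)"
      using that by (auto simp: hausdorff_covers_def)
    then have "hausdorff_premeasure \<delta> 0 ({} :: 'm set)
        \<le> (\<Sum>i::nat. ennreal (hausdorff_gauge 0 ({} :: 'm set)))"
      unfolding hausdorff_premeasure_def by (rule INF_lower)
    also have "\<dots> = 0"
      by (simp add: hausdorff_gauge_def)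
    finally show ?thesis by simp
  qed
  then have "hausdorff_measure 0 ({} :: 'm set) \<le> 0"
    unfolding hausdorff_measure_def by (intro SUP_least) simp
  then have "hausdorff_measure 0 ({} :: 'm set) = 0"
    by simp
  then show "hausdorff_dim ({} :: 'm set) \<le> 0"
    unfolding hausdorff_dim_def by (intro INF_lower2[where i = 0]) (simp_all add: zero_ereal_def)
qed


section \<open>Dynamics of partial maps\<close>

text \<open>\<open>f^k\<close> for \<open>k \<ge> 0\<close>, defined exactly where all the intermediate iterates are.\<close>

definition map_iter :: "('x \<rightharpoonup> 'x) \<Rightarrow> nat \<Rightarrow> ('x \<rightharpoonup> 'x)" where
  "map_iter f k = (map_comp f ^^ k) Some"

text \<open>
  For injective \<open>f\<close>, the equation \<open>map_iter f k y = Some x\<close> says that \<open>f^(-k)\<close> is defined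
  at \<open>x\<close> with value \<open>y\<close>; likewise \<open>x \<in> ran (map_iter f k)\<close> says that \<open>f^(-k)\<close> is defined at \<open>x\<close>.
\<close>

definition orbit :: "('x \<rightharpoonup> 'x) \<Rightarrow> 'x \<Rightarrow> 'x set" where
  "orbit f x = {y. \<exists>k. map_iter f k x = Some y \<or> map_iter f k y = Some x}"

definition minimal :: "(real \<rightharpoonup> real) \<Rightarrow> bool" where
  "minimal f \<longleftrightarrow>
     (\<forall>x\<in>{0..<1}. (\<forall>k. x \<in> dom (map_iter f k)) \<or> (\<forall>k. x \<in> ran (map_iter f k))
        \<longrightarrow> {0..<1} \<subseteq> closure (orbit f x))"

definition invariant_measure :: "(real \<rightharpoonup> real) \<Rightarrow> real measure \<Rightarrow> bool" where
  "invariant_measure f \<mu> \<longleftrightarrow>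
     prob_space \<mu> \<and> sets \<mu> = sets (restrict_space borel {0..<1}) \<and>
     emeasure \<mu> ({0..<1} - dom f) = 0 \<and>
     (\<forall>A\<in>sets \<mu>. emeasure \<mu> {x. \<exists>y\<in>A. f x = Some y} = emeasure \<mu> A)"

definition uniquely_ergodic :: "(real \<rightharpoonup> real) \<Rightarrow> bool" where
  "uniquely_ergodic f \<longleftrightarrow> (\<exists>!\<mu>. invariant_measure f \<mu>)"


section \<open>Interval exchange transformations with flips\<close>

text \<open>The alphabet is the finite type \<open>'a\<close>, and \<open>n\<close> is \<open>CARD('a)\<close>.\<close>

type_synonym 'a gperm = "('a \<Rightarrow> nat) \<times> ('a \<Rightarrow> int)"

definition gen_perm :: "'a::finite gperm \<Rightarrow> bool" where
  "gen_perm p \<longleftrightarrow>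
     bij_betw (fst p) UNIV {1..CARD('a)} \<and>
     range (snd p) \<subseteq> {- int CARD('a)..-1} \<union> {1..int CARD('a)} \<and>
     bij_betw (\<lambda>\<alpha>. \<bar>snd p \<alpha>\<bar>) UNIV {1..int CARD('a)}"

definition flip_set :: "'a gperm \<Rightarrow> 'a set" where
  "flip_set p = {\<alpha>. snd p \<alpha> < 0}"

definition flip_perms :: "'a::finite gperm set" where
  "flip_perms = {p. gen_perm p \<and> flip_set p \<noteq> {}}"

definition lengths :: "(real ^ 'a::finite) set" where
  "lengths = {l. (\<forall>\<alpha>. 0 < l $ \<alpha>) \<and> (\<Sum>\<alpha>\<in>UNIV. l $ \<alpha>) = 1}"

definition left_end :: "'a::finite gperm \<Rightarrow> real ^ 'a \<Rightarrow> 'a \<Rightarrow> real" where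
  "left_end p l \<alpha> = (\<Sum>\<beta> | fst p \<beta> < fst p \<alpha>. l $ \<beta>)"

definition piece :: "'a::finite gperm \<Rightarrow> real ^ 'a \<Rightarrow> 'a \<Rightarrow> real set" where
  "piece p l \<alpha> = {left_end p l \<alpha> ..< left_end p l \<alpha> + l $ \<alpha>}"

definition branch :: "'a::finite gperm \<Rightarrow> real ^ 'a \<Rightarrow> 'a \<Rightarrow> real \<Rightarrow> real" where
  "branch p l \<alpha> x =
     (if \<alpha> \<notin> flip_set p
      then x + ((\<Sum>\<beta> | \<bar>snd p \<beta>\<bar> < \<bar>snd p \<alpha>\<bar>. l $ \<beta>) - (\<Sum>\<beta> | fst p \<beta> < fst p \<alpha>. l $ \<beta>))
      else ((\<Sum>\<beta> | \<bar>snd p \<beta>\<bar> \<le> \<bar>snd p \<alpha>\<bar>. l $ \<beta>) + (\<Sum>\<beta> | fst p \<beta> < fst p \<alpha>. l $ \<beta>)) - x)"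

definition fiet :: "'a::finite gperm \<Rightarrow> real ^ 'a \<Rightarrow> (real \<rightharpoonup> real)" where
  "fiet p l x =
     (if \<exists>\<alpha>. x \<in> interior (piece p l \<alpha>)
      then Some (branch p l (THE \<alpha>. x \<in> interior (piece p l \<alpha>)) x)
      else None)"

definition NUE :: "('a::finite gperm \<times> (real ^ 'a)) set" where
  "NUE = {(p, l). p \<in> flip_perms \<and> l \<in> lengths \<and>
                  minimal (fiet p l) \<and> \<not> uniquely_ergodic (fiet p l)}"

text \<open>
  The slices lie in the affine hyperplane of \<open>real ^ 'a\<close> where the coordinates sum to \<open>1\<close>; the
  Euclidean metric of that hyperplane is the restriction of the metric of \<open>real ^ 'a\<close>.
\<close>

definition Hdim :: "('a::finite gperm \<times> (real ^ 'a)) set \<Rightarrow> ereal" where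
  "Hdim S = Max ((\<lambda>p. hausdorff_dim {l. (p, l) \<in> S}) ` flip_perms)"

lemma finite_flip_perms: "finite (flip_perms :: 'a::finite gperm set)"
proof (rule finite_subset)
  show "(flip_perms :: 'a gperm set) \<subseteq>
      (UNIV \<rightarrow>\<^sub>E {1..CARD('a)}) \<times> (UNIV \<rightarrow>\<^sub>E {- int CARD('a)..int CARD('a)})"
  proof
    fix p :: "'a gperm" assume "p \<in> flip_perms"
    then have 1: "range (fst p) = {1..CARD('a)}"
      and 2: "range (snd p) \<subseteq> {- int CARD('a)..-1} \<union> {1..int CARD('a)}"
      by (simp_all add: flip_perms_def gen_perm_def bij_betw_def)
    have "fst p \<alpha> \<in> {1..CARD('a)}" for \<alpha>
      using 1 by blast
    moreover have "snd p \<alpha> \<in> {- int CARD('a)..int CARD('a)}" for \<alpha>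
    proof -
      have "snd p \<alpha> \<in> {- int CARD('a)..-1} \<union> {1..int CARD('a)}"
        using 2 by blast
      then show ?thesis by auto
    qed
    ultimately show "p \<in> (UNIV \<rightarrow>\<^sub>E {1..CARD('a)}) \<times> (UNIV \<rightarrow>\<^sub>E {- int CARD('a)..int CARD('a)})"
      by (cases p) (simp add: PiE_UNIV_domain)
  qed
  show "finite ((UNIV \<rightarrow>\<^sub>E {1..CARD('a)}) \<times> (UNIV \<rightarrow>\<^sub>E {- int CARD('a)..int CARD('a)})
      :: 'a gperm set)"
    by (intro finite_cartesian_product finite_PiE) auto
qed

lemma flip_perms_nonempty: "(flip_perms :: 'a::finite gperm set) \<noteq> {}"
proof -
  obtain h :: "'a \<Rightarrow> nat" where h: "bij_betw h UNIV {1..CARD('a)}"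
    using ex_bij_betw_finite_nat finite_same_card_bij[of "UNIV :: 'a set" "{1..CARD('a)}"] by auto
  have "bij_betw (\<lambda>\<alpha>. int (h \<alpha>)) UNIV {1..int CARD('a)}"
    using bij_betw_trans[OF h, of int "{1..int CARD('a)}"]
    by (simp add: bij_betw_def image_int_atLeastAtMost comp_def)
  moreover have range: "h \<alpha> \<in> {1..CARD('a)}" for \<alpha>
    using bij_betwE[OF h] by blast
  moreover have "range (\<lambda>\<alpha>. - int (h \<alpha>)) \<subseteq> {- int CARD('a)..-1}"
    using range by (auto simp: Suc_le_eq)
  ultimately have "(h, \<lambda>\<alpha>. - int (h \<alpha>)) \<in> flip_perms"
    using h by (auto simp: flip_perms_def gen_perm_def flip_set_def Suc_le_eq)
  then show ?thesis by auto
qed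

lemma left_end_mono:
  fixes l :: "real ^ 'a::finite"
  assumes "l \<in> lengths" and "fst p \<alpha> < fst p \<beta>"
  shows "left_end p l \<alpha> + l $ \<alpha> \<le> left_end p l \<beta>"
proof -
  have "left_end p l \<alpha> + l $ \<alpha> = (\<Sum>\<gamma> \<in> insert \<alpha> {\<gamma>. fst p \<gamma> < fst p \<alpha>}. l $ \<gamma>)"
    by (simp add: left_end_def)
  also have "\<dots> \<le> left_end p l \<beta>"
    unfolding left_end_def using assms
    by (intro sum_mono2) (auto simp: lengths_def intro: less_imp_le)
  finally show ?thesis .
qed

lemma fiet_eq_branch:
  assumes p: "gen_perm p" and l: "l \<in> lengths" and x: "x \<in> interior (piece p l \<alpha>)"
  shows "fiet p l x = Some (branch p l \<alpha> x)"
proof -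
  have "\<beta> = \<alpha>" if y: "x \<in> interior (piece p l \<beta>)" for \<beta>
  proof (rule ccontr)
    assume "\<beta> \<noteq> \<alpha>"
    then have "fst p \<beta> < fst p \<alpha> \<or> fst p \<alpha> < fst p \<beta>"
      using p by (metis bij_betw_imp_inj_on gen_perm_def injD linorder_neqE_nat)
    moreover have "x \<in> piece p l \<alpha>" "x \<in> piece p l \<beta>"
      using x y interior_subset[THEN subsetD] by metis+
    ultimately show False
      using left_end_mono[OF l, of p \<alpha> \<beta>] left_end_mono[OF l, of p \<beta> \<alpha>]
      unfolding piece_def atLeastLessThan_iff by linarith
  qed
  then have "(THE \<beta>. x \<in> interior (piece p l \<beta>)) = \<alpha>"
    using x by (rule the_equality[rotated])
  moreover have "\<exists>\<beta>. x \<in> interior (piece p l \<beta>)"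
    using x by blast
  ultimately show ?thesis
    by (simp add: fiet_def)
qed

end

theory Submission
  imports Defs
begin

text \<open>
  A minimal, non-uniquely ergodic exchange \<open>T\<close> of four intervals without flips becomes an exchange
  with flips when its last interval is turned over: conjugating \<open>T\<close> by the map that reflects this
  interval about its centre preserves density of orbits and the number of invariant measures, and
  creates a single new discontinuity. The conjugate \<open>f\<close> exchanges five intervals, two of
  them flipped. If the unflipped rest of the third interval is cut into \<open>k + 1\<close> adjacent pieces that move
  together, the result is an exchange of \<open>n = 5 + k\<close> intervals with the same dynamics off a finite
  set, and \<open>k\<close> of the lengths of the pieces can be chosen freely. One more free parameter comes from
  \<open>T\<close>, so that the lengths in \<open>NUE\<close> for one permutation are mapped onto an \<open>(n - 4)\<close>-dimensional
  box by Lipschitz functions (\<open>many_NUE\<close>, \<open>hausdorff_dim_ge_card_of_box_image\<close>). For \<open>n \<ge> 5\<close> this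
  gives \<open>[(n - 1) / 2] - 1 \<le> n - 4 \<le> Hdim NUE\<^sub>n\<close>, and for \<open>n \<le> 4\<close> the asserted bound is at most
  zero.

  \<open>T\<close> is Keane's example. Read from right to left, the first return map of \<open>T\<close> to its last interval
  is again an exchange of the same type, for lengths that depend linearly on the old ones and on two
  integers \<open>m k\<close>, \<open>n k\<close>, the numbers of steps that a point makes in the second and the third
  interval (\<open>first_return\<close>). When this can be repeated for ever, then for each level
  \<open>k\<close> the unit interval is filled, up to finitely many points, by four towers of intervals on which
  the iterates of \<open>T\<close> are translations (\<open>tower\<close>, \<open>finite_uncovered\<close>). Every tower of level \<open>k + 2\<close>
  runs through all the towers of level \<open>k\<close>, whence long orbit segments come close to every point
  (\<open>hits_open\<close>).

  When the integers grow fast, the towers over the first and the second interval of level \<open>k + 1\<close>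
  spend nearly all of their height in the second tower of level \<open>k\<close>, and the two other towers spend
  it in the third and the fourth. So the union of the first two towers changes
  by sets of summable measure as \<open>k\<close> grows, and its limit is an invariant set which is neither null
  nor of full measure (\<open>limit_side_invariant\<close>, \<open>limit_side_nontrivial\<close>): Lebesgue measure is not
  ergodic.

  The same estimate shows that the admissible lengths are plentiful. They form the intersection of a
  nested sequence of cones, and the cone of level \<open>k\<close> has one edge where the first two lengths make
  up at least \<open>7/8\<close> of the total and one where they make up at most \<open>1/8\<close>. By compactness, for each
  \<open>t \<in> [1/3, 2/3]\<close> there are admissible lengths of total \<open>1\<close> whose first two add up to \<open>t\<close>
  (\<open>fast_keane_exists\<close>). This \<open>t\<close> is the free parameter that comes from \<open>T\<close>.
\<close>

section \<open>A lower bound for the Hausdorff dimension\<close>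

text \<open>
  Lipschitz coordinates \<open>g i\<close> turn a cover of \<open>E\<close> by sets of diameters \<open>d\<^sub>k\<close> into a cover of the box
  by boxes with sides \<open>2 C d\<^sub>k\<close>. Comparing volumes bounds \<open>\<Sum> d\<^sub>k ^ card S\<close> from below, and
  diameters \<open>\<le> 1\<close> allow the exponent to be lowered.
\<close>
lemma hausdorff_dim_ge_card_of_box_image:
  fixes E :: "'m::metric_space set" and g :: "'i::finite \<Rightarrow> 'm \<Rightarrow> real" and S :: "'i set"
  assumes lip: "\<And>i u v. i \<in> S \<Longrightarrow> \<bar>g i u - g i v\<bar> \<le> C * dist u v"
    and box: "\<And>i. i \<in> S \<Longrightarrow> lo i < hi i"
    and onto: "\<And>y. (\<And>i. i \<in> S \<Longrightarrow> lo i \<le> y i \<and> y i \<le> hi i) \<Longrightarrow> \<exists>u\<in>E. \<forall>i\<in>S. g i u = y i"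
    and C: "0 < C"
  shows "ereal (real (card S)) \<le> hausdorff_dim E"
  unfolding hausdorff_dim_def
proof (rule INF_greatest, clarify)
  fix s :: real
  assume s: "0 \<le> s" and null: "hausdorff_measure s E = 0"
  show "ereal (real (card S)) \<le> ereal s"
  proof (rule ccontr)
    assume "\<not> ereal (real (card S)) \<le> ereal s"
    then have sS: "s \<le> real (card S)" by simp
    define F :: "(real ^ 'i) set" where
      "F = cbox (\<chi> i. if i \<in> S then lo i else 0) (\<chi> i. if i \<in> S then hi i else 1)"
    define K where "K = (2 * C) ^ card S"
    have K: "0 < K" using C by (simp add: K_def)
    have ne: "F \<noteq> {}"
      unfolding F_def interval_ne_empty_cart using box by (auto intro: less_imp_le)
    have "0 < (if i \<in> S then hi i else 1) - (if i \<in> S then lo i else 0)" for i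
      using box[of i] by auto
    then have volF: "0 < measure lborel F"
      using ne unfolding F_def by (subst content_cbox_cart) (auto intro!: prod_pos)
    have fin: "emeasure lborel (cbox a b) \<noteq> top" for a b :: "real ^ 'i"
      using emeasure_lborel_cbox_finite[of a b] by auto
    have key: "ennreal (measure lborel F / K) \<le> (\<Sum>i. ennreal (hausdorff_gauge s (U i)))"
      if U: "U \<in> hausdorff_covers 1 E" for U :: "nat \<Rightarrow> 'm set"
    proof -
      have cov: "E \<subseteq> (\<Union>k. U k)" and bd: "\<And>k. bounded (U k)" and d1: "\<And>k. diameter (U k) \<le> 1"
        using U by (auto simp: hausdorff_covers_def)
      define c where "c k = (SOME u. u \<in> U k)" for k
      have c: "c k \<in> U k" if "U k \<noteq> {}" for k
        using that unfolding c_def by (auto intro: someI)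
      define d where "d k = diameter (U k)" for k
      have d0: "0 \<le> d k" for k unfolding d_def by (rule diameter_ge_0[OF bd])
      \<comment> \<open>The coordinates outside \<open>S\<close> are padded by \<open>[0,1]\<close>, so that Lebesgue measure on the whole
        space measures the boxes in the coordinates of \<open>S\<close>.\<close>
      define B :: "nat \<Rightarrow> (real ^ 'i) set" where
        "B k = (if U k = {} then {} else
           cbox (\<chi> i. if i \<in> S then g i (c k) - C * d k else 0)
                (\<chi> i. if i \<in> S then g i (c k) + C * d k else 1))" for k
      have "F \<subseteq> (\<Union>k. B k)"
      proof
        fix y assume y: "y \<in> F"
        then have "lo i \<le> y $ i \<and> y $ i \<le> hi i" if "i \<in> S" for i
          using that unfolding F_def mem_box_cart by (auto dest: spec[of _ i])
        then obtain u where u: "u \<in> E" "\<forall>i\<in>S. g i u = y $ i" using onto[of "\<lambda>i. y $ i"] by auto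
        then obtain k where k: "u \<in> U k" using cov by auto
        have "dist u (c k) \<le> d k" unfolding d_def
          by (rule diameter_bounded_bound[OF bd k]) (use c k in auto)
        then have "\<bar>y $ i - g i (c k)\<bar> \<le> C * d k" if "i \<in> S" for i
          using lip[OF that, of u "c k"] u(2) that C
          by (smt (verit, best) mult_left_mono)
        then have "y \<in> B k"
          using k y unfolding B_def F_def by (auto simp: mem_box_cart abs_le_iff algebra_simps) (smt (verit))+
        then show "y \<in> (\<Union>k. B k)" by auto
      qed
      then have "emeasure lborel F \<le> emeasure lborel (\<Union>k. B k)"
        by (intro emeasure_mono) (auto simp: B_def)
      also have "\<dots> \<le> (\<Sum>k. emeasure lborel (B k))"
        by (intro emeasure_subadditive_countably) (auto simp: B_def)
      also have "\<dots> \<le> (\<Sum>k. ennreal K * ennreal (hausdorff_gauge s (U k)))"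
      proof (intro suminf_le summableI)
        fix k
        show "emeasure lborel (B k) \<le> ennreal K * ennreal (hausdorff_gauge s (U k))"
        proof (cases "U k = {}")
          case True then show ?thesis by (simp add: B_def)
        next
          case False
          have ne: "B k \<noteq> {}"
            using False d0[of k] C unfolding B_def by (auto simp: interval_ne_empty_cart)
          have "measure lborel (B k) =
              (\<Prod>i\<in>UNIV. if i \<in> S then 2 * C * d k else 1)"
            using ne False unfolding B_def
            by (simp add: content_cbox_cart) (rule prod.cong, auto split: if_splits)
          also have "\<dots> = (2 * C * d k) ^ card S"
            by (simp add: prod.If_cases)
          also have "\<dots> = K * d k ^ card S" by (simp add: K_def power_mult_distrib)
          also have "\<dots> \<le> K * hausdorff_gauge s (U k)"
          proof (intro mult_left_mono)
            show "d k ^ card S \<le> hausdorff_gauge s (U k)"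
            proof (cases "s = 0 \<or> d k = 0")
              case True
              then show ?thesis using False d0[of k] d1[of k] sS s
                by (auto simp: hausdorff_gauge_def d_def power_le_one power_0_left split: if_splits)
            next
              case sd: False
              then have "d k ^ card S = d k powr real (card S)"
                using d0[of k] by (simp add: powr_realpow)
              also have "\<dots> \<le> d k powr s"
                using sd d0[of k] d1[of k] sS by (intro powr_mono') (auto simp: d_def)
              finally show ?thesis using sd False by (simp add: hausdorff_gauge_def d_def)
            qed
          qed (use K in simp)
          finally have m: "measure lborel (B k) \<le> K * hausdorff_gauge s (U k)" .
          have "emeasure lborel (B k) = ennreal (measure lborel (B k))"
            using False by (intro emeasure_eq_ennreal_measure) (simp add: B_def fin)
          also have "\<dots> \<le> ennreal (K * hausdorff_gauge s (U k))" by (rule ennreal_leI[OF m])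
          also have "\<dots> = ennreal K * ennreal (hausdorff_gauge s (U k))"
            using K by (intro ennreal_mult) (auto simp: hausdorff_gauge_def)
          finally show ?thesis .
        qed
      qed
      also have "\<dots> = ennreal K * (\<Sum>k. ennreal (hausdorff_gauge s (U k)))"
        by (rule ennreal_suminf_cmult)
      finally have le: "emeasure lborel F \<le> ennreal K * (\<Sum>k. ennreal (hausdorff_gauge s (U k)))" .
      have "emeasure lborel F = ennreal (measure lborel F)"
        by (intro emeasure_eq_ennreal_measure) (simp add: F_def fin)
      then have "ennreal (measure lborel F / K) = inverse (ennreal K) * emeasure lborel F"
        using K by (simp add: ennreal_mult''[symmetric] inverse_ennreal divide_inverse mult.commute)
      also have "\<dots> \<le> inverse (ennreal K) * (ennreal K * (\<Sum>k. ennreal (hausdorff_gauge s (U k))))"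
        by (intro mult_left_mono le) auto
      also have "\<dots> = (\<Sum>k. ennreal (hausdorff_gauge s (U k)))"
        using K by (simp add: mult.assoc[symmetric] inverse_ennreal ennreal_mult''[symmetric])
      finally show ?thesis .
    qed
    have "0 < ennreal (measure lborel F / K)" using volF K by simp
    also have "\<dots> \<le> hausdorff_premeasure 1 s E"
      unfolding hausdorff_premeasure_def by (rule INF_greatest) (rule key)
    also have "\<dots> \<le> hausdorff_measure s E"
      unfolding hausdorff_measure_def by (rule SUP_upper) simp
    finally show False using null by simp
  qed
qed

section \<open>Lebesgue measure and exchanges with flips\<close>

text \<open>
  With \<open>q = \<pi>\<^sub>0\<close> these are the left ends of the intervals of the domain, with \<open>q = \<bar>\<pi>\<^sub>1\<bar>\<close> those of
  their images; both partitions are handled by the same lemmas.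
\<close>
definition offset :: "('a::finite \<Rightarrow> 'b::linorder) \<Rightarrow> real ^ 'a \<Rightarrow> 'a \<Rightarrow> real" where
  "offset q l \<alpha> = (\<Sum>\<beta> | q \<beta> < q \<alpha>. l $ \<beta>)"

abbreviation cell :: "('a::finite \<Rightarrow> 'b::linorder) \<Rightarrow> real ^ 'a \<Rightarrow> 'a \<Rightarrow> real set" where
  "cell q l \<alpha> \<equiv> {offset q l \<alpha> <..< offset q l \<alpha> + l $ \<alpha>}"

lemma offset_nonneg: "l \<in> lengths \<Longrightarrow> 0 \<le> offset q l \<alpha>"
  unfolding offset_def lengths_def by (auto intro!: sum_nonneg intro: less_imp_le)

lemma offset_add_eq:
  fixes l :: "real ^ 'a::finite"
  assumes "inj q"
  shows "offset q l \<alpha> + l $ \<alpha> = (\<Sum>\<beta> | q \<beta> \<le> q \<alpha>. l $ \<beta>)"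
proof -
  have "{\<beta>. q \<beta> \<le> q \<alpha>} = insert \<alpha> {\<beta>. q \<beta> < q \<alpha>}"
    using assms by (auto simp: le_less inj_def)
  then show ?thesis by (simp add: offset_def)
qed

lemma offset_add_le:
  fixes l :: "real ^ 'a::finite"
  assumes "inj q" "l \<in> lengths" "q \<alpha> < q \<beta>"
  shows "offset q l \<alpha> + l $ \<alpha> \<le> offset q l \<beta>"
  unfolding offset_add_eq[OF assms(1)] unfolding offset_def
  using assms(2,3) by (intro sum_mono2) (auto simp: lengths_def intro: less_imp_le)

lemma offset_add_le_1:
  fixes l :: "real ^ 'a::finite"
  assumes "inj q" "l \<in> lengths"
  shows "offset q l \<alpha> + l $ \<alpha> \<le> 1"
proof -
  have "(\<Sum>\<beta> | q \<beta> \<le> q \<alpha>. l $ \<beta>) \<le> (\<Sum>\<beta>\<in>UNIV. l $ \<beta>)"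
    using assms(2) by (intro sum_mono2) (auto simp: lengths_def intro: less_imp_le)
  then show ?thesis using assms by (simp add: offset_add_eq lengths_def)
qed

lemma disjoint_cells:
  assumes "inj q" "l \<in> lengths" "\<alpha> \<noteq> \<beta>"
  shows "cell q l \<alpha> \<inter> cell q l \<beta> = {}"
proof -
  have "q \<alpha> < q \<beta> \<or> q \<beta> < q \<alpha>" using assms(1,3) by (metis injD linorder_neqE)
  then show ?thesis
    using offset_add_le[OF assms(1,2), of \<alpha> \<beta>] offset_add_le[OF assms(1,2), of \<beta> \<alpha>] by force
qed

lemma emeasure_Union_cells:
  fixes l :: "real ^ 'a::finite"
  assumes "inj q" "l \<in> lengths"
  shows "emeasure lborel (\<Union>\<alpha>. cell q l \<alpha>) = 1"
proof -
  have "emeasure lborel (\<Union>\<alpha>. cell q l \<alpha>) = (\<Sum>\<alpha>\<in>UNIV. emeasure lborel (cell q l \<alpha>))"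
    using disjoint_cells[OF assms] by (intro sum_emeasure[symmetric]) (auto simp: disjoint_family_on_def)
  also have "\<dots> = (\<Sum>\<alpha>\<in>UNIV. ennreal (l $ \<alpha>))"
    using assms(2) by (intro sum.cong) (auto simp: lengths_def less_imp_le)
  also have "\<dots> = ennreal (\<Sum>\<alpha>\<in>UNIV. l $ \<alpha>)"
    using assms(2) by (intro sum_ennreal) (auto simp: lengths_def less_imp_le)
  finally show ?thesis using assms(2) by (simp add: lengths_def)
qed

lemma emeasure_lborel_isometry_vimage:
  fixes c \<sigma> :: real
  assumes "\<sigma> = 1 \<or> \<sigma> = -1" "E \<in> sets borel"
  shows "emeasure lborel ((\<lambda>x. c + \<sigma> * x) -` E) = emeasure lborel E"
proof -
  have "lborel = distr lborel borel (\<lambda>x. c + \<sigma> * x)"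
    using lborel_real_affine[of \<sigma> c] assms(1) by (auto simp: density_1)
  then have "emeasure lborel E = emeasure (distr lborel borel (\<lambda>x. c + \<sigma> * x)) E" by simp
  also have "\<dots> = emeasure lborel ((\<lambda>x. c + \<sigma> * x) -` E)"
    using assms(2) by (subst emeasure_distr) auto
  finally show ?thesis by simp
qed

context
  fixes p :: "'a::finite gperm" and l :: "real ^ 'a"
  assumes p: "gen_perm p" and l: "l \<in> lengths"
begin

lemma inj_fst: "inj (fst p)" and inj_abs_snd: "inj (\<lambda>\<alpha>. \<bar>snd p \<alpha>\<bar>)"
  using p by (auto simp: gen_perm_def bij_betw_def)

lemma interior_piece: "interior (piece p l \<alpha>) = cell (fst p) l \<alpha>"
  by (simp add: piece_def left_end_def offset_def)

lemma branch_affine: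
  "\<exists>c \<sigma>. (\<sigma> = 1 \<or> \<sigma> = -1) \<and> branch p l \<alpha> = (\<lambda>x. c + \<sigma> * x)"
  "x \<in> cell (fst p) l \<alpha> \<longleftrightarrow> branch p l \<alpha> x \<in> cell (\<lambda>\<alpha>. \<bar>snd p \<alpha>\<bar>) l \<alpha>"
proof -
  define t where "t = offset (\<lambda>\<alpha>. \<bar>snd p \<alpha>\<bar>) l \<alpha>"
  have t: "t + l $ \<alpha> = (\<Sum>\<beta> | \<bar>snd p \<beta>\<bar> \<le> \<bar>snd p \<alpha>\<bar>. l $ \<beta>)"
    unfolding t_def by (rule offset_add_eq[OF inj_abs_snd])
  have br: "branch p l \<alpha> x = (if \<alpha> \<in> flip_set p then t + l $ \<alpha> + offset (fst p) l \<alpha> + (-1) * x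
      else t - offset (fst p) l \<alpha> + 1 * x)" for x
    unfolding t by (simp add: branch_def offset_def t_def)
  show "\<exists>c \<sigma>. (\<sigma> = 1 \<or> \<sigma> = -1) \<and> branch p l \<alpha> = (\<lambda>x. c + \<sigma> * x)"
    by (cases "\<alpha> \<in> flip_set p") (simp_all only: br fun_eq_iff if_True if_False, blast+)
  show "x \<in> cell (fst p) l \<alpha> \<longleftrightarrow> branch p l \<alpha> x \<in> cell (\<lambda>\<alpha>. \<bar>snd p \<alpha>\<bar>) l \<alpha>"
    unfolding br t_def[symmetric] by auto
qed

lemma fiet_Some_iff:
  "fiet p l x = Some y \<longleftrightarrow> (\<exists>\<alpha>. x \<in> cell (fst p) l \<alpha> \<and> y = branch p l \<alpha> x)"
proof
  assume y: "fiet p l x = Some y"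
  then obtain \<alpha> where \<alpha>: "x \<in> interior (piece p l \<alpha>)"
    by (auto simp: fiet_def split: if_splits)
  then show "\<exists>\<alpha>. x \<in> cell (fst p) l \<alpha> \<and> y = branch p l \<alpha> x"
    using fiet_eq_branch[OF p l \<alpha>] y by (auto simp: interior_piece)
qed (use fiet_eq_branch[OF p l] interior_piece in auto)

lemma fiet_locally_isometric:
  assumes "fiet p l x = Some y"
  shows "0 < x \<and> x < 1 \<and> 0 < y \<and> y < 1"
    "\<exists>\<epsilon>>0. \<exists>\<sigma>. (\<sigma> = 1 \<or> \<sigma> = -1) \<and> (\<forall>z. \<bar>z - x\<bar> < \<epsilon> \<longrightarrow> fiet p l z = Some (y + \<sigma> * (z - x)))"
proof -
  obtain \<alpha> where \<alpha>: "x \<in> cell (fst p) l \<alpha>" "y = branch p l \<alpha> x"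
    using assms by (auto simp: fiet_Some_iff)
  obtain c \<sigma> where b: "\<sigma> = 1 \<or> \<sigma> = -1" "branch p l \<alpha> = (\<lambda>x. c + \<sigma> * x)"
    using branch_affine(1)[of \<alpha>] by blast
  have "y \<in> cell (\<lambda>\<alpha>. \<bar>snd p \<alpha>\<bar>) l \<alpha>" using \<alpha> branch_affine(2)[of x \<alpha>] by simp
  then show "0 < x \<and> x < 1 \<and> 0 < y \<and> y < 1"
    using \<alpha>(1) offset_nonneg[OF l, of "fst p" \<alpha>] offset_add_le_1[OF inj_fst l, of \<alpha>]
      offset_nonneg[OF l, of "\<lambda>\<alpha>. \<bar>snd p \<alpha>\<bar>" \<alpha>] offset_add_le_1[OF inj_abs_snd l, of \<alpha>] by auto
  obtain \<epsilon> where \<epsilon>: "\<epsilon> > 0" "ball x \<epsilon> \<subseteq> cell (fst p) l \<alpha>"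
    using \<alpha>(1) open_contains_ball[of "cell (fst p) l \<alpha>"] open_greaterThanLessThan by blast
  show "\<exists>\<epsilon>>0. \<exists>\<sigma>. (\<sigma> = 1 \<or> \<sigma> = -1) \<and> (\<forall>z. \<bar>z - x\<bar> < \<epsilon> \<longrightarrow> fiet p l z = Some (y + \<sigma> * (z - x)))"
  proof (intro exI conjI allI impI)
    fix z assume "\<bar>z - x\<bar> < \<epsilon>"
    then have "z \<in> cell (fst p) l \<alpha>" using \<epsilon>(2) by (auto simp: dist_real_def abs_minus_commute)
    then have "fiet p l z = Some (branch p l \<alpha> z)" by (auto simp: fiet_Some_iff)
    then show "fiet p l z = Some (y + \<sigma> * (z - x))"
      by (simp add: \<alpha>(2) b(2) algebra_simps)
  qed (use \<epsilon> b in auto)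
qed

text \<open>
  The branches carry the cells of the domain isometrically onto the cells of the image order, and the
  latter fill the unit interval up to a null set.
\<close>
lemma lebesgue_invariant_fiet:
  assumes E: "E \<in> sets borel"
  shows "{x. \<exists>y\<in>E. fiet p l x = Some y} \<in> sets borel"
    "emeasure lborel {x. \<exists>y\<in>E. fiet p l x = Some y} = emeasure lborel (E \<inter> {0..<1})"
proof -
  define J where "J = (\<lambda>\<alpha>. cell (\<lambda>\<alpha>. \<bar>snd p \<alpha>\<bar>) l \<alpha>)"
  define P where "P \<alpha> = branch p l \<alpha> -` (E \<inter> J \<alpha>)" for \<alpha>
  have P_cell: "P \<alpha> \<subseteq> cell (fst p) l \<alpha>" for \<alpha>
    using branch_affine(2)[of _ \<alpha>] by (auto simp: P_def J_def simp del: greaterThanLessThan_iff)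
  have Jm: "J \<alpha> \<in> sets borel" for \<alpha> by (simp add: J_def)
  have Jd: "J \<alpha> \<inter> J \<beta> = {}" if "\<alpha> \<noteq> \<beta>" for \<alpha> \<beta>
    unfolding J_def by (rule disjoint_cells[OF inj_abs_snd l that])
  have "disjoint_family (\<lambda>\<alpha>. E \<inter> J \<alpha>)"
    unfolding disjoint_family_on_def using Jd by blast
  have preim: "{x. \<exists>y\<in>E. fiet p l x = Some y} = (\<Union>\<alpha>. P \<alpha>)"
  proof (intro set_eqI iffI)
    fix x assume "x \<in> {x. \<exists>y\<in>E. fiet p l x = Some y}"
    then obtain \<alpha> where "branch p l \<alpha> x \<in> E" "x \<in> cell (fst p) l \<alpha>"
      by (auto simp: fiet_Some_iff)
    then show "x \<in> (\<Union>\<alpha>. P \<alpha>)"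
      using branch_affine(2)[of x \<alpha>] unfolding P_def J_def by blast
  next
    fix x assume "x \<in> (\<Union>\<alpha>. P \<alpha>)"
    then obtain \<alpha> where "x \<in> P \<alpha>" by auto
    then show "x \<in> {x. \<exists>y\<in>E. fiet p l x = Some y}"
      using P_cell[of \<alpha>] fiet_Some_iff unfolding P_def by blast
  qed
  have Pm: "P \<alpha> \<in> sets borel" and Pe: "emeasure lborel (P \<alpha>) = emeasure lborel (E \<inter> J \<alpha>)" for \<alpha>
  proof -
    obtain c \<sigma> where b: "\<sigma> = 1 \<or> \<sigma> = -1" "branch p l \<alpha> = (\<lambda>x. c + \<sigma> * x)"
      using branch_affine(1)[of \<alpha>] by blast
    have "(\<lambda>x. c + \<sigma> * x) -` (E \<inter> J \<alpha>) \<inter> space borel \<in> sets borel"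
      by (rule measurable_sets[where A = borel]) (use E Jm in auto)
    then show "P \<alpha> \<in> sets borel" by (simp add: P_def b)
    show "emeasure lborel (P \<alpha>) = emeasure lborel (E \<inter> J \<alpha>)"
      unfolding P_def b(2) by (rule emeasure_lborel_isometry_vimage[OF b(1)]) (use E Jm in auto)
  qed
  show "{x. \<exists>y\<in>E. fiet p l x = Some y} \<in> sets borel"
    unfolding preim using Pm by auto
  have "P \<alpha> \<inter> P \<beta> = {}" if "\<alpha> \<noteq> \<beta>" for \<alpha> \<beta>
    using P_cell[of \<alpha>] P_cell[of \<beta>] disjoint_cells[OF inj_fst l that] by blast
  then have "emeasure lborel (\<Union>\<alpha>. P \<alpha>) = (\<Sum>\<alpha>\<in>UNIV. emeasure lborel (P \<alpha>))"
    using Pm by (intro sum_emeasure[symmetric]) (auto simp: disjoint_family_on_def)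
  also have "\<dots> = (\<Sum>\<alpha>\<in>UNIV. emeasure lborel (E \<inter> J \<alpha>))" by (simp add: Pe)
  also have "\<dots> = emeasure lborel (\<Union>\<alpha>. E \<inter> J \<alpha>)"
    using E Jm \<open>disjoint_family _\<close> by (intro sum_emeasure) auto
  also have "\<dots> = emeasure lborel (E \<inter> {0..<1})"
  proof -
    have "(\<Union>\<alpha>. J \<alpha>) \<subseteq> {0..<1}"
    proof (rule UN_least, rule subsetI)
      fix \<alpha> x assume "x \<in> J \<alpha>"
      then show "x \<in> {0..<1}"
        using offset_nonneg[OF l, of "\<lambda>\<alpha>. \<bar>snd p \<alpha>\<bar>" \<alpha>] offset_add_le_1[OF inj_abs_snd l, of \<alpha>]
        by (auto simp: J_def)
    qed
    moreover have "emeasure lborel (\<Union>\<alpha>. J \<alpha>) = 1"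
      unfolding J_def by (rule emeasure_Union_cells[OF inj_abs_snd l])
    ultimately have "emeasure lborel ({0..<1} - (\<Union>\<alpha>. J \<alpha>)) = 0"
      using Jm by (subst emeasure_Diff) auto
    then have "{0..<1} - (\<Union>\<alpha>. J \<alpha>) \<in> null_sets lborel"
      using Jm by (intro null_setsI) auto
    then have "AE x in lborel. x \<notin> {0..<1} - (\<Union>\<alpha>. J \<alpha>)" by (rule AE_not_in)
    then have "AE x in lborel. x \<in> (\<Union>\<alpha>. E \<inter> J \<alpha>) \<longleftrightarrow> x \<in> E \<inter> {0..<1}"
      by eventually_elim (use \<open>(\<Union>\<alpha>. J \<alpha>) \<subseteq> {0..<1}\<close> in blast)
    then show ?thesis using E Jm by (intro emeasure_eq_AE) auto
  qed
  finally show "emeasure lborel {x. \<exists>y\<in>E. fiet p l x = Some y} = emeasure lborel (E \<inter> {0..<1})"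
    using preim by simp
qed

lemma emeasure_undefined_fiet:
  "{0..<1} - dom (fiet p l) \<in> sets borel" "emeasure lborel ({0..<1} - dom (fiet p l)) = 0"
proof -
  have "dom (fiet p l) = {x. \<exists>y\<in>UNIV. fiet p l x = Some y}" by auto
  then have d: "dom (fiet p l) \<in> sets borel" "emeasure lborel (dom (fiet p l)) = 1"
    using lebesgue_invariant_fiet[of UNIV] by auto
  have "dom (fiet p l) \<subseteq> {0..<1}" using fiet_locally_isometric(1) by (auto simp: less_imp_le)
  then show "{0..<1} - dom (fiet p l) \<in> sets borel" "emeasure lborel ({0..<1} - dom (fiet p l)) = 0"
    using d by (auto simp: emeasure_Diff)
qed

text \<open>An invariant set of positive measure carries an invariant measure, namely normalised Lebesgue measure.\<close>
lemma invariant_measure_uniform_on: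
  assumes C: "C \<in> sets borel" "C \<subseteq> {0..<1}" "emeasure lborel C \<noteq> 0"
    and inv: "AE x in lborel. \<forall>y. fiet p l x = Some y \<longrightarrow> (y \<in> C \<longleftrightarrow> x \<in> C)"
  defines "\<mu> \<equiv> restrict_space (uniform_measure lborel C) {0..<1}"
  shows "invariant_measure (fiet p l) \<mu>"
    "\<And>E. E \<in> sets borel \<Longrightarrow> E \<subseteq> {0..<1} \<Longrightarrow> emeasure \<mu> E = emeasure lborel (C \<inter> E) / emeasure lborel C"
proof -
  have Cfin: "emeasure lborel C \<noteq> \<infinity>"
    using emeasure_mono[OF C(2), of lborel] by (auto simp: top_unique)
  show \<mu>: "emeasure \<mu> E = emeasure lborel (C \<inter> E) / emeasure lborel C"
    if "E \<in> sets borel" "E \<subseteq> {0..<1}" for E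
    using that C(1) unfolding \<mu>_def by (subst emeasure_restrict_space) auto
  have setsmu: "sets \<mu> = sets (restrict_space borel {0..<1})"
    unfolding \<mu>_def by (rule sets_restrict_space_cong) simp
  have "C \<inter> {0..<1} = C" using C(2) by auto
  then have "emeasure \<mu> {0..<1} = 1"
    using \<mu>[of "{0..<1}"] C Cfin by (simp add: ennreal_divide_self less_top)
  then have prob: "prob_space \<mu>"
    by (intro prob_spaceI) (simp add: \<mu>_def space_restrict_space)
  show "invariant_measure (fiet p l) \<mu>"
    unfolding invariant_measure_def
  proof (intro conjI prob setsmu ballI)
    have "emeasure lborel (C \<inter> ({0..<1} - dom (fiet p l))) = 0"
      using emeasure_mono[of "C \<inter> ({0..<1} - dom (fiet p l))" "{0..<1} - dom (fiet p l)" lborel]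
        emeasure_undefined_fiet by simp
    then show "emeasure \<mu> ({0..<1} - dom (fiet p l)) = 0"
      using emeasure_undefined_fiet(1) by (subst \<mu>) auto
    fix E assume "E \<in> sets \<mu>"
    then have E: "E \<in> sets borel" "E \<subseteq> {0..<1}"
      by (auto simp: setsmu sets_restrict_space_iff)
    let ?P = "\<lambda>E. {x. \<exists>y\<in>E. fiet p l x = Some y}"
    have "?P E \<subseteq> {0..<1}" using fiet_locally_isometric(1) by (auto simp: less_imp_le)
    have "emeasure lborel (C \<inter> ?P E) = emeasure lborel (?P (C \<inter> E))"
      using inv C E lebesgue_invariant_fiet(1) by (intro emeasure_eq_AE) auto
    also have "\<dots> = emeasure lborel (C \<inter> E)"
      using C E by (subst lebesgue_invariant_fiet(2)) (auto intro!: arg_cong[where f = "emeasure lborel"])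
    finally show "emeasure \<mu> (?P E) = emeasure \<mu> E"
      using E lebesgue_invariant_fiet(1)[OF E(1)] \<open>?P E \<subseteq> {0..<1}\<close> by (simp add: \<mu>)
  qed
qed

text \<open>The normalised Lebesgue measures on \<open>A\<close> and on its complement are invariant and distinct.\<close>
lemma not_uniquely_ergodicI:
  assumes A: "A \<in> sets borel" "A \<subseteq> {0..<1}"
    and pos: "emeasure lborel A \<noteq> 0" "emeasure lborel ({0..<1} - A) \<noteq> 0"
    and inv: "AE x in lborel. \<forall>y. fiet p l x = Some y \<longrightarrow> (y \<in> A \<longleftrightarrow> x \<in> A)"
  shows "\<not> uniquely_ergodic (fiet p l)"
proof
  assume ue: "uniquely_ergodic (fiet p l)"
  define \<mu> where "\<mu> C = restrict_space (uniform_measure lborel C) {0..<1::real}" for C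
  define B where "B = {0..<1} - A"
  have B: "B \<in> sets borel" "B \<subseteq> {0..<1}" "emeasure lborel B \<noteq> 0"
    using A pos by (auto simp: B_def)
  have invB: "AE x in lborel. \<forall>y. fiet p l x = Some y \<longrightarrow> (y \<in> B \<longleftrightarrow> x \<in> B)"
    using inv by eventually_elim (auto simp: B_def dest: fiet_locally_isometric(1))
  have "\<mu> A = \<mu> B"
    using ue invariant_measure_uniform_on(1)[OF A pos(1) inv] invariant_measure_uniform_on(1)[OF B invB]
    unfolding uniquely_ergodic_def \<mu>_def by blast
  moreover have "B \<inter> A = {}" by (auto simp: B_def)
  then have "emeasure (\<mu> B) A = 0"
    unfolding \<mu>_def invariant_measure_uniform_on(2)[OF B invB A] by simp
  moreover have "emeasure (\<mu> A) A = 1"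
  proof -
    have "emeasure lborel A \<noteq> \<infinity>"
      using emeasure_mono[OF A(2), of lborel] by (auto simp: top_unique)
    then show ?thesis
      unfolding \<mu>_def invariant_measure_uniform_on(2)[OF A pos(1) inv A]
      using pos(1) by (simp add: ennreal_divide_self less_top)
  qed
  ultimately show False by simp
qed

end

section \<open>A criterion for minimality\<close>

lemma map_iter_0: "map_iter f 0 x = Some x"
  by (simp add: map_iter_def)

lemma map_iter_Suc: "map_iter f (Suc k) x = Some z \<longleftrightarrow> (\<exists>y. map_iter f k x = Some y \<and> f y = Some z)"
  by (simp add: map_iter_def map_comp_Some_iff)

lemma map_iter_add:
  "map_iter f (j + k) x = Some z \<longleftrightarrow> (\<exists>y. map_iter f k x = Some y \<and> map_iter f j y = Some z)"
proof (induction j arbitrary: z)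
  case (Suc j)
  show ?case unfolding add_Suc map_iter_Suc Suc.IH by blast
qed (simp add: map_iter_0)

text \<open>
  This form of density passes between a map and its modifications on finite sets, since \<open>E\<close> can absorb
  the points where they differ. Being about finite segments, it serves forward and backward orbits
  alike.
\<close>
definition hits :: "('x \<rightharpoonup> 'x) \<Rightarrow> 'x set \<Rightarrow> nat \<Rightarrow> 'x set \<Rightarrow> bool" where
  "hits f E N U \<longleftrightarrow> (\<forall>u. (\<forall>i<N. f (u i) = Some (u (Suc i))) \<and> (\<forall>i\<le>N. u i \<notin> E) \<longrightarrow> (\<exists>i\<le>N. u i \<in> U))"

lemma hitsD:
  assumes "hits f E N U" "\<And>i. i < N \<Longrightarrow> f (u i) = Some (u (Suc i))" "\<And>i. i \<le> N \<Longrightarrow> u i \<notin> E"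
  shows "\<exists>i\<le>N. u i \<in> U"
  using assms unfolding hits_def by blast

locale hitting_map =
  fixes f :: "real \<rightharpoonup> real"
  assumes locally_isometric: "f x = Some y \<Longrightarrow>
      \<exists>\<epsilon>>0. \<exists>\<sigma>. (\<sigma> = 1 \<or> \<sigma> = -1) \<and> (\<forall>z. \<bar>z - x\<bar> < \<epsilon> \<longrightarrow> f z = Some (y + \<sigma> * (z - x)))"
    and hitting: "open U \<Longrightarrow> U \<inter> {0<..<1} \<noteq> {} \<Longrightarrow> \<exists>N E. finite E \<and> hits f E N U"
begin

text \<open>
  A whole orbit segment of length \<open>q\<close> is followed isometrically by all nearby points; the sign may
  change with the time and is chosen pointwise.
\<close>
lemma iterates_locally_isometric:
  assumes "\<And>i. i < q \<Longrightarrow> f (u i) = Some (u (Suc i))"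
  shows "\<exists>\<epsilon>>0. \<forall>z. \<bar>z - u 0\<bar> < \<epsilon> \<longrightarrow>
    (\<forall>i\<le>q. \<exists>\<sigma>. (\<sigma> = 1 \<or> \<sigma> = -1) \<and> map_iter f i z = Some (u i + \<sigma> * (z - u 0)))"
  using assms
proof (induction q)
  case 0
  show ?case by (intro exI[of _ 1]) (auto simp: map_iter_0 intro: exI[of _ 1])
next
  case (Suc q)
  then obtain \<epsilon> where \<epsilon>: "\<epsilon> > 0" "\<forall>z. \<bar>z - u 0\<bar> < \<epsilon> \<longrightarrow>
    (\<forall>i\<le>q. \<exists>\<sigma>. (\<sigma> = 1 \<or> \<sigma> = -1) \<and> map_iter f i z = Some (u i + \<sigma> * (z - u 0)))"
    by auto
  obtain \<epsilon>' \<tau> where \<epsilon>': "\<epsilon>' > 0" "\<tau> = 1 \<or> \<tau> = -1"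
    "\<forall>z. \<bar>z - u q\<bar> < \<epsilon>' \<longrightarrow> f z = Some (u (Suc q) + \<tau> * (z - u q))"
    using locally_isometric[OF Suc.prems[of q]] by auto
  show ?case
  proof (rule exI[of _ "min \<epsilon> \<epsilon>'"], intro conjI allI impI)
    fix z i assume z: "\<bar>z - u 0\<bar> < min \<epsilon> \<epsilon>'" and i: "i \<le> Suc q"
    show "\<exists>\<sigma>. (\<sigma> = 1 \<or> \<sigma> = -1) \<and> map_iter f i z = Some (u i + \<sigma> * (z - u 0))"
    proof (cases "i = Suc q")
      case True
      obtain \<sigma> where \<sigma>: "\<sigma> = 1 \<or> \<sigma> = -1" "map_iter f q z = Some (u q + \<sigma> * (z - u 0))"
        using \<epsilon>(2) z by auto
      have "\<bar>u q + \<sigma> * (z - u 0) - u q\<bar> < \<epsilon>'" using \<sigma>(1) z by auto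
      then have "f (u q + \<sigma> * (z - u 0)) = Some (u (Suc q) + \<tau> * (u q + \<sigma> * (z - u 0) - u q))"
        using \<epsilon>'(3) by blast
      then have "map_iter f (Suc q) z = Some (u (Suc q) + (\<tau> * \<sigma>) * (z - u 0))"
        unfolding map_iter_Suc using \<sigma>(2) by simp
      then show ?thesis unfolding True using \<sigma>(1) \<epsilon>'(2) by (intro exI[of _ "\<tau> * \<sigma>"]) auto
    next
      case False
      then show ?thesis using \<epsilon>(2) z i by auto
    qed
  qed (use \<epsilon> \<epsilon>' in auto)
qed

text \<open>
  Around a periodic point all points at distance \<open>h\<close> stay for ever within distance \<open>h\<close> of the finite
  orbit. For small generic \<open>h\<close> such points avoid both the exceptional set \<open>E\<close> and a given ball off the
  orbit, which contradicts the hitting property.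
\<close>
lemma aperiodic:
  assumes "0 < q" "\<And>i. i < q \<Longrightarrow> f (u i) = Some (u (Suc i))"
  shows "u q \<noteq> u 0"
proof
  assume per: "u q = u 0"
  obtain \<epsilon> where \<epsilon>: "\<epsilon> > 0" "\<And>z i. \<bar>z - u 0\<bar> < \<epsilon> \<Longrightarrow> i \<le> q \<Longrightarrow>
      \<exists>\<sigma>. (\<sigma> = 1 \<or> \<sigma> = -1) \<and> map_iter f i z = Some (u i + \<sigma> * (z - u 0))"
    using iterates_locally_isometric[of q u, OF assms(2)] by blast
  let ?O = "u ` {..q}"
  have "infinite {0<..<1::real}" by (simp add: infinite_Ioo)
  then have "\<not> {0<..<1} \<subseteq> ?O" using finite_subset by blast
  then obtain v where v: "v \<in> {0<..<1}" "v \<notin> ?O" by blast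
  have "open (- ?O)" by (intro open_Compl finite_imp_closed) auto
  then obtain r where r: "r > 0" "ball v r \<subseteq> - ?O"
    using v(2) unfolding open_contains_ball by (metis ComplI)
  have "v \<in> ball v (r / 2) \<inter> {0<..<1}" using v(1) r(1) by auto
  then have "open (ball v (r / 2))" "ball v (r / 2) \<inter> {0<..<1} \<noteq> {}" by blast+
  then obtain N E where E: "finite E" "hits f E N (ball v (r / 2))" using hitting by blast
  let ?X = "(\<Union>i\<in>{..q}. \<Union>\<sigma>\<in>{1,-1}. (\<lambda>e. \<sigma> * (e - u i)) ` E)"
  have "finite ?X" using E(1) by auto
  moreover have "infinite {0<..<min \<epsilon> (r / 2)}" using \<epsilon>(1) r(1) by (simp add: infinite_Ioo)
  ultimately have "\<not> {0<..<min \<epsilon> (r / 2)} \<subseteq> ?X" using finite_subset by blast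
  then obtain h where hX: "h \<in> {0<..<min \<epsilon> (r / 2)}" "h \<notin> ?X" by blast
  then have h: "0 < h" "h < \<epsilon>" "h < r / 2" by auto
  \<comment> \<open>\<open>R\<close> is closed under \<open>f\<close>: after \<open>q\<close> steps the offset \<open>h\<close> from \<open>u 0\<close> has at most changed its sign.\<close>
  define R where "R = {w. \<exists>i<q. \<exists>t. (t = 1 \<or> t = -1) \<and> map_iter f i (u 0 + t * h) = Some w}"
  have iter: "\<exists>\<sigma>. (\<sigma> = 1 \<or> \<sigma> = -1) \<and> map_iter f i (u 0 + t * h) = Some (u i + \<sigma> * h)"
    if t: "t = 1 \<or> t = -1" and i: "i \<le> q" for t i
  proof -
    have "\<bar>u 0 + t * h - u 0\<bar> < \<epsilon>" using t h by auto
    from \<epsilon>(2)[OF this i] obtain \<sigma> where "\<sigma> = 1 \<or> \<sigma> = -1" "map_iter f i (u 0 + t * h) = Some (u i + \<sigma> * (t * h))"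
      by auto
    then show ?thesis using t by (intro exI[of _ "\<sigma> * t"]) auto
  qed
  have R_next: "\<exists>w'\<in>R. f w = Some w'" if w: "w \<in> R" for w
  proof -
    obtain i t where it: "i < q" "t = 1 \<or> t = -1" "map_iter f i (u 0 + t * h) = Some w"
      using w unfolding R_def by blast
    obtain \<sigma> where \<sigma>: "\<sigma> = 1 \<or> \<sigma> = -1" "map_iter f (Suc i) (u 0 + t * h) = Some (u (Suc i) + \<sigma> * h)"
      using iter[OF it(2), of "Suc i"] it(1) by auto
    have fw: "f w = Some (u (Suc i) + \<sigma> * h)" using \<sigma>(2) it(3) by (simp add: map_iter_Suc)
    moreover have "u (Suc i) + \<sigma> * h \<in> R"
    proof (cases "Suc i = q")
      case True
      then show ?thesis
        unfolding R_def using per assms(1) \<sigma>(1)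
        by (intro CollectI exI[of _ 0] conjI exI[of _ \<sigma>]) (auto simp: map_iter_0)
    next
      case False
      then show ?thesis unfolding R_def using \<sigma>(2) it by (intro CollectI exI[of _ "Suc i"] conjI exI[of _ t]) auto
    qed
    ultimately show ?thesis by blast
  qed
  have R_avoid: "w \<notin> E \<and> w \<notin> ball v (r / 2)" if w: "w \<in> R" for w
  proof -
    obtain i t where i: "i < q" and t: "t = 1 \<or> t = -1" and wi: "map_iter f i (u 0 + t * h) = Some w"
      using w unfolding R_def by blast
    obtain \<sigma> where \<sigma>: "\<sigma> = 1 \<or> \<sigma> = -1" "map_iter f i (u 0 + t * h) = Some (u i + \<sigma> * h)"
      using iter[OF t less_imp_le[OF i]] by blast
    then have it: "i \<le> q" "\<sigma> = 1 \<or> \<sigma> = -1" "w = u i + \<sigma> * h" using i wi by auto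
    have "w \<notin> E"
    proof
      assume "w \<in> E"
      then have "h \<in> ?X" using it by (intro UN_I[of i] UN_I[of \<sigma>] image_eqI[of _ _ w]) auto
      then show False using hX(2) by blast
    qed
    have "u i \<notin> ball v r" using r(2) it(1) by auto
    then have "r \<le> \<bar>v - u i\<bar>" by (simp add: dist_real_def)
    moreover have "w = u i + h \<or> w = u i - h" using it(2,3) by auto
    ultimately have "r / 2 \<le> \<bar>v - w\<bar>" using h(1,3) by (elim disjE) linarith+
    then have "w \<notin> ball v (r / 2)" by (simp add: dist_real_def)
    with \<open>w \<notin> E\<close> show ?thesis by blast
  qed
  define g where "g i = ((\<lambda>w. the (f w)) ^^ i) (u 0 + h)" for i
  have g: "g i \<in> R \<and> f (g i) = Some (g (Suc i))" for i
  proof (induction i)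
    case 0
    have "map_iter f 0 (u 0 + 1 * h) = Some (g 0)" by (simp add: map_iter_0 g_def)
    then have "g 0 \<in> R" unfolding R_def using assms(1) by blast
    then show ?case using R_next[of "g 0"] by (auto simp: g_def)
  next
    case (Suc i)
    then have "g (Suc i) \<in> R" using R_next[of "g i"] by auto
    then show ?case using R_next[of "g (Suc i)"] by (auto simp: g_def)
  qed
  have "\<exists>i\<le>N. g i \<in> ball v (r / 2)" using hitsD[OF E(2), of g] g R_avoid by blast
  then show False using g R_avoid by blast
qed

lemma orbit_segments:
  assumes "(\<forall>k. x \<in> dom (map_iter f k)) \<or> (\<forall>k. x \<in> ran (map_iter f k))"
  shows "\<exists>u. (\<forall>i<K. f (u i) = Some (u (Suc i))) \<and> (\<forall>i\<le>K. u i \<in> orbit f x)"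
proof -
  have seg: "\<exists>u. (\<forall>i\<le>K. map_iter f i y = Some (u i)) \<and> (\<forall>i<K. f (u i) = Some (u (Suc i)))"
    if y: "map_iter f K y = Some z" for y z
  proof -
    have "\<exists>w. map_iter f i y = Some w" if "i \<le> K" for i
      using y map_iter_add[of f "K - i" i y z] that by auto
    then obtain u where u: "\<And>i. i \<le> K \<Longrightarrow> map_iter f i y = Some (u i)" by metis
    have "f (u i) = Some (u (Suc i))" if "i < K" for i
      using u[of i] u[of "Suc i"] that by (auto simp: map_iter_Suc)
    then show ?thesis using u by blast
  qed
  from assms show ?thesis
  proof
    assume "\<forall>k. x \<in> dom (map_iter f k)"
    then obtain z where "map_iter f K x = Some z" by blast
    from seg[OF this] show ?thesis unfolding orbit_def by blast
  next
    assume "\<forall>k. x \<in> ran (map_iter f k)"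
    then obtain y where y: "map_iter f K y = Some x" by (auto simp: ran_def)
    from seg[OF this] obtain u where u: "\<And>i. i \<le> K \<Longrightarrow> map_iter f i y = Some (u i)"
      "\<forall>i<K. f (u i) = Some (u (Suc i))" by blast
    have "u i \<in> orbit f x" if "i \<le> K" for i
    proof -
      have "map_iter f (K - i) (u i) = Some x"
        using map_iter_add[of f "K - i" i y x] y u(1)[OF that] that by auto
      then show ?thesis unfolding orbit_def by blast
    qed
    then show ?thesis using u(2) by blast
  qed
qed

text \<open>
  Without periodic points an orbit segment meets \<open>E\<close> at most \<open>card E\<close> times, so one of \<open>card E + 1\<close>
  consecutive blocks of \<open>N + 1\<close> points is free of \<open>E\<close>.
\<close>
lemma avoiding_run:
  assumes "\<And>i. i < K \<Longrightarrow> f (u i) = Some (u (Suc i))" "finite E" "(card E + 1) * (N + 1) \<le> K"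
  shows "\<exists>s. s + N \<le> K \<and> (\<forall>i\<le>N. u (s + i) \<notin> E)"
proof (rule ccontr)
  assume none: "\<not> ?thesis"
  have inj: "u i \<noteq> u j" if "i < j" "j \<le> K" for i j
    using aperiodic[of "j - i" "\<lambda>k. u (i + k)"] assms(1) that by auto
  have "\<exists>i\<le>N. u (r * (N + 1) + i) \<in> E" if "r \<le> card E" for r
  proof -
    have "r * (N + 1) + N + 1 \<le> (card E + 1) * (N + 1)"
      using mult_le_mono1[OF that, of "N + 1"] by simp
    then have "r * (N + 1) + N \<le> K" using assms(3) by linarith
    then show ?thesis using none by blast
  qed
  then obtain c where c: "\<And>r. r \<le> card E \<Longrightarrow> c r \<le> N" "\<And>r. r \<le> card E \<Longrightarrow> u (r * (N + 1) + c r) \<in> E"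
    by metis
  have less: "r * (N + 1) + c r < r' * (N + 1) + c r'" if "r < r'" "r' \<le> card E" for r r'
  proof -
    have "r * (N + 1) + c r < (r + 1) * (N + 1)" using c(1)[of r] that by simp
    also have "\<dots> \<le> r' * (N + 1)" using that by (intro mult_le_mono1) simp
    finally show ?thesis by simp
  qed
  have le: "r * (N + 1) + c r \<le> K" if "r \<le> card E" for r
  proof -
    have "r * (N + 1) \<le> card E * (N + 1)" using that by (intro mult_le_mono1)
    then show ?thesis using c(1)[OF that] assms(3) by simp
  qed
  have "inj_on (\<lambda>r. u (r * (N + 1) + c r)) {..card E}"
  proof (rule linorder_inj_onI)
    fix r r' assume "r < r'" "r \<in> {..card E}" "r' \<in> {..card E}"
    then show "u (r * (N + 1) + c r) \<noteq> u (r' * (N + 1) + c r')"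
      using inj[OF less[of r r']] le[of r'] by auto
  qed auto
  moreover have "(\<lambda>r. u (r * (N + 1) + c r)) ` {..card E} \<subseteq> E" using c(2) by auto
  ultimately have "card {..card E} \<le> card E" using assms(2) by (rule card_inj_on_le)
  then show False by simp
qed

lemma minimal: "minimal f"
  unfolding minimal_def
proof (intro ballI impI subsetI)
  fix x y :: real
  assume x: "(\<forall>k. x \<in> dom (map_iter f k)) \<or> (\<forall>k. x \<in> ran (map_iter f k))" and y: "y \<in> {0..<1}"
  show "y \<in> closure (orbit f x)"
    unfolding closure_approachable
  proof (intro allI impI)
    fix e :: real assume e: "0 < e"
    obtain w where "y < w" "w < y + e" "w < 1" using dense[of y "min (y + e) 1"] y e by auto
    then have "w \<in> ball y e \<inter> {0<..<1}" using y by (auto simp: dist_real_def)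
    then have "ball y e \<inter> {0<..<1} \<noteq> {}" by blast
    from hitting[OF open_ball this] obtain N E where E: "finite E" "hits f E N (ball y e)" by blast
    define K where "K = (card E + 1) * (N + 1)"
    obtain u where u: "\<And>i. i < K \<Longrightarrow> f (u i) = Some (u (Suc i))" "\<And>i. i \<le> K \<Longrightarrow> u i \<in> orbit f x"
      using orbit_segments[OF x] by blast
    have "(card E + 1) * (N + 1) \<le> K" by (simp only: K_def)
    from avoiding_run[of K u E N, OF u(1) E(1) this]
    obtain s where s: "s + N \<le> K" "\<And>i. i \<le> N \<Longrightarrow> u (s + i) \<notin> E" by blast
    have "f (u (s + i)) = Some (u (s + Suc i))" if "i < N" for i
      using u(1)[of "s + i"] s(1) that by simp
    from hitsD[of f E N "ball y e" "\<lambda>i. u (s + i)", OF E(2) this s(2)]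
    obtain i where i: "i \<le> N" "u (s + i) \<in> ball y e" by blast
    then show "\<exists>z\<in>orbit f x. dist z y < e"
      using u(2)[of "s + i"] s(1) by (intro bexI[of _ "u (s + i)"]) (simp_all add: dist_commute)
  qed
qed

end

section \<open>Keane's exchange of four intervals and its towers\<close>

datatype letter = One | Two | Three | Four

lemma UNIV_letter: "(UNIV :: letter set) = {One, Two, Three, Four}"
  using letter.exhaust by auto

instance letter :: finite
  by standard (simp add: UNIV_letter)

text \<open>
  The point \<open>y\<close> where the itinerary of \<open>x\<close> ends is an argument, so that itineraries can be
  concatenated.
\<close>
fun itin :: "('x \<Rightarrow> 'x) \<Rightarrow> ('w \<Rightarrow> 'x set) \<Rightarrow> 'w list \<Rightarrow> 'x \<Rightarrow> 'x \<Rightarrow> bool" where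
  "itin T P [] x y \<longleftrightarrow> y = x"
| "itin T P (w # ws) x y \<longleftrightarrow> x \<in> P w \<and> itin T P ws (T x) y"

lemma itin_append: "itin T P (us @ vs) x z \<longleftrightarrow> (\<exists>y. itin T P us x y \<and> itin T P vs y z)"
  by (induction us arbitrary: x) auto

lemma itin_funpow: "itin T P ws x y \<Longrightarrow> y = (T ^^ length ws) x"
  by (induction ws arbitrary: x) (auto simp: funpow_swap1)

lemma itin_translation:
  fixes T :: "real \<Rightarrow> real"
  assumes "\<And>w x. x \<in> P w \<Longrightarrow> T x = x + s w" "itin T P ws x y"
  shows "y = x + sum_list (map s ws)"
  using assms(2)
proof (induction ws arbitrary: x)
  case (Cons w ws)
  then have "itin T P ws (x + s w) y" using assms(1)[of x w] by simp
  from Cons.IH[OF this] show ?case by simp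
qed simp

lemma itin_replicate:
  fixes T :: "real \<Rightarrow> real"
  assumes T: "\<And>x. x \<in> P w \<Longrightarrow> T x = x + s"
    and "\<And>t. t < r \<Longrightarrow> x + real t * s \<in> P w"
  shows "itin T P (replicate r w) x (x + real r * s)"
  using assms(2)
proof (induction r arbitrary: x)
  case (Suc r)
  have x: "x \<in> P w" using Suc.prems[of 0] by simp
  have "itin T P (replicate r w) (x + s) (x + s + real r * s)"
    using Suc.prems[of "Suc t" for t] by (intro Suc.IH) (simp add: algebra_simps)
  then show ?case using x T by (simp add: algebra_simps)
qed simp

lemma replicate_split: "t < r \<Longrightarrow> replicate r w = replicate t w @ w # replicate (r - 1 - t) w"
  using replicate_add[of t "Suc (r - 1 - t)" w] by (simp del: replicate_Suc) simp

lemma quotient_remainder: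
  fixes y D :: real
  assumes D: "0 < D" and y: "0 \<le> y"
  shows "\<exists>t e. y = e + real t * D \<and> 0 \<le> e \<and> e < D"
proof -
  have t: "real (nat \<lfloor>y / D\<rfloor>) = of_int \<lfloor>y / D\<rfloor>"
    by (rule of_nat_nat) (use D y in simp)
  have "real (nat \<lfloor>y / D\<rfloor>) * D \<le> y" unfolding t by (rule floor_divide_lower[OF D])
  moreover have "y < (real (nat \<lfloor>y / D\<rfloor>) + 1) * D" unfolding t by (rule floor_divide_upper[OF D])
  ultimately show ?thesis
    by (intro exI[of _ "nat \<lfloor>y / D\<rfloor>"] exI[of _ "y - real (nat \<lfloor>y / D\<rfloor>) * D"]) (simp add: distrib_right)
qed

text \<open>
  The itinerary of the \<open>j\<close>-th interval of the next level until it returns. It starts in the fourth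
  interval; the first two letters then circulate near the second interval, the other two cross the
  first one, and all of them climb through the third.
\<close>
fun word :: "nat \<Rightarrow> nat \<Rightarrow> letter \<Rightarrow> letter list" where
  "word m n One = Four # replicate (m - 1) Two @ replicate n Three"
| "word m n Two = Four # replicate m Two @ replicate n Three"
| "word m n Three = Four # One # replicate (n - 1) Three"
| "word m n Four = Four # One # replicate n Three"

fun full_word :: "(nat \<Rightarrow> nat) \<Rightarrow> (nat \<Rightarrow> nat) \<Rightarrow> nat \<Rightarrow> letter \<Rightarrow> letter list" where
  "full_word m n 0 j = [j]"
| "full_word m n (Suc k) j = concat (map (full_word m n k) (word (m k) (n k) j))"

text \<open>
  \<open>a k\<close>, \<open>b k\<close>, \<open>c k\<close>, \<open>d k\<close> are the lengths at level \<open>k\<close>. The coefficient of a length of level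
  \<open>k + 1\<close> in the recursions counts the letters in the corresponding \<open>word\<close>; this is Keane's matrix.
\<close>
locale keane =
  fixes m n :: "nat \<Rightarrow> nat" and a b c d :: "nat \<Rightarrow> real"
  assumes m2: "2 \<le> m k" and n2: "2 \<le> n k"
    and a_pos: "0 < a k" and b_pos: "0 < b k" and c_pos: "0 < c k" and d_pos: "0 < d k"
    and a_rec: "a k = c (Suc k) + d (Suc k)"
    and b_rec: "b k = (real (m k) - 1) * a (Suc k) + real (m k) * b (Suc k)"
    and c_rec: "c k = real (n k) * (a (Suc k) + b (Suc k) + d (Suc k)) + (real (n k) - 1) * c (Suc k)"
    and d_rec: "d k = a (Suc k) + b (Suc k) + c (Suc k) + d (Suc k)"
    and total: "a 0 + b 0 + c 0 + d 0 = 1"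
begin

definition L :: "nat \<Rightarrow> real" where "L k = a k + b k + c k + d k"

fun P :: "nat \<Rightarrow> letter \<Rightarrow> real set" where
  "P k One = {0<..<a k}"
| "P k Two = {a k<..<a k + b k}"
| "P k Three = {a k + b k<..<a k + b k + c k}"
| "P k Four = {a k + b k + c k<..<L k}"

fun shift :: "nat \<Rightarrow> letter \<Rightarrow> real" where
  "shift k One = d k + b k"
| "shift k Two = d k - a k"
| "shift k Three = d k"
| "shift k Four = - (a k + b k + c k)"

text \<open>The images of the four intervals lie in the order \<open>4, 2, 1, 3\<close>.\<close>
definition T :: "nat \<Rightarrow> real \<Rightarrow> real" where
  "T k x = x + (if x < a k then shift k One else if x < a k + b k then shift k Two
                else if x < a k + b k + c k then shift k Three else shift k Four)"

abbreviation W :: "nat \<Rightarrow> letter \<Rightarrow> letter list" where "W \<equiv> full_word m n"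

text \<open>
  The position in the unit interval of a point with coordinate \<open>x\<close> at level \<open>k\<close>. The next level lives
  on the last interval and is read from its right end, which restores the order of the four letters.
\<close>
fun \<Phi> :: "nat \<Rightarrow> real \<Rightarrow> real" where
  "\<Phi> 0 x = x"
| "\<Phi> (Suc k) x = \<Phi> k (L k - x)"

abbreviation walk :: "letter list \<Rightarrow> real \<Rightarrow> real \<Rightarrow> bool" where
  "walk \<equiv> itin (T 0) (P 0)"

lemma T_eq: "x \<in> P k j \<Longrightarrow> T k x = x + shift k j"
  using a_pos[of k] b_pos[of k] c_pos[of k] by (cases j) (auto simp: T_def)

lemma P_subset: "x \<in> P k j \<Longrightarrow> 0 < x \<and> x < L k"
  using a_pos[of k] b_pos[of k] c_pos[of k] d_pos[of k] by (cases j) (auto simp: L_def)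

lemma T_range: "x \<in> P k j \<Longrightarrow> 0 < T k x \<and> T k x < L k"
  using a_pos[of k] b_pos[of k] c_pos[of k] d_pos[of k] T_eq[of x k j]
  by (cases j) (auto simp: L_def)

lemma in_some_P:
  "0 < x \<Longrightarrow> x < L k \<Longrightarrow> x \<notin> {a k, a k + b k, a k + b k + c k} \<Longrightarrow> \<exists>j. x \<in> P k j"
  by (cases "x < a k"; cases "x < a k + b k"; cases "x < a k + b k + c k")
    (fastforce intro: exI[of _ One] exI[of _ Two] exI[of _ Three] exI[of _ Four])+

lemma P_unique:
  assumes "x \<in> P k i" "x \<in> P k j"
  shows "i = j"
  using assms a_pos[of k] b_pos[of k] c_pos[of k] d_pos[of k] by (cases i; cases j) auto

lemma L_Suc: "L (Suc k) = d k"
  using d_rec[of k] by (simp add: L_def)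

text \<open>
  \<open>d k - a k\<close> and \<open>d k\<close> are the step widths in the second and the third interval, and these formulas
  compare the widths of the intervals with multiples of the steps.
\<close>
lemma rec':
  "d k - a k = a (Suc k) + b (Suc k)"
  "b k = real (m k) * (d k - a k) - a (Suc k)"
  "c k = real (n k) * d k - c (Suc k)"
  by (simp_all add: a_rec[of k] b_rec[of k] c_rec[of k] d_rec[of k] algebra_simps)

lemma itin_Threes:
  assumes "0 < e" "e + (real r - 1) * d k < c k"
  shows "itin (T k) (P k) (replicate r Three) (a k + b k + e) (a k + b k + e + real r * d k)"
proof (rule itin_replicate)
  fix t assume "t < r"
  then have "real t * d k \<le> (real r - 1) * d k"
    using d_pos[of k] by (intro mult_right_mono) auto
  moreover have "0 \<le> real t * d k" using d_pos[of k] by simp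
  ultimately show "a k + b k + e + real t * d k \<in> P k Three" using assms by auto
qed (use T_eq[of _ k Three] in simp)

lemma itin_Twos:
  assumes "0 < e" "e + (real r - 1) * (d k - a k) < b k"
  shows "itin (T k) (P k) (replicate r Two) (a k + e) (a k + e + real r * (d k - a k))"
proof (rule itin_replicate)
  have D: "0 < d k - a k" using rec'(1)[of k] a_pos[of "Suc k"] b_pos[of "Suc k"] by simp
  fix t assume "t < r"
  then have "real t * (d k - a k) \<le> (real r - 1) * (d k - a k)"
    using D by (intro mult_right_mono) auto
  moreover have "0 \<le> real t * (d k - a k)" using D by simp
  ultimately show "a k + e + real t * (d k - a k) \<in> P k Two" using assms by auto
qed (use T_eq[of _ k Two] in simp)

text \<open>
  A point \<open>L k - x\<close> of the last interval is first mapped to \<open>d k - x\<close>. It reaches the third interval at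
  a distance \<open>e\<close> from its left end with \<open>0 < e < d k\<close>; in steps of \<open>d k\<close> it then climbs back to the last
  interval. The distance \<open>e\<close> is a rearrangement of \<open>x\<close> that together with the last climb amounts to
  the exchange of the next level.
\<close>
lemma first_return:
  assumes x: "x \<in> P (Suc k) j"
  shows "itin (T k) (P k) (word (m k) (n k) j) (L k - x) (L k - T (Suc k) x)"
proof -
  have pos: "0 < a (Suc k)" "0 < b (Suc k)" "0 < c (Suc k)" "0 < d (Suc k)"
    using a_pos b_pos c_pos d_pos by auto
  have x0: "0 < x" "x < d k" using P_subset[OF x] by (auto simp: L_Suc)
  then have four: "L k - x \<in> P k Four" by (auto simp: L_def)
  then have T4: "T k (L k - x) = d k - x" using T_eq[OF four] by (simp add: L_def)
  note r = rec'[of k] and ad = a_rec[of k] d_rec[of k]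
  have step3: "itin (T k) (P k) (replicate (n k) Three) (a k + b k + e) (L k - d k + c (Suc k) + e)"
    if "0 < e" "e < d k - c (Suc k)" for e
  proof -
    have eq: "a k + b k + e + real (n k) * d k = L k - d k + c (Suc k) + e"
      using r(3) by (simp add: L_def)
    have "e + (real (n k) - 1) * d k < c k"
      using that r(3) by (simp add: algebra_simps)
    from itin_Threes[OF that(1) this] show ?thesis unfolding eq .
  qed
  show ?thesis
  proof (cases j)
    case j: One
    define e where "e = a (Suc k) - x"
    have xj: "x < a (Suc k)" using x j by simp
    have "itin (T k) (P k) (replicate (m k - 1) Two) (a k + (d k - a k - x))
        (a k + (d k - a k - x) + real (m k - 1) * (d k - a k))"
      using xj x0 pos r m2[of k] by (intro itin_Twos) (auto simp: of_nat_diff algebra_simps)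
    moreover have "a k + (d k - a k - x) + real (m k - 1) * (d k - a k) = a k + b k + e"
      using r m2[of k] by (simp add: e_def of_nat_diff algebra_simps)
    ultimately have twos: "itin (T k) (P k) (replicate (m k - 1) Two) (d k - x) (a k + b k + e)" by simp
    have eq: "L k - T (Suc k) x = L k - d k + c (Suc k) + e"
      using T_eq[OF x] j ad by (simp add: e_def)
    have "itin (T k) (P k) (replicate (n k) Three) (a k + b k + e) (L k - T (Suc k) x)"
      unfolding eq by (rule step3) (use xj x0 pos ad in \<open>auto simp: e_def\<close>)
    with twos have "itin (T k) (P k) (replicate (m k - 1) Two @ replicate (n k) Three) (d k - x) (L k - T (Suc k) x)"
      unfolding itin_append by blast
    then show ?thesis using four by (simp only: j word.simps itin.simps T4 simp_thms)
  next
    case j: Two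
    define e where "e = 2 * a (Suc k) + b (Suc k) - x"
    have xj: "a (Suc k) < x" "x < a (Suc k) + b (Suc k)" using x j by auto
    have "itin (T k) (P k) (replicate (m k) Two) (a k + (d k - a k - x))
        (a k + (d k - a k - x) + real (m k) * (d k - a k))"
      using xj pos r m2[of k] by (intro itin_Twos) (auto simp: algebra_simps)
    moreover have "a k + (d k - a k - x) + real (m k) * (d k - a k) = a k + b k + e"
      using r m2[of k] by (simp add: e_def algebra_simps)
    ultimately have twos: "itin (T k) (P k) (replicate (m k) Two) (d k - x) (a k + b k + e)" by simp
    have eq: "L k - T (Suc k) x = L k - d k + c (Suc k) + e"
      using T_eq[OF x] j ad by (simp add: e_def)
    have "itin (T k) (P k) (replicate (n k) Three) (a k + b k + e) (L k - T (Suc k) x)"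
      unfolding eq by (rule step3) (use xj x0 pos ad in \<open>auto simp: e_def\<close>)
    with twos have "itin (T k) (P k) (replicate (m k) Two @ replicate (n k) Three) (d k - x) (L k - T (Suc k) x)"
      unfolding itin_append by blast
    then show ?thesis using four by (simp only: j word.simps itin.simps T4 simp_thms)
  next
    case j: Three
    define e where "e = d k + (d k - a k) - x"
    have xj: "a (Suc k) + b (Suc k) < x" "x < a (Suc k) + b (Suc k) + c (Suc k)" using x j by auto
    have one: "d k - x \<in> P k One" using xj ad x0 by auto
    have T1: "T k (d k - x) = a k + b k + e" using T_eq[OF one] by (simp add: e_def)
    have "itin (T k) (P k) (replicate (n k - 1) Three) (a k + b k + e) (a k + b k + e + real (n k - 1) * d k)"
      using xj r(3) ad n2[of k] x0 pos by (intro itin_Threes) (auto simp: e_def of_nat_diff algebra_simps)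
    moreover have "a k + b k + e + real (n k - 1) * d k = L k - T (Suc k) x"
      using T_eq[OF x] j ad r n2[of k] by (simp add: e_def L_def of_nat_diff algebra_simps)
    ultimately have "itin (T k) (P k) (replicate (n k - 1) Three) (a k + b k + e) (L k - T (Suc k) x)" by (simp only:)
    then show ?thesis using four one by (simp only: j word.simps itin.simps T4 T1 simp_thms)
  next
    case j: Four
    define e where "e = d k + (d k - a k) - x"
    have xj: "a (Suc k) + b (Suc k) + c (Suc k) < x" using x j by auto
    have one: "d k - x \<in> P k One" using xj ad x0 pos by auto
    have T1: "T k (d k - x) = a k + b k + e" using T_eq[OF one] by (simp add: e_def)
    have eq: "L k - T (Suc k) x = L k - d k + c (Suc k) + e"
      using T_eq[OF x] j ad r by (simp add: e_def)
    have "itin (T k) (P k) (replicate (n k) Three) (a k + b k + e) (L k - T (Suc k) x)"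
      unfolding eq by (rule step3) (use xj x0 pos ad in \<open>auto simp: e_def\<close>)
    then show ?thesis using four one by (simp only: j word.simps itin.simps T4 T1 simp_thms)
  qed
qed

text \<open>
  Replacing each letter by its word of level zero turns an itinerary of \<open>T k\<close> into one of \<open>T 0\<close>.
\<close>
lemma walk_concat:
  assumes IH: "\<And>j x. x \<in> P k j \<Longrightarrow> walk (W k j) (\<Phi> k x) (\<Phi> k (T k x))"
    and "itin (T k) (P k) ws x y"
  shows "walk (concat (map (W k) ws)) (\<Phi> k x) (\<Phi> k y)"
  using assms(2)
proof (induction ws arbitrary: x)
  case (Cons w ws)
  then have "walk (W k w) (\<Phi> k x) (\<Phi> k (T k x))"
    "walk (concat (map (W k) ws)) (\<Phi> k (T k x)) (\<Phi> k y)"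
    using IH by simp_all
  then show ?case by (auto simp only: list.map concat.simps itin_append)
qed simp

text \<open>
  All points of the \<open>j\<close>-th interval of level \<open>k\<close> share their itinerary until they return. Their images
  up to this time are the floors of the \<open>j\<close>-th tower.
\<close>
lemma tower: "x \<in> P k j \<Longrightarrow> walk (W k j) (\<Phi> k x) (\<Phi> k (T k x))"
proof (induction k arbitrary: j x)
  case (Suc k)
  show ?case using walk_concat[OF Suc.IH first_return[OF Suc.prems]] by simp
qed simp

definition breaks :: "nat \<Rightarrow> real set" where
  "breaks k = {a k, a k + b k, a k + b k + c k}"

text \<open>Among these points are all inner end points of floors of level \<open>k + 1\<close>, in the coordinate of level \<open>k\<close>.\<close>
definition exceptions :: "nat \<Rightarrow> real set" where
  "exceptions k = breaks k \<union> (\<lambda>x. L k - x) ` breaks (Suc k) \<union> {d (Suc k)}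
     \<union> (\<Union>e\<in>{0, b (Suc k)}. (\<lambda>t. a k + e + real t * (d k - a k)) ` {..m k})
     \<union> (\<Union>e\<in>{0, a (Suc k), d k - a k, d k - a k + d (Suc k)}. (\<lambda>t. a k + b k + e + real t * d k) ` {..n k})"

lemma finite_exceptions: "finite (exceptions k)"
proof -
  have fb: "finite (breaks i)" for i by (simp add: breaks_def)
  show ?thesis
    unfolding exceptions_def by (intro finite_UnI finite_UN_I finite_imageI fb finite.intros finite_atMost)
qed

text \<open>
  Inside the second and the third interval the point is reduced modulo the step width; the remainder
  tells which letter it comes from and the quotient gives the time.
\<close>
lemma word_covers:
  assumes y: "0 < y" "y < L k" "y \<notin> exceptions k"
  shows "\<exists>j x us v vs. x \<in> P (Suc k) j \<and> word (m k) (n k) j = us @ v # vs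
           \<and> y = L k - x + sum_list (map (shift k) us)"
proof -
  let ?D = "d k - a k"
  have pos: "0 < a (Suc k)" "0 < b (Suc k)" "0 < c (Suc k)" "0 < d (Suc k)"
    using a_pos b_pos c_pos d_pos by auto
  note r = rec'[of k] and ad = a_rec[of k] d_rec[of k]
  have exc: "breaks k \<subseteq> exceptions k" "(\<lambda>x. L k - x) ` breaks (Suc k) \<subseteq> exceptions k"
    "d (Suc k) \<in> exceptions k"
    unfolding exceptions_def by blast+
  have exc2: "a k + e + real t * ?D \<in> exceptions k" if "e \<in> {0, b (Suc k)}" "t \<le> m k" for e t
    unfolding exceptions_def using that by blast
  have exc3: "a k + b k + e + real t * d k \<in> exceptions k"
    if "e \<in> {0, a (Suc k), ?D, ?D + d (Suc k)}" "t \<le> n k" for e t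
    unfolding exceptions_def using that by blast
  have "y \<notin> breaks k" using y(3) exc(1) by blast
  then have "y \<noteq> a k" "y \<noteq> a k + b k" "y \<noteq> a k + b k + c k" by (simp_all add: breaks_def)
  then have "y < a k \<or> a k < y \<and> y < a k + b k \<or> a k + b k < y \<and> y < a k + b k + c k
    \<or> a k + b k + c k < y" by linarith
  then consider "y < a k" | "a k < y" "y < a k + b k" | "a k + b k < y" "y < a k + b k + c k"
    | "a k + b k + c k < y" by blast
  then show ?thesis
  proof cases
    case 1
    have x: "d k - y \<noteq> a (Suc k) + b (Suc k) + c (Suc k)" using y(3) exc(3) ad by auto
    define j where "j = (if d k - y < a (Suc k) + b (Suc k) + c (Suc k) then Three else Four)"
    have "d k - y \<in> P (Suc k) j" using 1 x y r ad L_Suc[of k] by (auto simp: j_def)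
    moreover have "\<exists>vs. word (m k) (n k) j = [Four] @ One # vs" by (simp add: j_def)
    moreover have "y = L k - (d k - y) + sum_list (map (shift k) [Four])" by (simp add: L_def)
    ultimately show ?thesis by blast
  next
    case 2
    have D: "0 < ?D" using r pos by simp
    obtain t :: nat and e where te: "y - a k = e + real t * ?D" "0 \<le> e" "e < ?D"
      using quotient_remainder[OF D, of "y - a k"] 2 by auto
    have "real t * ?D < real (m k) * ?D" using te 2 r pos by linarith
    then have tm: "t < m k" using D by simp
    have yeq: "y = a k + e + real t * ?D" using te(1) by simp
    have e: "e \<noteq> 0" "e \<noteq> b (Suc k)"
      using exc2[of e t, folded yeq] tm y(3) by auto
    define x where "x = ?D - e"
    define j where "j = (if x < a (Suc k) then One else Two)"
    have xP: "x \<in> P (Suc k) j" using te e r by (auto simp: j_def x_def)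
    have tj: "t < (if j = One then m k - 1 else m k)"
    proof (cases "j = One")
      case True
      then have "b (Suc k) < e" using r by (simp add: j_def x_def split: if_splits)
      moreover have "e + real t * ?D < (real (m k) - 1) * ?D + b (Suc k)"
        using te 2 r by (simp add: algebra_simps)
      ultimately have "real t * ?D < (real (m k) - 1) * ?D" by linarith
      then show ?thesis using True D m2[of k] by auto
    qed (use tm in simp)
    have "\<exists>vs. word (m k) (n k) j = (Four # replicate t Two) @ Two # vs"
      using tj replicate_split[of t "m k - 1" Two] replicate_split[of t "m k" Two]
      by (auto simp: j_def split: if_splits)
    moreover have "y = L k - x + sum_list (map (shift k) (Four # replicate t Two))"
      using te by (simp add: x_def L_def sum_list_replicate)
    ultimately show ?thesis using xP by blast
  next
    case 3
    obtain t :: nat and e where te: "y - (a k + b k) = e + real t * d k" "0 \<le> e" "e < d k"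
      using quotient_remainder[OF d_pos[of k], of "y - (a k + b k)"] 3 by auto
    have "real t * d k < real (n k) * d k" using te 3 r pos by linarith
    then have tn: "t < n k" using d_pos[of k] by simp
    have yeq: "y = a k + b k + e + real t * d k" using te(1) by simp
    have e: "e \<noteq> 0" "e \<noteq> a (Suc k)" "e \<noteq> ?D" "e \<noteq> ?D + d (Suc k)"
      using exc3[of e t, folded yeq] tn y(3) by auto
    have "e < a (Suc k) \<or> (a (Suc k) < e \<and> e < ?D) \<or> (?D < e \<and> e < ?D + d (Suc k)) \<or> ?D + d (Suc k) < e"
      using e by auto
    then consider "e < a (Suc k)" | "a (Suc k) < e" "e < ?D" | "?D < e" "e < ?D + d (Suc k)"
      | "?D + d (Suc k) < e" by blast
    then show ?thesis
    proof cases
      case 1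
      let ?us = "Four # replicate (m k - 1) Two @ replicate t Three"
      have "a (Suc k) - e \<in> P (Suc k) One" using 1 e te by auto
      moreover have "\<exists>vs. word (m k) (n k) One = ?us @ Three # vs"
        using replicate_split[OF tn, of Three] by simp
      moreover have "y = L k - (a (Suc k) - e) + sum_list (map (shift k) ?us)"
        using te r m2[of k] by (simp add: L_def sum_list_replicate of_nat_diff algebra_simps)
      ultimately show ?thesis by blast
    next
      case 2
      let ?us = "Four # replicate (m k) Two @ replicate t Three"
      have "2 * a (Suc k) + b (Suc k) - e \<in> P (Suc k) Two" using 2 e te r by auto
      moreover have "\<exists>vs. word (m k) (n k) Two = ?us @ Three # vs"
        using replicate_split[OF tn, of Three] by simp
      moreover have "y = L k - (2 * a (Suc k) + b (Suc k) - e) + sum_list (map (shift k) ?us)"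
        using te r m2[of k] by (simp add: L_def sum_list_replicate algebra_simps)
      ultimately show ?thesis by blast
    next
      case 3
      let ?us = "Four # One # replicate t Three"
      have "d k + ?D - e \<in> P (Suc k) Four" using 3 e te r ad by (auto simp: L_Suc)
      moreover have "\<exists>vs. word (m k) (n k) Four = ?us @ Three # vs"
        using replicate_split[OF tn, of Three] by simp
      moreover have "y = L k - (d k + ?D - e) + sum_list (map (shift k) ?us)"
        using te r by (simp add: L_def sum_list_replicate)
      ultimately show ?thesis by blast
    next
      case 4
      let ?us = "Four # One # replicate t Three"
      have "e + real t * d k < (real (n k) - 1) * d k + (?D + d (Suc k))"
        using te \<open>y < a k + b k + c k\<close> r ad by (simp add: algebra_simps)
      then have "real t * d k < (real (n k) - 1) * d k" using 4 by linarith
      then have tn1: "t < n k - 1" using d_pos[of k] n2[of k] by auto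
      have "d k + ?D - e \<in> P (Suc k) Three" using 4 e te r ad by auto
      moreover have "\<exists>vs. word (m k) (n k) Three = ?us @ Three # vs"
        using replicate_split[OF tn1, of Three] by simp
      moreover have "y = L k - (d k + ?D - e) + sum_list (map (shift k) ?us)"
        using te r by (simp add: L_def sum_list_replicate)
      ultimately show ?thesis by blast
    qed
  next
    case 4
    have "L k - y \<notin> breaks (Suc k)" using y(3) exc(2) by force
    moreover have "0 < L k - y" "L k - y < L (Suc k)" using y 4 by (auto simp: L_Suc) (simp add: L_def)
    ultimately obtain j where "L k - y \<in> P (Suc k) j"
      using in_some_P[of "L k - y" "Suc k"] by (auto simp: breaks_def)
    moreover have "\<exists>vs. word (m k) (n k) j = [] @ Four # vs" by (cases j) auto
    moreover have "y = L k - (L k - y) + sum_list (map (shift k) [])" by simp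
    ultimately show ?thesis by blast
  qed
qed

text \<open>
  A proper prefix \<open>us\<close> of the word marks a time before the return, so \<open>floors k j\<close> is the union of all
  the floors of the \<open>j\<close>-th tower.
\<close>
definition floors :: "nat \<Rightarrow> letter \<Rightarrow> real set" where
  "floors k j = {z. \<exists>x us v vs. x \<in> P k j \<and> W k j = us @ v # vs \<and> walk us (\<Phi> k x) z}"

text \<open>
  A point of level \<open>k\<close> that is no exception lies in some floor over level \<open>k + 1\<close>, and the itineraries
  of the two levels combine. Each level adds the finitely many images of its exceptions.
\<close>
lemma finite_uncovered: "finite ({0<..<1} - (\<Union>j. floors k j))"
proof (induction k)
  case 0
  have "{0<..<1} - (\<Union>j. floors 0 j) \<subseteq> breaks 0"
  proof
    fix z assume z: "z \<in> {0<..<1} - (\<Union>j. floors 0 j)"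
    show "z \<in> breaks 0"
    proof (rule ccontr)
      assume "z \<notin> breaks 0"
      then obtain j where "z \<in> P 0 j"
        using in_some_P[of z 0] z total by (auto simp: breaks_def L_def)
      then have "z \<in> floors 0 j"
        unfolding floors_def by (auto intro!: exI[of _ z] exI[of _ "[]"])
      then show False using z by auto
    qed
  qed
  then show ?case by (rule finite_subset) (simp add: breaks_def)
next
  case (Suc k)
  let ?X = "\<Union>j. \<Union>i\<in>{..length (W k j)}. (\<lambda>y. \<Phi> k y + sum_list (map (shift 0) (take i (W k j)))) ` exceptions k"
  have "{0<..<1} - (\<Union>j. floors (Suc k) j) \<subseteq> ({0<..<1} - (\<Union>j. floors k j)) \<union> ?X"
  proof (rule subsetI, rule ccontr)
    fix z assume z: "z \<in> {0<..<1} - (\<Union>j. floors (Suc k) j)"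
      and n: "z \<notin> ({0<..<1} - (\<Union>j. floors k j)) \<union> ?X"
    then obtain v where "z \<in> floors k v" by auto
    then obtain y us' v0 vs' where y: "y \<in> P k v" "W k v = us' @ v0 # vs'" "walk us' (\<Phi> k y) z"
      unfolding floors_def by blast
    have "z = \<Phi> k y + sum_list (map (shift 0) us')"
      by (rule itin_translation[OF T_eq y(3)])
    moreover have "take (length us') (W k v) = us'" "length us' \<le> length (W k v)" using y(2) by auto
    ultimately have "z \<in> ?X" if "y \<in> exceptions k"
      using that by (intro UN_I[of v] UN_I[of "length us'"] image_eqI[of _ _ y]) simp_all
    then have "y \<notin> exceptions k" using n by blast
    then obtain j x us v' vs where jx: "x \<in> P (Suc k) j" "word (m k) (n k) j = us @ v' # vs"
      "y = L k - x + sum_list (map (shift k) us)"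
      using word_covers[of y k] P_subset[OF y(1)] by blast
    obtain y' where y': "itin (T k) (P k) us (L k - x) y'" "y' \<in> P k v'"
      using first_return[OF jx(1)] unfolding jx(2) itin_append by auto
    have "y' = y" using itin_translation[OF T_eq y'(1)] jx(3) by simp
    then have "v' = v" using y'(2) y(1) P_unique by blast
    have "walk (concat (map (W k) us)) (\<Phi> (Suc k) x) (\<Phi> k y)"
      using walk_concat[OF tower y'(1)] \<open>y' = y\<close> by simp
    then have "walk (concat (map (W k) us) @ us') (\<Phi> (Suc k) x) z"
      using y(3) by (auto simp: itin_append)
    moreover have "W (Suc k) j = (concat (map (W k) us) @ us') @ v0 # (vs' @ concat (map (W k) vs))"
      using jx(2) y(2) \<open>v' = v\<close> by simp
    ultimately have "z \<in> floors (Suc k) j" using jx(1) unfolding floors_def by blast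
    then show False using z by auto
  qed
  moreover have "finite (({0<..<1} - (\<Union>j. floors k j)) \<union> ?X)"
    using Suc.IH by (simp add: UNIV_letter finite_exceptions)
  ultimately show ?case by (rule finite_subset)
qed

end

lemma emeasure_isometry_image:
  fixes c \<sigma> :: real
  assumes "\<sigma> = 1 \<or> \<sigma> = -1" "E \<in> sets borel"
  shows "(\<lambda>x. c + \<sigma> * x) ` E \<in> sets borel"
    "emeasure lborel ((\<lambda>x. c + \<sigma> * x) ` E) = emeasure lborel E"
proof -
  have eq: "(\<lambda>x. c + \<sigma> * x) ` E = (\<lambda>y. - \<sigma> * c + \<sigma> * y) -` E"
  proof (intro set_eqI iffI)
    fix y assume "y \<in> (\<lambda>y. - \<sigma> * c + \<sigma> * y) -` E"
    then show "y \<in> (\<lambda>x. c + \<sigma> * x) ` E"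
      using assms(1) by (intro image_eqI[of _ _ "- \<sigma> * c + \<sigma> * y"]) auto
  qed (use assms(1) in auto)
  have "(\<lambda>y. - \<sigma> * c + \<sigma> * y) -` E \<inter> space borel \<in> sets borel"
    by (rule measurable_sets[where A = borel]) (use assms in auto)
  then show "(\<lambda>x. c + \<sigma> * x) ` E \<in> sets borel" unfolding eq by simp
  show "emeasure lborel ((\<lambda>x. c + \<sigma> * x) ` E) = emeasure lborel E"
    unfolding eq by (rule emeasure_lborel_isometry_vimage[OF assms])
qed

text \<open>
  A time within a concatenation of words splits into a number of complete words and a time within the
  next word. The list of the replicated letters records, for each time, which word is being read.
\<close>
lemma concat_map_nth_split:
  assumes "i < length (concat (map F ws))"
  shows "\<exists>us v vs i'. ws = us @ v # vs \<and> i = length (concat (map F us)) + i' \<and> i' < length (F v)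
           \<and> concat (map (\<lambda>v. replicate (length (F v)) v) ws) ! i = v"
  using assms
proof (induction ws arbitrary: i)
  case (Cons w ws)
  show ?case
  proof (cases "i < length (F w)")
    case True
    then show ?thesis
      by (intro exI[of _ "[]"] exI[of _ w] exI[of _ ws] exI[of _ i]) (simp add: nth_append)
  next
    case False
    then have "i - length (F w) < length (concat (map F ws))" using Cons.prems by auto
    from Cons.IH[OF this] obtain us v vs i' where "ws = us @ v # vs"
      "i - length (F w) = length (concat (map F us)) + i'" "i' < length (F v)"
      "concat (map (\<lambda>v. replicate (length (F v)) v) ws) ! (i - length (F w)) = v" by blast
    then show ?thesis
      using False by (intro exI[of _ "w # us"] exI[of _ v] exI[of _ vs] exI[of _ i']) (simp add: nth_append)
  qed
qed simp

context keane
begin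

fun lam :: "nat \<Rightarrow> letter \<Rightarrow> real" where
  "lam k One = a k"
| "lam k Two = b k"
| "lam k Three = c k"
| "lam k Four = d k"

lemma lam_pos: "0 < lam k j"
  using a_pos[of k] b_pos[of k] c_pos[of k] d_pos[of k] by (cases j) auto

lemma P_eq_interval: "\<exists>u. P k j = {u<..<u + lam k j}"
proof (cases j)
  case One
  then show ?thesis by (intro exI[of _ 0]) simp
qed (auto simp: L_def)

lemma \<Phi>_affine: "\<exists>c \<sigma>. (\<sigma> = 1 \<or> \<sigma> = -1) \<and> \<Phi> k = (\<lambda>x. c + \<sigma> * x)"
proof (induction k)
  case 0
  show ?case by (intro exI[of _ 0] exI[of _ 1]) auto
next
  case (Suc k)
  then obtain c \<sigma> where "\<sigma> = 1 \<or> \<sigma> = -1" "\<Phi> k = (\<lambda>x. c + \<sigma> * x)" by blast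
  then show ?case
    by (intro exI[of _ "c + \<sigma> * L k"] exI[of _ "- \<sigma>"]) (auto simp: algebra_simps)
qed

lemma L_half: "L (Suc k) \<le> L k / 2"
proof -
  have "2 * d k \<le> real (n k) * d k" using n2[of k] d_pos[of k] by (intro mult_right_mono) auto
  moreover have "c (Suc k) \<le> d k" using d_rec[of k] a_pos[of "Suc k"] b_pos[of "Suc k"] d_pos[of "Suc k"] by simp
  ultimately have "d k \<le> c k" using rec'(3)[of k] by linarith
  then have "2 * d k \<le> L k" using a_pos[of k] b_pos[of k] by (simp add: L_def)
  then show ?thesis by (simp add: L_Suc)
qed

lemma L_le: "L k \<le> (1 / 2) ^ k"
proof (induction k)
  case (Suc k)
  then show ?case using L_half[of k] by simp
qed (simp add: L_def total)

definition flr :: "nat \<Rightarrow> letter \<Rightarrow> nat \<Rightarrow> real set" where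
  "flr k j i = (\<lambda>x. \<Phi> k x + sum_list (map (shift 0) (take i (W k j)))) ` P k j"

lemma flr_walk:
  assumes "z \<in> flr k j i"
  shows "\<exists>x\<in>P k j. walk (take i (W k j)) (\<Phi> k x) z \<and> walk (drop i (W k j)) z (\<Phi> k (T k x))"
proof -
  obtain x where x: "x \<in> P k j" "z = \<Phi> k x + sum_list (map (shift 0) (take i (W k j)))"
    using assms by (auto simp: flr_def)
  have "walk (take i (W k j) @ drop i (W k j)) (\<Phi> k x) (\<Phi> k (T k x))" using tower[OF x(1)] by simp
  then obtain y where y: "walk (take i (W k j)) (\<Phi> k x) y" "walk (drop i (W k j)) y (\<Phi> k (T k x))"
    unfolding itin_append by blast
  have "y = z" using itin_translation[OF T_eq y(1)] x(2) by simp
  then show ?thesis using x y by blast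
qed

lemma floors_eq: "floors k j = (\<Union>i<length (W k j). flr k j i)"
proof (intro set_eqI iffI)
  fix z assume "z \<in> floors k j"
  then obtain x us v vs where x: "x \<in> P k j" "W k j = us @ v # vs" "walk us (\<Phi> k x) z"
    unfolding floors_def by blast
  have "take (length us) (W k j) = us" "length us < length (W k j)" using x(2) by auto
  then show "z \<in> (\<Union>i<length (W k j). flr k j i)"
    using x(1) itin_translation[OF T_eq x(3)]
    by (intro UN_I[of "length us"]) (auto simp: flr_def)
next
  fix z assume "z \<in> (\<Union>i<length (W k j). flr k j i)"
  then obtain i where i: "i < length (W k j)" "z \<in> flr k j i" by auto
  then show "z \<in> floors k j"
    using flr_walk[OF i(2)] id_take_nth_drop[OF i(1)] unfolding floors_def by blast
qed

lemma floors_subset: "floors k j \<subseteq> {0<..<1}"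
proof
  fix z assume "z \<in> floors k j"
  then obtain x us v vs where x: "x \<in> P k j" "W k j = us @ v # vs" "walk us (\<Phi> k x) z"
    unfolding floors_def by blast
  obtain y where y: "walk us (\<Phi> k x) y" "y \<in> P 0 v"
    using tower[OF x(1)] unfolding x(2) itin_append by auto
  have "y = z" using itin_funpow[OF y(1)] itin_funpow[OF x(3)] by simp
  then show "z \<in> {0<..<1}" using P_subset[OF y(2)] total by (simp add: L_def)
qed

lemma floors_0: "floors 0 j = P 0 j"
  by (auto simp: floors_eq flr_def)

lemma emeasure_flr: "flr k j i \<in> sets borel" "emeasure lborel (flr k j i) = ennreal (lam k j)"
proof -
  obtain c \<sigma> where \<Phi>: "\<sigma> = 1 \<or> \<sigma> = -1" "\<Phi> k = (\<lambda>x. c + \<sigma> * x)" using \<Phi>_affine by blast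
  have eq: "flr k j i = (\<lambda>x. (c + sum_list (map (shift 0) (take i (W k j)))) + \<sigma> * x) ` P k j"
    unfolding flr_def \<Phi>(2) by (simp add: algebra_simps)
  obtain u where u: "P k j = {u<..<u + lam k j}" using P_eq_interval by blast
  have Pm: "P k j \<in> sets borel" "emeasure lborel (P k j) = ennreal (lam k j)"
    unfolding u using lam_pos[of k j] by auto
  show "flr k j i \<in> sets borel" "emeasure lborel (flr k j i) = ennreal (lam k j)"
    unfolding eq using emeasure_isometry_image[OF \<Phi>(1) Pm(1)] Pm(2) by auto
qed

lemma emeasure_UN_flr:
  assumes "finite I"
  shows "emeasure lborel (\<Union>i\<in>I. flr k j i) \<le> ennreal (real (card I) * lam k j)"
proof -
  have "emeasure lborel (\<Union>i\<in>I. flr k j i) \<le> (\<Sum>i\<in>I. emeasure lborel (flr k j i))"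
    using assms emeasure_flr(1) by (intro emeasure_subadditive_finite) auto
  also have "\<dots> = ennreal (real (card I) * lam k j)"
    using lam_pos[of k j] by (simp add: emeasure_flr(2) ennreal_mult'' ennreal_of_nat_eq_real_of_nat less_imp_le)
  finally show ?thesis .
qed

lemma floors_measurable: "floors k j \<in> sets borel"
  unfolding floors_eq using emeasure_flr(1) by auto

text \<open>
  At time \<open>i\<close> some complete words of level \<open>k\<close> have been read and a part of the next one, so the point
  stands on a floor over the letter of that word.
\<close>
lemma flr_Suc_subset:
  assumes i: "i < length (W (Suc k) j)"
  shows "flr (Suc k) j i \<subseteq>
    floors k (concat (map (\<lambda>v. replicate (length (W k v)) v) (word (m k) (n k) j)) ! i)"
proof
  fix z assume "z \<in> flr (Suc k) j i"
  then obtain x where x: "x \<in> P (Suc k) j"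
    "z = \<Phi> (Suc k) x + sum_list (map (shift 0) (take i (W (Suc k) j)))"
    by (auto simp: flr_def)
  obtain us v vs i' where s: "word (m k) (n k) j = us @ v # vs"
    "i = length (concat (map (W k) us)) + i'" "i' < length (W k v)"
    "concat (map (\<lambda>v. replicate (length (W k v)) v) (word (m k) (n k) j)) ! i = v"
    using concat_map_nth_split[of i "W k" "word (m k) (n k) j"] i unfolding full_word.simps by blast
  obtain y where y: "itin (T k) (P k) us (L k - x) y" "y \<in> P k v"
    using first_return[OF x(1)] unfolding s(1) itin_append by auto
  have "\<Phi> k y = \<Phi> (Suc k) x + sum_list (map (shift 0) (concat (map (W k) us)))"
    using itin_translation[OF T_eq walk_concat[OF tower y(1)]] by simp
  moreover have "take i (W (Suc k) j) = concat (map (W k) us) @ take i' (W k v)"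
    using s(1,2,3) by simp
  ultimately have "z = \<Phi> k y + sum_list (map (shift 0) (take i' (W k v)))" using x(2) by simp
  then have "z \<in> flr k v i'" using y(2) by (auto simp: flr_def)
  then show "z \<in> floors k (concat (map (\<lambda>v. replicate (length (W k v)) v) (word (m k) (n k) j)) ! i)"
    unfolding s(4) floors_eq using s(3) by auto
qed

section \<open>Density of long orbit segments\<close>
lemma visits:
  assumes "x \<in> P (Suc k) j" "v \<in> set (word (m k) (n k) j)"
  shows "\<exists>us vs y. W (Suc k) j = us @ W k v @ vs \<and> y \<in> P k v \<and> walk us (\<Phi> (Suc k) x) (\<Phi> k y)"
proof -
  obtain us vs where s: "word (m k) (n k) j = us @ v # vs"
    using assms(2) by (auto simp: in_set_conv_decomp)
  obtain y where y: "itin (T k) (P k) us (L k - x) y" "y \<in> P k v"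
    using first_return[OF assms(1)] unfolding s itin_append by auto
  have "walk (concat (map (W k) us)) (\<Phi> (Suc k) x) (\<Phi> k y)"
    using walk_concat[OF tower y(1)] by simp
  then show ?thesis using s y(2)
    by (intro exI[of _ "concat (map (W k) us)"] exI[of _ "concat (map (W k) vs)"] exI[of _ y]) simp
qed

text \<open>
  No single \<open>word\<close> contains all four letters, but two levels suffice: the product of two consecutive
  matrices is positive.
\<close>
lemma two_words_positive: "\<exists>u. u \<in> set (word (m (Suc k)) (n (Suc k)) j) \<and> v \<in> set (word (m k) (n k) u)"
proof -
  have nz: "m k \<noteq> 0" "n k \<noteq> 0" "m (Suc k) \<noteq> 0" "n (Suc k) \<noteq> 0" "m (Suc k) \<noteq> Suc 0" "n (Suc k) \<noteq> Suc 0"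
    "m k \<noteq> Suc 0" "n k \<noteq> Suc 0"
    using m2[of k] n2[of k] m2[of "Suc k"] n2[of "Suc k"] by auto
  show ?thesis
  proof (cases "v = Two")
    case True
    then show ?thesis using nz
      by (cases j) (auto intro!: exI[of _ "if j = One \<or> j = Two then Two else One"])
  next
    case False
    then show ?thesis using nz
      by (cases j; cases v) (auto intro!: exI[of _ Four])
  qed
qed

lemma visits2:
  assumes "x \<in> P (Suc (Suc k)) j"
  shows "\<exists>us vs y. W (Suc (Suc k)) j = us @ W k v @ vs \<and> y \<in> P k v \<and> walk us (\<Phi> (Suc (Suc k)) x) (\<Phi> k y)"
proof -
  obtain u where u: "u \<in> set (word (m (Suc k)) (n (Suc k)) j)" "v \<in> set (word (m k) (n k) u)"
    using two_words_positive by blast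
  obtain us vs y where 1: "W (Suc (Suc k)) j = us @ W (Suc k) u @ vs" "y \<in> P (Suc k) u"
    "walk us (\<Phi> (Suc (Suc k)) x) (\<Phi> (Suc k) y)" using visits[OF assms u(1)] by blast
  obtain us' vs' y' where 2: "W (Suc k) u = us' @ W k v @ vs'" "y' \<in> P k v"
    "walk us' (\<Phi> (Suc k) y) (\<Phi> k y')" using visits[OF 1(2) u(2)] by blast
  have "walk (us @ us') (\<Phi> (Suc (Suc k)) x) (\<Phi> k y')" unfolding itin_append using 1(3) 2(3) by blast
  then show ?thesis using 1(1) 2(1,2)
    by (intro exI[of _ "us @ us'"] exI[of _ "vs' @ vs"] exI[of _ y']) (simp del: full_word.simps)
qed

lemma infinite_ball: "0 < e \<Longrightarrow> infinite (ball (x::real) e)"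
  by (simp add: ball_eq_greaterThanLessThan)

text \<open>
  \<open>U\<close> contains a whole floor of some level \<open>k\<close>. A segment that is twice as long as the towers of level
  \<open>k + 2\<close> finishes one tower and then runs through a complete second one; on its way it visits
  every floor of level \<open>k\<close>. The exceptional set makes sure that it enters the second tower at an interior
  point.
\<close>
lemma hits_open:
  assumes "open U" "U \<inter> {0<..<1} \<noteq> {}"
  shows "\<exists>N E. finite E \<and> (\<forall>x. (\<forall>i\<le>N. (T 0 ^^ i) x \<in> {0<..<1} - E) \<longrightarrow> (\<exists>i\<le>N. (T 0 ^^ i) x \<in> U))"
proof -
  obtain u where u: "u \<in> U" "0 < u" "u < 1" using assms(2) by auto
  have "open (U \<inter> {0<..<1})" using assms(1) by auto
  then obtain e where e: "e > 0" "ball u e \<subseteq> U \<inter> {0<..<1}"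
    using u unfolding open_contains_ball by (metis IntI greaterThanLessThan_iff)
  obtain k where k: "(1 / 2 :: real) ^ k < e / 2" using real_arch_pow_inv[of "e / 2" "1 / 2"] e(1) by auto
  have "infinite (ball u (e / 2))" using e(1) infinite_ball[of "e / 2" u] by simp
  then have "\<not> ball u (e / 2) \<subseteq> {0<..<1} - (\<Union>j. floors k j)"
    using finite_uncovered finite_subset by blast
  then obtain z where z: "z \<in> ball u (e / 2)" "z \<notin> {0<..<1} - (\<Union>j. floors k j)" by blast
  have "z \<in> ball u e" using z(1) e(1) by auto
  then have "z \<in> {0<..<1}" using e(2) by blast
  then obtain v i where vi: "i < length (W k v)" "z \<in> flr k v i" using z(2) floors_eq by auto
  have flrU: "flr k v i \<subseteq> U"
  proof
    fix w assume "w \<in> flr k v i"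
    then obtain x y where xy: "x \<in> P k v" "y \<in> P k v" "\<bar>w - z\<bar> = \<bar>\<Phi> k x - \<Phi> k y\<bar>"
      using vi(2) unfolding flr_def by auto
    obtain c \<sigma> where \<Phi>: "\<sigma> = 1 \<or> \<sigma> = -1" "\<Phi> k = (\<lambda>x. c + \<sigma> * x)" using \<Phi>_affine by blast
    have "\<bar>\<Phi> k x - \<Phi> k y\<bar> = \<bar>x - y\<bar>" unfolding \<Phi>(2) using \<Phi>(1) by auto
    also have "\<dots> < L k" using P_subset[OF xy(1)] P_subset[OF xy(2)] by auto
    finally have "\<bar>w - z\<bar> < e / 2" using xy(3) L_le[of k] k by simp
    then have "w \<in> ball u e" using z(1) unfolding mem_ball dist_real_def by linarith
    then show "w \<in> U" using e(2) by auto
  qed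
  define k2 where "k2 = Suc (Suc k)"
  define N where "N = (\<Sum>j\<in>UNIV. length (W k2 j)) + (\<Sum>j\<in>UNIV. length (W k2 j))"
  define E where "E = ({0<..<1} - (\<Union>j. floors k2 j)) \<union> \<Phi> k2 ` breaks k2"
  have lenN: "length (W k2 j) \<le> (\<Sum>j\<in>UNIV. length (W k2 j))" for j
    by (rule member_le_sum) auto
  have "finite E" unfolding E_def using finite_uncovered by (auto simp: breaks_def)
  moreover have "\<exists>i\<le>N. (T 0 ^^ i) x \<in> U" if x: "\<forall>i\<le>N. (T 0 ^^ i) x \<in> {0<..<1} - E" for x
  proof -
    have "x \<in> {0<..<1} - E" using x[rule_format, of 0] by simp
    then obtain j i1 where j: "i1 < length (W k2 j)" "x \<in> flr k2 j i1"
      unfolding E_def floors_eq by auto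
    then obtain y where y: "y \<in> P k2 j" "walk (drop i1 (W k2 j)) x (\<Phi> k2 (T k2 y))"
      using flr_walk[OF j(2)] by blast
    define w where "w = T k2 y"
    define s where "s = length (drop i1 (W k2 j))"
    have s: "\<Phi> k2 w = (T 0 ^^ s) x" "s \<le> (\<Sum>j\<in>UNIV. length (W k2 j))"
      using itin_funpow[OF y(2)] lenN[of j] by (auto simp: w_def s_def)
    then have "\<Phi> k2 w \<notin> E" using x[rule_format, of s] by (simp add: N_def)
    then have "w \<notin> breaks k2" by (auto simp: E_def)
    then obtain j' where "w \<in> P k2 j'"
      using in_some_P[of w k2] T_range[OF y(1)] by (auto simp: breaks_def w_def)
    then obtain us vs y' where v: "W k2 j' = us @ W k v @ vs" "y' \<in> P k v" "walk us (\<Phi> k2 w) (\<Phi> k y')"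
      using visits2[of w k j' v] unfolding k2_def by blast
    define r where "r = \<Phi> k y' + sum_list (map (shift 0) (take i (W k v)))"
    have "walk (take i (W k v) @ drop i (W k v)) (\<Phi> k y') (\<Phi> k (T k y'))" using tower[OF v(2)] by simp
    then obtain q where q: "walk (take i (W k v)) (\<Phi> k y') q" unfolding itin_append by blast
    have "q = r" using itin_translation[OF T_eq q] by (simp add: r_def)
    then have "walk (us @ take i (W k v)) (\<Phi> k2 w) r" using q v(3) unfolding itin_append by blast
    then have "r = (T 0 ^^ (length us + min (length (W k v)) i)) ((T 0 ^^ s) x)"
      using itin_funpow s(1) by fastforce
    moreover have "length us + min (length (W k v)) i + s \<le> N"
      using lenN[of j'] v(1) s(2) unfolding N_def by simp
    moreover have "r \<in> U" using flrU v(2) by (auto simp: r_def flr_def)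
    ultimately show ?thesis
      by (intro exI[of _ "length us + min (length (W k v)) i + s"]) (simp add: funpow_add)
  qed
  ultimately show ?thesis by blast
qed

section \<open>Lebesgue measure is not ergodic\<close>
abbreviation H :: "nat \<Rightarrow> letter \<Rightarrow> real" where "H k j \<equiv> real (length (W k j))"

lemma H_Suc:
  "H (Suc k) One = H k Four + (real (m k) - 1) * H k Two + real (n k) * H k Three"
  "H (Suc k) Two = H k Four + real (m k) * H k Two + real (n k) * H k Three"
  "H (Suc k) Three = H k Four + H k One + (real (n k) - 1) * H k Three"
  "H (Suc k) Four = H k Four + H k One + real (n k) * H k Three"
proof -
  obtain M N where "m k = Suc M" "n k = Suc N"
    using m2[of k] n2[of k] by (metis not_numeral_le_zero old.nat.exhaust)
  then show "H (Suc k) One = H k Four + (real (m k) - 1) * H k Two + real (n k) * H k Three"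
    "H (Suc k) Two = H k Four + real (m k) * H k Two + real (n k) * H k Three"
    "H (Suc k) Three = H k Four + H k One + (real (n k) - 1) * H k Three"
    "H (Suc k) Four = H k Four + H k One + real (n k) * H k Three"
    by (simp_all add: length_concat sum_list_replicate algebra_simps)
qed

text \<open>
  The next level recuts the towers without changing their total area: the heights are multiplied by
  Keane's matrix and the lengths by its inverse.
\<close>
lemma total_height: "H k One * a k + H k Two * b k + H k Three * c k + H k Four * d k = 1"
proof (induction k)
  case 0
  show ?case using total by simp
next
  case (Suc k)
  then show ?case
    unfolding H_Suc a_rec[of k] b_rec[of k] c_rec[of k] d_rec[of k] by (simp add: algebra_simps)
qed

text \<open>Approximations of the two invariant sets.\<close>
definition side_A :: "nat \<Rightarrow> real set" where "side_A k = floors k One \<union> floors k Two"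
definition side_B :: "nat \<Rightarrow> real set" where "side_B k = floors k Three \<union> floors k Four"

lemma side_measurable: "side_A k \<in> sets borel" "side_B k \<in> sets borel"
  unfolding side_A_def side_B_def using floors_measurable by auto

lemma emeasure_floors_le: "emeasure lborel (floors k j) \<le> ennreal (H k j * lam k j)"
  using emeasure_UN_flr[of "{..<length (W k j)}" k j] by (simp add: floors_eq)

lemma uncovered_sides: "finite ({0<..<1} - (side_A k \<union> side_B k))"
proof -
  have "(\<Union>j. floors k j) = side_A k \<union> side_B k"
    by (auto simp: UNIV_letter side_A_def side_B_def)
  then show ?thesis using finite_uncovered[of k] by simp
qed

lemma finite_imp_emeasure_0: "finite (F::real set) \<Longrightarrow> emeasure lborel F = 0"
  by (simp add: emeasure_lborel_countable countable_finite)

text \<open>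
  The two sides cover the unit interval up to a finite set, and their measures add up to at most
  \<open>total_height\<close>, that is, to \<open>1\<close>. Hence they overlap in a null set.
\<close>
lemma sides_overlap: "emeasure lborel (side_A k \<inter> side_B k) = 0"
proof -
  have sub: "emeasure lborel (X \<union> Y) \<le> emeasure lborel X + emeasure lborel Y"
    if "X \<in> sets borel" "Y \<in> sets borel" for X Y :: "real set"
    using that by (intro emeasure_subadditive) auto
  have "1 = emeasure lborel {0<..<1::real}" by simp
  also have "\<dots> \<le> emeasure lborel ((side_A k \<union> side_B k) \<union> ({0<..<1} - (side_A k \<union> side_B k)))"
    using side_measurable[of k] by (intro emeasure_mono) auto
  also have "\<dots> \<le> emeasure lborel (side_A k \<union> side_B k) + 0"
    using sub[of "side_A k \<union> side_B k" "{0<..<1} - (side_A k \<union> side_B k)"] side_measurable[of k]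
      finite_imp_emeasure_0[OF uncovered_sides[of k]] by auto
  finally have "1 + emeasure lborel (side_A k \<inter> side_B k)
      \<le> emeasure lborel (side_A k \<union> side_B k) + emeasure lborel (side_A k \<inter> side_B k)"
    by (intro add_right_mono) simp
  also have "\<dots> = emeasure lborel (side_A k) + emeasure lborel (side_B k)"
    using side_measurable[of k] by (intro emeasure_Un_Int[symmetric]) auto
  also have "\<dots> \<le> (ennreal (H k One * a k) + ennreal (H k Two * b k)) + (ennreal (H k Three * c k) + ennreal (H k Four * d k))"
    unfolding side_A_def side_B_def
    using emeasure_floors_le[of k One] emeasure_floors_le[of k Two] emeasure_floors_le[of k Three] emeasure_floors_le[of k Four]
    by (intro add_mono order.trans[OF sub]) (auto simp: floors_measurable)
  also have "\<dots> = ennreal (H k One * a k + H k Two * b k + (H k Three * c k + H k Four * d k))"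
    using a_pos[of k] b_pos[of k] c_pos[of k] d_pos[of k] by (simp add: less_imp_le)
  also have "\<dots> = 1" using total_height[of k] by (simp add: algebra_simps)
  finally have "1 + emeasure lborel (side_A k \<inter> side_B k) \<le> 1 + 0" by simp
  then show ?thesis by (metis ennreal_add_left_cancel_le ennreal_one_neq_top infinity_ennreal_def le_zero_eq)
qed

definition letters_at :: "nat \<Rightarrow> letter \<Rightarrow> letter list" where
  "letters_at k j = concat (map (\<lambda>v. replicate (length (W k v)) v) (word (m k) (n k) j))"

lemma length_letters_at: "length (letters_at k j) = length (W (Suc k) j)"
  by (simp add: letters_at_def length_concat o_def)

text \<open>
  With \<open>J = {One, Two}\<close> and \<open>V = {Three, Four}\<close>, or the other way round, this is the part that
  changes sides between the levels \<open>k\<close> and \<open>k + 1\<close>.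
\<close>
definition leak :: "nat \<Rightarrow> letter set \<Rightarrow> letter set \<Rightarrow> real set" where
  "leak k J V = (\<Union>j\<in>J. \<Union>i\<in>{i. i < length (letters_at k j) \<and> letters_at k j ! i \<in> V}. flr (Suc k) j i)"

lemma leak_measurable: "leak k J V \<in> sets borel"
  unfolding leak_def using emeasure_flr(1) by auto

lemma emeasure_leak:
  "emeasure lborel (leak k J V) \<le> (\<Sum>j\<in>J. ennreal (real (length (filter (\<lambda>v. v \<in> V) (letters_at k j))) * lam (Suc k) j))"
proof -
  have "emeasure lborel (leak k J V) \<le> (\<Sum>j\<in>J. emeasure lborel
      (\<Union>i\<in>{i. i < length (letters_at k j) \<and> letters_at k j ! i \<in> V}. flr (Suc k) j i))"
    unfolding leak_def using emeasure_flr(1) by (intro emeasure_subadditive_finite) auto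
  also have "\<dots> \<le> (\<Sum>j\<in>J. ennreal (real (length (filter (\<lambda>v. v \<in> V) (letters_at k j))) * lam (Suc k) j))"
    unfolding length_filter_conv_card by (intro sum_mono emeasure_UN_flr) auto
  finally show ?thesis .
qed

lemma floors_Suc_subset:
  assumes "j \<in> J"
  shows "floors (Suc k) j \<subseteq> (\<Union>v\<in>-V. floors k v) \<union> leak k J V"
proof
  fix z assume "z \<in> floors (Suc k) j"
  then obtain i where i: "i < length (W (Suc k) j)" "z \<in> flr (Suc k) j i" by (auto simp: floors_eq)
  then have "z \<in> floors k (letters_at k j ! i)" using flr_Suc_subset by (auto simp: letters_at_def)
  then show "z \<in> (\<Union>v\<in>-V. floors k v) \<union> leak k J V"
    using i assms length_letters_at[of k j] by (auto simp: leak_def)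
qed

lemma side_A_Suc: "side_A (Suc k) \<subseteq> side_A k \<union> leak k {One, Two} {Three, Four}"
proof -
  have "- {Three, Four} = {One, Two}" by (auto intro: letter.exhaust)
  then show ?thesis
    using floors_Suc_subset[of One "{One, Two}" k "{Three, Four}"]
      floors_Suc_subset[of Two "{One, Two}" k "{Three, Four}"] by (auto simp: side_A_def)
qed

lemma side_B_Suc: "side_B (Suc k) \<subseteq> side_B k \<union> leak k {Three, Four} {One, Two}"
proof -
  have "- {One, Two} = {Three, Four}" by (auto intro: letter.exhaust)
  then show ?thesis
    using floors_Suc_subset[of Three "{Three, Four}" k "{One, Two}"]
      floors_Suc_subset[of Four "{Three, Four}" k "{One, Two}"] by (auto simp: side_B_def)
qed

lemma emeasure_leak_A:
  "emeasure lborel (leak k {One, Two} {Three, Four})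
     \<le> ennreal ((a (Suc k) + b (Suc k)) * (real (n k) * H k Three + H k Four))"
proof -
  have "length (filter (\<lambda>v. v \<in> {Three, Four}) (letters_at k j)) = n k * length (W k Three) + length (W k Four)"
    if "j \<in> {One, Two}" for j
    using that by (auto simp: letters_at_def filter_concat length_concat sum_list_replicate o_def)
  then have "emeasure lborel (leak k {One, Two} {Three, Four}) \<le>
      ennreal ((real (n k) * H k Three + H k Four) * a (Suc k)) + ennreal ((real (n k) * H k Three + H k Four) * b (Suc k))"
    using emeasure_leak[of k "{One, Two}" "{Three, Four}"] by simp
  also have "\<dots> = ennreal ((a (Suc k) + b (Suc k)) * (real (n k) * H k Three + H k Four))"
    using a_pos[of "Suc k"] b_pos[of "Suc k"] by (subst ennreal_plus[symmetric]) (auto simp: algebra_simps)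
  finally show ?thesis .
qed

lemma emeasure_leak_B:
  "emeasure lborel (leak k {Three, Four} {One, Two}) \<le> ennreal ((c (Suc k) + d (Suc k)) * H k One)"
proof -
  have "length (filter (\<lambda>v. v \<in> {One, Two}) (letters_at k j)) = length (W k One)"
    if "j \<in> {Three, Four}" for j
    using that by (auto simp: letters_at_def filter_concat length_concat sum_list_replicate o_def)
  then have "emeasure lborel (leak k {Three, Four} {One, Two}) \<le>
      ennreal (H k One * c (Suc k)) + ennreal (H k One * d (Suc k))"
    using emeasure_leak[of k "{Three, Four}" "{One, Two}"] by simp
  also have "\<dots> = ennreal ((c (Suc k) + d (Suc k)) * H k One)"
    using c_pos[of "Suc k"] d_pos[of "Suc k"] by (subst ennreal_plus[symmetric]) (auto simp: algebra_simps)
  finally show ?thesis .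
qed

end

context keane
begin

definition top_floors :: "nat \<Rightarrow> real set" where
  "top_floors k = (\<Union>j. flr k j (length (W k j) - 1))"

lemma top_floors_measurable: "top_floors k \<in> sets borel"
  unfolding top_floors_def using emeasure_flr(1) by auto

lemma emeasure_top_floors: "emeasure lborel (top_floors k) \<le> ennreal ((1 / 2) ^ k)"
proof -
  have "emeasure lborel (top_floors k) \<le> (\<Sum>j\<in>UNIV. emeasure lborel (flr k j (length (W k j) - 1)))"
    unfolding top_floors_def using emeasure_flr(1) by (intro emeasure_subadditive_finite) auto
  also have "\<dots> = (\<Sum>j\<in>UNIV. ennreal (lam k j))" by (simp add: emeasure_flr(2))
  also have "\<dots> = ennreal (\<Sum>j\<in>UNIV. lam k j)" using lam_pos by (intro sum_ennreal) (auto intro: less_imp_le)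
  also have "(\<Sum>j\<in>UNIV. lam k j) = L k" by (simp add: UNIV_letter L_def)
  finally show ?thesis using L_le[of k] by (meson ennreal_leI order.trans)
qed

text \<open>Only from the top floor does \<open>T\<close> leave a tower, and the top floors have summable measure.\<close>
lemma T_stays_in_floors:
  assumes "z \<in> floors k j" "z \<notin> top_floors k"
  shows "T 0 z \<in> floors k j"
proof -
  obtain i where i: "i < length (W k j)" "z \<in> flr k j i" using assms(1) by (auto simp: floors_eq)
  have "i \<noteq> length (W k j) - 1" using i(2) assms(2) unfolding top_floors_def by blast
  then have Suc: "Suc i < length (W k j)" using i(1) by simp
  have "drop i (W k j) = W k j ! i # drop (Suc i) (W k j)" using i(1) by (simp add: Cons_nth_drop_Suc)
  then have "z \<in> P 0 (W k j ! i)" using flr_walk[OF i(2)] by auto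
  then have "T 0 z = z + shift 0 (W k j ! i)" by (rule T_eq)
  moreover have "take (Suc i) (W k j) = take i (W k j) @ [W k j ! i]"
    using i(1) by (rule take_Suc_conv_app_nth)
  ultimately have "T 0 z \<in> flr k j (Suc i)" using i(2) by (auto simp: flr_def add.assoc)
  then show ?thesis using Suc by (auto simp: floors_eq)
qed

text \<open>\<open>T\<close> is a piecewise translation, so preimages of null sets are null.\<close>
lemma AE_T:
  assumes "AE z in lborel. Q z"
  shows "AE z in lborel. Q (T 0 z)"
proof -
  obtain N where N: "N \<in> null_sets lborel" "{z. \<not> Q z} \<subseteq> N"
    using assms unfolding eventually_ae_filter by auto
  have "(\<lambda>x. shift 0 j + 1 * x) -` N \<in> null_sets lborel" for j
  proof -
    have b: "N \<in> sets borel" using N(1) by auto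
    have "(\<lambda>x. shift 0 j + 1 * x) -` N \<inter> space borel \<in> sets borel"
      by (rule measurable_sets[where A = borel]) (use b in auto)
    then show ?thesis
      using emeasure_lborel_isometry_vimage[of 1 N "shift 0 j"] b N(1) by (intro null_setsI) (auto simp: null_setsD1)
  qed
  then have "(\<Union>j. (\<lambda>x. shift 0 j + 1 * x) -` N) \<in> null_sets lborel"
    by (intro null_sets.finite_UN) auto
  moreover have "{z. \<not> Q (T 0 z)} \<subseteq> (\<Union>j. (\<lambda>x. shift 0 j + 1 * x) -` N)"
  proof
    fix z assume "z \<in> {z. \<not> Q (T 0 z)}"
    then have "T 0 z \<in> N" using N(2) by auto
    moreover have "T 0 z = shift 0 (if z < a 0 then One else if z < a 0 + b 0 then Two
        else if z < a 0 + b 0 + c 0 then Three else Four) + 1 * z"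
      by (simp add: T_def)
    ultimately show "z \<in> (\<Union>j. (\<lambda>x. shift 0 j + 1 * x) -` N)" by auto
  qed
  ultimately show ?thesis
    by (intro AE_I'[where N = "\<Union>j. (\<lambda>x. shift 0 j + 1 * x) -` N"]) auto
qed

end

text \<open>
  The growth conditions make the leaks of level \<open>k\<close> smaller than \<open>2 ^ (-k) / 8\<close>, with sum at
  most \<open>1/4\<close>. The two sides of level zero have measure at least \<open>1/3\<close>, so neither can leak away.
\<close>
locale fast_keane = keane +
  assumes growth_n: "16 * 2 ^ k * H k One \<le> (real (n k) - 1) * H k Three"
    and growth_m: "16 * 2 ^ k * (real (n k) * H k Three + H k Four) \<le> (real (m k) - 1) * H k Two"
    and balanced: "1 / 3 \<le> a 0 + b 0" "a 0 + b 0 \<le> 2 / 3"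
begin

abbreviation leak_A :: "nat \<Rightarrow> real set" where "leak_A k \<equiv> leak k {One, Two} {Three, Four}"
abbreviation leak_B :: "nat \<Rightarrow> real set" where "leak_B k \<equiv> leak k {Three, Four} {One, Two}"

text \<open>
  The first two towers of level \<open>k + 1\<close> contain at least \<open>m k - 1\<close> copies of the second tower
  of level \<open>k\<close>, the others at least \<open>n k - 1\<close> copies of the third, and the total area is \<open>1\<close>. Multiplied with
  the growth conditions this bounds the leaks.
\<close>
lemma heights_le_1:
  "(a (Suc k) + b (Suc k)) * ((real (m k) - 1) * H k Two) \<le> 1"
  "(c (Suc k) + d (Suc k)) * ((real (n k) - 1) * H k Three) \<le> 1"
proof -
  have pos: "0 < a (Suc k)" "0 < b (Suc k)" "0 < c (Suc k)" "0 < d (Suc k)"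
    using a_pos b_pos c_pos d_pos by auto
  have mn: "1 \<le> real (m k)" "1 \<le> real (n k)" using m2[of k] n2[of k] by auto
  have 1: "(real (m k) - 1) * H k Two \<le> H (Suc k) One" "(real (m k) - 1) * H k Two \<le> H (Suc k) Two"
    "(real (n k) - 1) * H k Three \<le> H (Suc k) Three" "(real (n k) - 1) * H k Three \<le> H (Suc k) Four"
    using mult_nonneg_nonneg[of "real (n k)" "H k Three"] unfolding H_Suc left_diff_distrib by linarith+
  have "(real (m k) - 1) * H k Two * a (Suc k) \<le> H (Suc k) One * a (Suc k)"
    "(real (m k) - 1) * H k Two * b (Suc k) \<le> H (Suc k) Two * b (Suc k)"
    "(real (n k) - 1) * H k Three * c (Suc k) \<le> H (Suc k) Three * c (Suc k)"
    "(real (n k) - 1) * H k Three * d (Suc k) \<le> H (Suc k) Four * d (Suc k)"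
    using pos 1 by (simp_all add: mult_right_mono del: full_word.simps)
  moreover have "0 \<le> H (Suc k) One * a (Suc k)" "0 \<le> H (Suc k) Two * b (Suc k)"
    "0 \<le> H (Suc k) Three * c (Suc k)" "0 \<le> H (Suc k) Four * d (Suc k)"
    using pos by (simp_all del: full_word.simps)
  ultimately show "(a (Suc k) + b (Suc k)) * ((real (m k) - 1) * H k Two) \<le> 1"
    "(c (Suc k) + d (Suc k)) * ((real (n k) - 1) * H k Three) \<le> 1"
    using total_height[of "Suc k"] by (simp_all add: distrib_right mult.commute del: full_word.simps)
qed

lemma emeasure_leaks: "emeasure lborel (leak_A k \<union> leak_B k) \<le> ennreal (1 / 8 * (1 / 2) ^ k)"
proof -
  have pos: "0 < a (Suc k)" "0 < b (Suc k)" "0 < c (Suc k)" "0 < d (Suc k)"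
    using a_pos b_pos c_pos d_pos by auto
  have "(a (Suc k) + b (Suc k)) * (16 * 2 ^ k * (real (n k) * H k Three + H k Four)) \<le> 1"
    by (rule order.trans[OF mult_left_mono[OF growth_m[of k]] heights_le_1(1)[of k]]) (use pos in simp)
  then have A: "(a (Suc k) + b (Suc k)) * (real (n k) * H k Three + H k Four) \<le> 1 / 16 * (1 / 2) ^ k"
    by (simp add: power_one_over field_simps)
  have "(c (Suc k) + d (Suc k)) * (16 * 2 ^ k * H k One) \<le> 1"
    by (rule order.trans[OF mult_left_mono[OF growth_n[of k]] heights_le_1(2)[of k]]) (use pos in simp)
  then have B: "(c (Suc k) + d (Suc k)) * H k One \<le> 1 / 16 * (1 / 2) ^ k"
    by (simp add: power_one_over field_simps)
  have "emeasure lborel (leak_A k \<union> leak_B k) \<le> emeasure lborel (leak_A k) + emeasure lborel (leak_B k)"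
    using leak_measurable by (intro emeasure_subadditive) auto
  also have "\<dots> \<le> ennreal (1 / 16 * (1 / 2) ^ k) + ennreal (1 / 16 * (1 / 2) ^ k)"
    using A B by (intro add_mono order.trans[OF emeasure_leak_A] order.trans[OF emeasure_leak_B] ennreal_leI)
  also have "\<dots> = ennreal (1 / 8 * (1 / 2) ^ k)"
    by (subst ennreal_plus[symmetric]) auto
  finally show ?thesis .
qed

lemma emeasure_all_leaks: "emeasure lborel (\<Union>k. leak_A k \<union> leak_B k) \<le> ennreal (1 / 4)"
proof -
  have "emeasure lborel (\<Union>k. leak_A k \<union> leak_B k) \<le> (\<Sum>k. emeasure lborel (leak_A k \<union> leak_B k))"
    using leak_measurable by (intro emeasure_subadditive_countably) auto
  also have "\<dots> \<le> (\<Sum>k. ennreal (1 / 8 * (1 / 2) ^ k))"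
    by (intro suminf_le emeasure_leaks summableI)
  also have "\<dots> = ennreal (1 / 4)"
  proof (rule suminf_ennreal_eq)
    show "(\<lambda>k. 1 / 8 * (1 / 2) ^ k :: real) sums (1 / 4)"
      using sums_mult[OF geometric_sums[of "1 / 2 :: real"], of "1 / 8"] by simp
  qed simp
  finally show ?thesis .
qed

definition limit_side :: "real set" where
  "limit_side = (\<Union>K. \<Inter>k\<in>{K..}. side_A k)"

text \<open>Each point of the open unit interval off this null set lies on exactly one side, at every level.\<close>
definition null_part :: "real set" where
  "null_part = (\<Union>k. ({0<..<1} - (side_A k \<union> side_B k)) \<union> (side_A k \<inter> side_B k))"

lemma null_part: "null_part \<in> null_sets lborel"
  unfolding null_part_def
proof (intro null_sets_UN null_sets.Un null_setsI)
  fix k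
  show "emeasure lborel ({0<..<1} - (side_A k \<union> side_B k)) = 0"
    by (rule finite_imp_emeasure_0[OF uncovered_sides])
  show "emeasure lborel (side_A k \<inter> side_B k) = 0" by (rule sides_overlap)
qed (use side_measurable in auto)

lemma limit_side_measurable: "limit_side \<in> sets borel"
  unfolding limit_side_def using side_measurable by (intro sets.countable_UN' sets.countable_INT') auto

lemma limit_side_subset: "limit_side \<subseteq> {0<..<1}"
  unfolding limit_side_def side_A_def using floors_subset by fastforce

lemma side_stable:
  assumes "z \<in> {0<..<1}" "z \<notin> (\<Union>k. leak_A k \<union> leak_B k)" "z \<notin> null_part"
  shows "z \<in> side_A k \<longleftrightarrow> z \<in> side_A 0"
proof (induction k)
  case (Suc k)
  have dich: "z \<in> side_B i \<longleftrightarrow> z \<notin> side_A i" for i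
    using assms(1,3) unfolding null_part_def by blast
  have "z \<notin> leak_A k" "z \<notin> leak_B k" using assms(2) by auto
  then have "z \<in> side_A (Suc k) \<longleftrightarrow> z \<in> side_A k"
    using side_A_Suc[of k] side_B_Suc[of k] dich[of k] dich[of "Suc k"] by blast
  then show ?case using Suc by simp
qed simp

lemma emeasure_sides_0: "ennreal (1 / 3) \<le> emeasure lborel (side_A 0)" "ennreal (1 / 3) \<le> emeasure lborel (side_B 0)"
proof -
  have pos: "0 < a 0" "0 < b 0" "0 < c 0" "0 < d 0"
    using a_pos b_pos c_pos d_pos by auto
  have "emeasure lborel (side_A 0) = emeasure lborel (P 0 One) + emeasure lborel (P 0 Two)"
    unfolding side_A_def floors_0 using P_unique[of _ 0 One Two]
    by (intro plus_emeasure[symmetric]) auto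
  also have "\<dots> = ennreal (a 0 + b 0)" using pos by simp
  finally show "ennreal (1 / 3) \<le> emeasure lborel (side_A 0)" using balanced(1) by (simp add: ennreal_leI)
  have "emeasure lborel (side_B 0) = emeasure lborel (P 0 Three) + emeasure lborel (P 0 Four)"
    unfolding side_B_def floors_0 using P_unique[of _ 0 Three Four]
    by (intro plus_emeasure[symmetric]) auto
  also have "\<dots> = ennreal (c 0 + d 0)" using pos by (simp add: L_def)
  finally show "ennreal (1 / 3) \<le> emeasure lborel (side_B 0)" using balanced(2) total by (simp add: ennreal_leI)
qed

lemma not_null_of_side:
  assumes "S \<in> sets borel" "ennreal (1 / 3) \<le> emeasure lborel X"
    "X \<subseteq> S \<union> (\<Union>k. leak_A k \<union> leak_B k) \<union> null_part"
  shows "emeasure lborel S \<noteq> 0"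
proof
  assume S: "emeasure lborel S = 0"
  have sub: "emeasure lborel (X \<union> Y) \<le> emeasure lborel X + emeasure lborel Y"
    if "X \<in> sets borel" "Y \<in> sets borel" for X Y :: "real set"
    using that by (intro emeasure_subadditive) auto
  have Lm: "(\<Union>k. leak_A k \<union> leak_B k) \<in> sets borel" using leak_measurable by auto
  have Nm: "null_part \<in> sets borel" using null_part by auto
  have "ennreal (1 / 3) \<le> emeasure lborel (S \<union> (\<Union>k. leak_A k \<union> leak_B k) \<union> null_part)"
    using assms(2) emeasure_mono[OF assms(3), of lborel] Lm Nm assms(1) by (simp add: order.trans)
  also have "\<dots> \<le> (emeasure lborel S + emeasure lborel (\<Union>k. leak_A k \<union> leak_B k)) + emeasure lborel null_part"
    using Lm Nm assms(1) by (intro order.trans[OF sub] add_mono sub) auto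
  also have "\<dots> \<le> 0 + ennreal (1 / 4) + 0"
    using S emeasure_all_leaks null_part by (intro add_mono) (auto simp: null_setsD1)
  finally show False by simp
qed

lemma limit_side_nontrivial:
  "emeasure lborel limit_side \<noteq> 0" "emeasure lborel ({0<..<1} - limit_side) \<noteq> 0"
proof -
  define Z where "Z = (\<Union>k. leak_A k \<union> leak_B k)"
  have mem: "z \<in> limit_side \<longleftrightarrow> z \<in> side_A 0"
    if "z \<in> {0<..<1}" "z \<notin> Z" "z \<notin> null_part" for z
    using side_stable[OF that[unfolded Z_def]] unfolding limit_side_def by auto
  have sub: "side_A 0 \<subseteq> {0<..<1}" "side_B 0 \<subseteq> {0<..<1}"
    unfolding side_A_def side_B_def using floors_subset by auto
  have dis: "side_A 0 \<inter> side_B 0 \<subseteq> null_part" unfolding null_part_def by blast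
  have "side_A 0 \<subseteq> limit_side \<union> Z \<union> null_part"
  proof
    fix z assume "z \<in> side_A 0"
    then show "z \<in> limit_side \<union> Z \<union> null_part" using mem[of z] sub(1) by blast
  qed
  then show "emeasure lborel limit_side \<noteq> 0"
    unfolding Z_def by (rule not_null_of_side[OF limit_side_measurable emeasure_sides_0(1)])
  have "side_B 0 \<subseteq> ({0<..<1} - limit_side) \<union> Z \<union> null_part"
  proof
    fix z assume "z \<in> side_B 0"
    then show "z \<in> ({0<..<1} - limit_side) \<union> Z \<union> null_part"
      using mem[of z] sub(2) dis by blast
  qed
  then show "emeasure lborel ({0<..<1} - limit_side) \<noteq> 0"
    unfolding Z_def by (rule not_null_of_side[OF _ emeasure_sides_0(2), rotated]) (use limit_side_measurable in auto)
qed

text \<open>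
  By the Borel-Cantelli lemma almost every point is eventually outside the top floors, and then it is
  on the same side as its image.
\<close>
lemma limit_side_invariant: "AE z in lborel. z \<in> {0<..<1} \<longrightarrow> (T 0 z \<in> limit_side \<longleftrightarrow> z \<in> limit_side)"
proof -
  have summ: "summable (\<lambda>k. measure lborel (top_floors k))"
  proof (rule summable_comparison_test')
    show "summable (\<lambda>k. (1 / 2 :: real) ^ k)" by (intro summable_geometric) auto
    show "norm (measure lborel (top_floors k)) \<le> (1 / 2) ^ k" if "k \<ge> 0" for k
      using emeasure_top_floors[of k] by (simp add: measure_def enn2real_leI)
  qed
  have "AE z in lborel. \<forall>\<^sub>F k in sequentially. z \<in> space lborel - top_floors k"
  proof (rule borel_cantelli_AE1[OF _ _ summ])
    show "emeasure lborel (top_floors k) < \<infinity>" for k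
      using emeasure_top_floors[of k] by (rule le_less_trans) simp
  qed (use top_floors_measurable in simp)
  moreover have "AE z in lborel. z \<notin> null_part" using null_part by (rule AE_not_in)
  moreover from this have "AE z in lborel. T 0 z \<notin> null_part" by (rule AE_T)
  ultimately show ?thesis
  proof eventually_elim
    case (elim z)
    show ?case
    proof
      assume z: "z \<in> {0<..<1}"
      have "\<forall>\<^sub>F k in sequentially. z \<in> side_A k \<longleftrightarrow> T 0 z \<in> side_A k"
        using elim(1)
      proof eventually_elim
        case (elim k)
        then have "z \<in> side_A k \<Longrightarrow> T 0 z \<in> side_A k" "z \<in> side_B k \<Longrightarrow> T 0 z \<in> side_B k"
          using T_stays_in_floors[of z k] by (auto simp: side_A_def side_B_def)
        moreover have "z \<in> side_A k \<or> z \<in> side_B k" "\<not> (T 0 z \<in> side_A k \<and> T 0 z \<in> side_B k)"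
          using z \<open>z \<notin> null_part\<close> \<open>T 0 z \<notin> null_part\<close> unfolding null_part_def by blast+
        ultimately show ?case by blast
      qed
      then obtain K where K: "\<forall>k\<ge>K. z \<in> side_A k \<longleftrightarrow> T 0 z \<in> side_A k"
        unfolding eventually_sequentially by blast
      have transfer: "w' \<in> limit_side"
        if w: "w \<in> limit_side" and agree: "\<forall>k\<ge>K. w \<in> side_A k \<longleftrightarrow> w' \<in> side_A k" for w w'
      proof -
        obtain K' where "\<forall>k\<ge>K'. w \<in> side_A k" using w unfolding limit_side_def by auto
        then have "\<forall>k\<ge>max K K'. w' \<in> side_A k" using agree by simp blast
        then show ?thesis unfolding limit_side_def by (intro UN_I[of "max K K'"]) auto
      qed
      show "T 0 z \<in> limit_side \<longleftrightarrow> z \<in> limit_side"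
        using transfer[of z "T 0 z"] transfer[of "T 0 z" z] K by blast
    qed
  qed
qed

end

section \<open>Existence of the length vectors\<close>

text \<open>
  The heights of the towers of level \<open>k\<close> depend only on the integers chosen before, so that \<open>n\<close> and then \<open>m\<close>
  can be chosen as large as the growth conditions demand, whatever the lengths will be.
\<close>
definition choose_n :: "nat \<Rightarrow> (letter \<Rightarrow> nat) \<Rightarrow> nat" where
  "choose_n k h = 2 + 16 * 2 ^ k * h One"

definition choose_m :: "nat \<Rightarrow> (letter \<Rightarrow> nat) \<Rightarrow> nat" where
  "choose_m k h = 2 + 16 * 2 ^ k * (choose_n k h * h Three + h Four)"

primrec height :: "nat \<Rightarrow> letter \<Rightarrow> nat" where
  "height 0 = (\<lambda>_. 1)"
| "height (Suc k) = (\<lambda>j. sum_list (map (height k) (word (choose_m k (height k)) (choose_n k (height k)) j)))"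

definition n_seq :: "nat \<Rightarrow> nat" where "n_seq k = choose_n k (height k)"
definition m_seq :: "nat \<Rightarrow> nat" where "m_seq k = choose_m k (height k)"

lemma length_full_word: "length (full_word m_seq n_seq k j) = height k j"
proof (induction k arbitrary: j)
  case (Suc k)
  then show ?case by (simp add: length_concat o_def m_seq_def n_seq_def)
qed simp

lemma height_pos: "1 \<le> height k j"
proof (induction k arbitrary: j)
  case (Suc k)
  then show ?case using Suc.IH[of Four] by (cases j) (auto intro: add_increasing2 trans_le_add1)
qed simp

lemma m_n_seq_ge_2: "2 \<le> m_seq k" "2 \<le> n_seq k"
  by (simp_all add: m_seq_def n_seq_def choose_m_def choose_n_def)

lemma n_seq_growth: "16 * 2 ^ k * real (height k One) \<le> (real (n_seq k) - 1) * real (height k Three)"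
proof -
  have "16 * 2 ^ k * real (height k One) \<le> real (n_seq k) - 1" by (simp add: n_seq_def choose_n_def)
  also have "\<dots> \<le> (real (n_seq k) - 1) * real (height k Three)"
    using mult_left_mono[of 1 "real (height k Three)" "real (n_seq k) - 1"] height_pos[of k Three] m_n_seq_ge_2(2)[of k] by simp
  finally show ?thesis .
qed

lemma m_seq_growth:
  "16 * 2 ^ k * (real (n_seq k) * real (height k Three) + real (height k Four)) \<le> (real (m_seq k) - 1) * real (height k Two)"
proof -
  have "16 * 2 ^ k * (real (n_seq k) * real (height k Three) + real (height k Four)) \<le> real (m_seq k) - 1"
    by (simp add: m_seq_def n_seq_def choose_m_def)
  also have "\<dots> \<le> (real (m_seq k) - 1) * real (height k Two)"
    using mult_left_mono[of 1 "real (height k Two)" "real (m_seq k) - 1"] height_pos[of k Two] m_n_seq_ge_2(1)[of k] by simp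
  finally show ?thesis .
qed

text \<open>
  \<open>push\<close> is Keane's matrix, which maps the lengths of level \<open>k + 1\<close> to those of level \<open>k\<close>, and
  \<open>pull\<close> is its inverse.
\<close>
fun push_entry :: "nat \<Rightarrow> nat \<Rightarrow> real ^ letter \<Rightarrow> letter \<Rightarrow> real" where
  "push_entry m n v One = v $ Three + v $ Four"
| "push_entry m n v Two = (real m - 1) * v $ One + real m * v $ Two"
| "push_entry m n v Three = real n * (v $ One + v $ Two + v $ Four) + (real n - 1) * v $ Three"
| "push_entry m n v Four = v $ One + v $ Two + v $ Three + v $ Four"

definition push :: "nat \<Rightarrow> nat \<Rightarrow> real ^ letter \<Rightarrow> real ^ letter" where
  "push m n v = (\<chi> j. push_entry m n v j)"

fun pull_entry :: "nat \<Rightarrow> nat \<Rightarrow> real ^ letter \<Rightarrow> letter \<Rightarrow> real" where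
  "pull_entry m n v One = real m * (v $ Four - v $ One) - v $ Two"
| "pull_entry m n v Two = v $ Two - (real m - 1) * (v $ Four - v $ One)"
| "pull_entry m n v Three = real n * v $ Four - v $ Three"
| "pull_entry m n v Four = v $ One - real n * v $ Four + v $ Three"

definition pull :: "nat \<Rightarrow> nat \<Rightarrow> real ^ letter \<Rightarrow> real ^ letter" where
  "pull m n v = (\<chi> j. pull_entry m n v j)"

lemma all_letter: "(\<forall>j. Q j) \<longleftrightarrow> Q One \<and> Q Two \<and> Q Three \<and> Q Four"
  by (metis letter.exhaust)

lemma pull_push: "pull m n (push m n v) = v"
  by (simp add: vec_eq_iff all_letter pull_def push_def algebra_simps)

lemma push_pull: "push m n (pull m n v) = v"
  by (simp add: vec_eq_iff all_letter pull_def push_def algebra_simps)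

lemma continuous_pull: "continuous_on UNIV (pull m n)"
  unfolding pull_def
proof (intro continuous_on_vec_lambda)
  fix j show "continuous_on UNIV (\<lambda>v. pull_entry m n v j)"
    by (cases j) (auto intro!: continuous_intros)
qed

primrec iter_pull :: "nat \<Rightarrow> real ^ letter \<Rightarrow> real ^ letter" where
  "iter_pull 0 v = v"
| "iter_pull (Suc k) v = pull (m_seq k) (n_seq k) (iter_pull k v)"

lemma continuous_iter_pull: "continuous_on UNIV (iter_pull k)"
proof (induction k)
  case (Suc k)
  then show ?case
    using continuous_on_compose[OF Suc.IH continuous_on_subset[OF continuous_pull[of "m_seq k" "n_seq k"]]]
    by (simp add: o_def)
qed simp

text \<open>
  The row vector \<open>r\<close> times the product of the first \<open>k\<close> matrices. For \<open>r = 1\<close> the entries are the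
  heights of the towers, and for \<open>r = weight\<close> they count the floors that lie in the first two
  intervals of level zero.
\<close>
primrec count_row :: "(letter \<Rightarrow> real) \<Rightarrow> nat \<Rightarrow> letter \<Rightarrow> real" where
  "count_row r 0 = r"
| "count_row r (Suc k) = (\<lambda>j. sum_list (map (count_row r k) (word (m_seq k) (n_seq k) j)))"

definition pairing :: "(letter \<Rightarrow> real) \<Rightarrow> real ^ letter \<Rightarrow> real" where
  "pairing r v = r One * v $ One + r Two * v $ Two + r Three * v $ Three + r Four * v $ Four"

lemma row_Suc:
  "count_row r (Suc k) One = count_row r k Four + (real (m_seq k) - 1) * count_row r k Two + real (n_seq k) * count_row r k Three"
  "count_row r (Suc k) Two = count_row r k Four + real (m_seq k) * count_row r k Two + real (n_seq k) * count_row r k Three"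
  "count_row r (Suc k) Three = count_row r k Four + count_row r k One + (real (n_seq k) - 1) * count_row r k Three"
  "count_row r (Suc k) Four = count_row r k Four + count_row r k One + real (n_seq k) * count_row r k Three"
proof -
  obtain M N where "m_seq k = Suc M" "n_seq k = Suc N"
    using m_n_seq_ge_2[of k] by (metis not_numeral_le_zero old.nat.exhaust)
  then show "count_row r (Suc k) One = count_row r k Four + (real (m_seq k) - 1) * count_row r k Two + real (n_seq k) * count_row r k Three"
    "count_row r (Suc k) Two = count_row r k Four + real (m_seq k) * count_row r k Two + real (n_seq k) * count_row r k Three"
    "count_row r (Suc k) Three = count_row r k Four + count_row r k One + (real (n_seq k) - 1) * count_row r k Three"
    "count_row r (Suc k) Four = count_row r k Four + count_row r k One + real (n_seq k) * count_row r k Three"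
    by (simp_all add: sum_list_replicate algebra_simps)
qed

lemma pairing_row_push: "pairing (count_row r (Suc k)) w = pairing (count_row r k) (push (m_seq k) (n_seq k) w)"
  unfolding pairing_def row_Suc by (simp add: push_def algebra_simps)

lemma pairing_iter_pull: "pairing (count_row r k) (iter_pull k v) = pairing r v"
proof (induction k)
  case (Suc k)
  then show ?case unfolding iter_pull.simps pairing_row_push push_pull .
qed simp

lemma row_1: "count_row (\<lambda>_. 1) k j = real (height k j)"
proof (induction k arbitrary: j)
  case (Suc k)
  have "sum_list (map (count_row (\<lambda>_. 1) k) xs) = real (sum_list (map (height k) xs))" for xs
    by (induction xs) (auto simp: Suc)
  then show ?case by (simp add: m_seq_def n_seq_def)
qed simp

definition weight :: "letter \<Rightarrow> real" where
  "weight j = (if j = One \<or> j = Two then 1 else 0)"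

lemma row_weight_bounds: "0 \<le> count_row weight k j \<and> count_row weight k j \<le> real (height k j)"
proof (induction k arbitrary: j)
  case (Suc k)
  have "0 \<le> sum_list (map (count_row weight k) xs) \<and> sum_list (map (count_row weight k) xs) \<le> real (sum_list (map (height k) xs))" for xs
    using Suc by (induction xs) (auto intro: add_mono add_nonneg_nonneg)
  then show ?case by (simp add: m_seq_def n_seq_def)
qed (simp add: weight_def)

text \<open>
  Up to an error \<open>s k \<le> 1/8\<close>, the second tower consists of floors in the first two intervals of
  level zero, and the third and fourth tower of floors in the last two. The error grows by \<open>\<delta>\<close> at each level,
  since the growth conditions bound the contribution of the foreign letters by the fraction \<open>\<delta>\<close> of the
  total height.
\<close>
lemma row_weight_separated:
  defines "s \<equiv> \<lambda>k. 1 / 8 * (1 - (1 / 2) ^ k) :: real"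
  shows "(1 - s k) * real (height k Two) \<le> count_row weight k Two
    \<and> count_row weight k Three \<le> s k * real (height k Three) \<and> count_row weight k Four \<le> s k * real (height k Four)"
proof (induction k)
  case 0
  show ?case by (simp add: s_def weight_def)
next
  case (Suc k)
  define \<delta> :: real where "\<delta> = 1 / 16 * (1 / 2) ^ k"
  have \<delta>: "0 < \<delta>" by (simp add: \<delta>_def)
  have sSuc: "s (Suc k) = s k + \<delta>" by (simp add: s_def \<delta>_def field_simps)
  have s01: "0 \<le> s i" "s i \<le> 1" for i
  proof -
    have "0 \<le> 1 / 8 * (1 - p) \<and> 1 / 8 * (1 - p) \<le> 1" if "0 \<le> p" "p \<le> 1" for p :: real
      using that by auto
    from this[of "(1 / 2) ^ i"] have "0 \<le> s i \<and> s i \<le> 1"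
      by (simp add: s_def power_le_one)
    then show "0 \<le> s i" "s i \<le> 1" by auto
  qed
  define R where "R j = real (height k j)" for j
  define G where "G = count_row weight k"
  have R1: "1 \<le> R j" for j using height_pos[of k j] by (simp add: R_def)
  have GR: "0 \<le> G j" "G j \<le> R j" for j using row_weight_bounds[of k j] by (auto simp: G_def R_def)
  have mn: "2 \<le> real (m_seq k)" "2 \<le> real (n_seq k)" using m_n_seq_ge_2[of k] by auto
  have RS: "real (height (Suc k) Two) = R Four + real (m_seq k) * R Two + real (n_seq k) * R Three"
    "real (height (Suc k) Three) = R Four + R One + (real (n_seq k) - 1) * R Three"
    "real (height (Suc k) Four) = R Four + R One + real (n_seq k) * R Three"
    unfolding row_1[symmetric] R_def by (rule row_Suc)+
  have gn: "R One \<le> \<delta> * ((real (n_seq k) - 1) * R Three)"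
    using n_seq_growth[of k] by (simp add: \<delta>_def R_def power_one_over field_simps)
  have gm: "real (n_seq k) * R Three + R Four \<le> \<delta> * ((real (m_seq k) - 1) * R Two)"
    using m_seq_growth[of k] by (simp add: \<delta>_def R_def power_one_over field_simps)
  have IH: "(1 - s k) * R Two \<le> G Two" "G Three \<le> s k * R Three" "G Four \<le> s k * R Four"
    using Suc by (auto simp: R_def G_def)
  let ?M = "real (m_seq k) * R Two"
  have M0: "0 \<le> ?M" using mn R1[of Two] by simp
  have "(1 - s (Suc k)) * real (height (Suc k) Two) \<le> (1 - s (Suc k)) * (?M + \<delta> * ?M)"
  proof (intro mult_left_mono)
    have "\<delta> * ((real (m_seq k) - 1) * R Two) \<le> \<delta> * ?M"
      using \<delta> R1[of Two] by (intro mult_left_mono mult_right_mono) auto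
    then show "real (height (Suc k) Two) \<le> ?M + \<delta> * ?M" unfolding RS using gm by linarith
  qed (use s01[of "Suc k"] in simp)
  also have "\<dots> = (1 - s k) * ?M - (\<delta> * s k + \<delta> * \<delta>) * ?M" by (simp add: sSuc algebra_simps)
  also have "\<dots> \<le> (1 - s k) * ?M" using \<delta> s01[of k] M0 by simp
  also have "\<dots> \<le> real (m_seq k) * G Two"
    using mult_left_mono[OF IH(1), of "real (m_seq k)"] by (simp add: algebra_simps)
  also have "\<dots> \<le> count_row weight (Suc k) Two"
    unfolding row_Suc using GR[of Four] GR[of Three] by (simp add: G_def)
  finally have two: "(1 - s (Suc k)) * real (height (Suc k) Two) \<le> count_row weight (Suc k) Two" .
  have G1: "G One \<le> \<delta> * ((real (n_seq k) - 1) * R Three)" using GR(2)[of One] gn by simp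
  have nR: "0 \<le> (real (n_seq k) - 1) * R Three" "0 \<le> R Four" "0 \<le> R One"
    using mn R1[of Three] R1[of Four] R1[of One] by auto
  have "count_row weight (Suc k) Three = G Four + G One + (real (n_seq k) - 1) * G Three"
    unfolding row_Suc G_def ..
  also have "\<dots> \<le> s k * R Four + \<delta> * ((real (n_seq k) - 1) * R Three) + (real (n_seq k) - 1) * (s k * R Three)"
    using IH G1 mn by (intro add_mono mult_left_mono) auto
  also have "\<dots> \<le> s (Suc k) * real (height (Suc k) Three)"
  proof -
    have "0 \<le> \<delta> * R Four" "0 \<le> (s k + \<delta>) * R One" using \<delta> s01[of k] nR by auto
    then show ?thesis unfolding sSuc RS by (simp add: algebra_simps)
  qed
  finally have three: "count_row weight (Suc k) Three \<le> s (Suc k) * real (height (Suc k) Three)" .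
  have "count_row weight (Suc k) Four = G Four + G One + real (n_seq k) * G Three"
    unfolding row_Suc G_def ..
  also have "\<dots> \<le> s k * R Four + \<delta> * ((real (n_seq k) - 1) * R Three) + real (n_seq k) * (s k * R Three)"
    using IH G1 mn by (intro add_mono mult_left_mono) auto
  also have "\<dots> \<le> s (Suc k) * real (height (Suc k) Four)"
  proof -
    have "0 \<le> \<delta> * R Four" "0 \<le> (s k + \<delta>) * R One" "0 \<le> \<delta> * R Three" using \<delta> s01[of k] nR R1[of Three] by auto
    then show ?thesis unfolding sSuc RS by (simp add: algebra_simps)
  qed
  finally show ?case using two three by simp
qed

text \<open>Vectors that are nonnegative at level \<open>k\<close> are nonnegative at all lower levels, because the matrices are.\<close>
lemma iter_pull_onto:
  assumes "\<And>j. 0 \<le> w $ j"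
  shows "\<exists>v. iter_pull k v = w \<and> (\<forall>i\<le>k. \<forall>j. 0 \<le> iter_pull i v $ j)"
  using assms
proof (induction k arbitrary: w)
  case 0
  then show ?case by auto
next
  case (Suc k)
  have "0 \<le> push (m_seq k) (n_seq k) w $ j" for j
    using Suc.prems m_n_seq_ge_2[of k] by (cases j) (auto simp: push_def intro!: add_nonneg_nonneg mult_nonneg_nonneg)
  then obtain v where v: "iter_pull k v = push (m_seq k) (n_seq k) w" "\<forall>i\<le>k. \<forall>j. 0 \<le> iter_pull i v $ j"
    using Suc.IH by blast
  have "iter_pull (Suc k) v = w" by (simp add: v(1) pull_push)
  then show ?case using v(2) Suc.prems by (intro exI[of _ v]) (auto simp: le_Suc_eq simp del: iter_pull.simps)
qed

definition cone_slice :: "real \<Rightarrow> nat \<Rightarrow> (real ^ letter) set" where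
  "cone_slice t k = {v. pairing (\<lambda>_. 1) v = 1} \<inter> {v. pairing weight v = t}
     \<inter> (\<Inter>i\<in>{..k}. \<Inter>j. {v. 0 \<le> iter_pull i v $ j})"

text \<open>
  Interpolate between the vectors of level \<open>k\<close> that are concentrated on the second and on the third
  letter: the first two lengths at level zero range over all values between \<open>g3 \<le> 1/8\<close> and
  \<open>g2 \<ge> 7/8\<close>.
\<close>
lemma cone_slice_nonempty:
  assumes "1 / 3 \<le> t" "t \<le> 2 / 3"
  shows "cone_slice t k \<noteq> {}"
proof -
  let ?R = "\<lambda>j. real (height k j)" and ?G = "count_row weight k"
  define s :: real where "s = 1 / 8 * (1 - (1 / 2) ^ k)"
  have s: "0 \<le> s" "s \<le> 1 / 8" by (auto simp: s_def power_le_one)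
  have Rpos: "0 < ?R j" for j using height_pos[of k j] by simp
  define g2 g3 where "g2 = ?G Two / ?R Two" and "g3 = ?G Three / ?R Three"
  have "(1 - s) * ?R Two \<le> ?G Two" "?G Three \<le> s * ?R Three"
    using row_weight_separated[of k] by (auto simp: s_def)
  then have "1 - s \<le> g2" "g3 \<le> s" using Rpos by (simp_all add: g2_def g3_def field_simps)
  then have g: "7 / 8 \<le> g2" "g3 \<le> 1 / 8" using s by linarith+
  define x where "x = (t - g3) / (g2 - g3)"
  have x: "0 \<le> x" "x \<le> 1" using g assms by (auto simp: x_def field_simps)
  have xg: "x * g2 + (1 - x) * g3 = t"
  proof -
    have "x * (g2 - g3) = t - g3" using g by (simp add: x_def)
    then show ?thesis by (simp add: algebra_simps)
  qed
  define w :: "real ^ letter" where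
    "w = (\<chi> j. if j = Two then x / ?R Two else if j = Three then (1 - x) / ?R Three else 0)"
  have "0 \<le> w $ j" for j using x Rpos by (simp add: w_def)
  then obtain v where v: "iter_pull k v = w" "\<forall>i\<le>k. \<forall>j. 0 \<le> iter_pull i v $ j"
    using iter_pull_onto by blast
  have "pairing (\<lambda>_. 1) v = pairing (count_row (\<lambda>_. 1) k) w" using pairing_iter_pull[of "\<lambda>_. 1" k v] v(1) by simp
  also have "\<dots> = 1" using Rpos[of Two] Rpos[of Three] by (simp add: pairing_def row_1 w_def)
  finally have 1: "pairing (\<lambda>_. 1) v = 1" .
  have "pairing weight v = pairing (count_row weight k) w" using pairing_iter_pull[of weight k v] v(1) by simp
  also have "\<dots> = x * g2 + (1 - x) * g3" by (simp add: pairing_def w_def g2_def g3_def mult.commute)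
  finally have "pairing weight v = t" using xg by simp
  then have "v \<in> cone_slice t k" using 1 v(2) by (auto simp: cone_slice_def)
  then show ?thesis by blast
qed

lemma compact_cone_slice: "compact (cone_slice t k)"
proof -
  have cl: "closed {v. 0 \<le> iter_pull i v $ j}" for i j
    by (intro closed_Collect_le continuous_intros continuous_on_compose2[OF continuous_iter_pull]) auto
  have "closed {v. pairing r v = u}" for r u
    unfolding pairing_def by (intro closed_Collect_eq continuous_intros)
  then have "closed (cone_slice t k)" unfolding cone_slice_def
    by (intro closed_Int closed_INT ballI cl) auto
  moreover have "bounded (cone_slice t k)"
  proof (rule boundedI)
    fix v assume v: "v \<in> cone_slice t k"
    have "0 \<le> iter_pull 0 v $ j" for j using v unfolding cone_slice_def by blast
    then have nonneg: "0 \<le> v $ j" for j by simp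
    have "norm v \<le> (\<Sum>j\<in>UNIV. \<bar>v $ j\<bar>)" by (rule norm_le_l1_cart)
    also have "\<dots> = pairing (\<lambda>_. 1) v" using nonneg by (simp add: UNIV_letter pairing_def)
    also have "\<dots> = 1" using v by (simp add: cone_slice_def)
    finally show "norm v \<le> 1" .
  qed
  ultimately show ?thesis by (simp add: compact_eq_bounded_closed)
qed

text \<open>
  A vector in all the cones is nonnegative at each level and never zero. As every entry of a product
  of two matrices is positive, it is then positive at each level.
\<close>
lemma fast_keane_exists:
  assumes "1 / 3 \<le> t" "t \<le> 2 / 3"
  shows "\<exists>a b c d. fast_keane m_seq n_seq a b c d \<and> a 0 + b 0 = t"
proof -
  have "\<Inter> (range (cone_slice t)) \<noteq> {}"
    by (rule compact_nest) (use compact_cone_slice cone_slice_nonempty[OF assms] in \<open>auto simp: cone_slice_def\<close>)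
  then obtain v where v: "\<And>k. v \<in> cone_slice t k" by blast
  define x where "x k = iter_pull k v" for k
  have nonneg: "0 \<le> x k $ j" for k j using v[of k] by (auto simp: cone_slice_def x_def)
  have step: "x k = push (m_seq k) (n_seq k) (x (Suc k))" for k by (simp add: x_def push_pull)
  have one: "x k $ One = x (Suc k) $ Three + x (Suc k) $ Four"
    and two: "x k $ Two = (real (m_seq k) - 1) * x (Suc k) $ One + real (m_seq k) * x (Suc k) $ Two"
    and three: "x k $ Three = real (n_seq k) * (x (Suc k) $ One + x (Suc k) $ Two + x (Suc k) $ Four)
        + (real (n_seq k) - 1) * x (Suc k) $ Three"
    and four: "x k $ Four = x (Suc k) $ One + x (Suc k) $ Two + x (Suc k) $ Three + x (Suc k) $ Four" for k
    by (subst step, simp add: push_def)+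
  have unit: "pairing (count_row (\<lambda>_. 1) k) (x k) = 1" for k
    using v[of k] pairing_iter_pull[of "\<lambda>_. 1" k v] by (simp add: cone_slice_def x_def)
  have tot: "0 < x k $ One + x k $ Two + x k $ Three + x k $ Four" for k
  proof (rule ccontr)
    assume "\<not> 0 < x k $ One + x k $ Two + x k $ Three + x k $ Four"
    then have "x k $ One = 0" "x k $ Two = 0" "x k $ Three = 0" "x k $ Four = 0"
      using nonneg[of k One] nonneg[of k Two] nonneg[of k Three] nonneg[of k Four] by linarith+
    then show False using unit[of k] by (simp add: pairing_def)
  qed
  have d: "0 < x k $ Four" for k using tot[of "Suc k"] four[of k] by simp
  have a: "0 < x k $ One" for k using d[of "Suc k"] nonneg[of "Suc k" Three] one[of k] by simp
  have mn: "2 \<le> real (m_seq k)" "2 \<le> real (n_seq k)" for k using m_n_seq_ge_2[of k] by auto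
  have b: "0 < x k $ Two" for k
  proof -
    have "0 < (real (m_seq k) - 1) * x (Suc k) $ One" using mn(1)[of k] a[of "Suc k"] by simp
    moreover have "0 \<le> real (m_seq k) * x (Suc k) $ Two" using nonneg[of "Suc k" Two] by simp
    ultimately show ?thesis using two[of k] by linarith
  qed
  have c: "0 < x k $ Three" for k
  proof -
    have "0 < real (n_seq k) * (x (Suc k) $ One + x (Suc k) $ Two + x (Suc k) $ Four)"
      using mn(2)[of k] a[of "Suc k"] b[of "Suc k"] d[of "Suc k"] by simp
    moreover have "0 \<le> (real (n_seq k) - 1) * x (Suc k) $ Three"
      using mn(2)[of k] nonneg[of "Suc k" Three] by simp
    ultimately show ?thesis using three[of k] by linarith
  qed
  have w: "x 0 $ One + x 0 $ Two = t" "x 0 $ One + x 0 $ Two + x 0 $ Three + x 0 $ Four = 1"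
    using v[of 0] by (auto simp: cone_slice_def pairing_def weight_def x_def)
  have "fast_keane m_seq n_seq (\<lambda>k. x k $ One) (\<lambda>k. x k $ Two) (\<lambda>k. x k $ Three) (\<lambda>k. x k $ Four)"
  proof
    fix k
    show "2 \<le> m_seq k" "2 \<le> n_seq k" by (fact m_n_seq_ge_2)+
    show "0 < x k $ One" "0 < x k $ Two" "0 < x k $ Three" "0 < x k $ Four" by (fact a b c d)+
    show "x k $ One = x (Suc k) $ Three + x (Suc k) $ Four" by (fact one)
    show "x k $ Two = (real (m_seq k) - 1) * x (Suc k) $ One + real (m_seq k) * x (Suc k) $ Two" by (fact two)
    show "x k $ Three = real (n_seq k) * (x (Suc k) $ One + x (Suc k) $ Two + x (Suc k) $ Four)
        + (real (n_seq k) - 1) * x (Suc k) $ Three" by (fact three)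
    show "x k $ Four = x (Suc k) $ One + x (Suc k) $ Two + x (Suc k) $ Three + x (Suc k) $ Four" by (fact four)
    show "x 0 $ One + x 0 $ Two + x 0 $ Three + x 0 $ Four = 1" by (fact w(2))
    show "16 * 2 ^ k * real (length (full_word m_seq n_seq k One))
        \<le> (real (n_seq k) - 1) * real (length (full_word m_seq n_seq k Three))"
      unfolding length_full_word by (fact n_seq_growth)
    show "16 * 2 ^ k * (real (n_seq k) * real (length (full_word m_seq n_seq k Three)) + real (length (full_word m_seq n_seq k Four)))
        \<le> (real (m_seq k) - 1) * real (length (full_word m_seq n_seq k Two))"
      unfolding length_full_word by (fact m_seq_growth)
    show "1 / 3 \<le> x 0 $ One + x 0 $ Two" "x 0 $ One + x 0 $ Two \<le> 2 / 3"
      unfolding w(1) by (fact assms)+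
  qed
  then show ?thesis using w by blast
qed

section \<open>Turning over the last interval\<close>

text \<open>
  The letters \<open>1\<close>, \<open>2\<close>, \<open>n\<close> are the first, second and fourth interval of Keane's exchange, and its third
  interval is cut into the letters \<open>3, \<dots>, n - 1\<close>. Of these, \<open>n - 1\<close> is the part that is mapped onto the
  fourth interval. Since that interval is turned over, both \<open>n - 1\<close> and \<open>n\<close> are flipped.
\<close>
definition image_place :: "nat \<Rightarrow> nat \<Rightarrow> int" where
  "image_place n j = (if j = 1 then 3 else if j = 2 then 2 else if j = n - 1 then - int n
     else if j = n then -1 else int j + 1)"

definition flipped_perm :: "('a::finite \<Rightarrow> nat) \<Rightarrow> 'a gperm" where
  "flipped_perm e = (e, \<lambda>\<alpha>. image_place CARD('a) (e \<alpha>))"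

lemma bij_image_place:
  assumes "5 \<le> n"
  shows "bij_betw (\<lambda>j. \<bar>image_place n j\<bar>) {1..n} {1..int n}"
proof (rule bij_betw_byWitness)
  let ?g = "\<lambda>v. if v = 1 then n else if v = 2 then 2 else if v = 3 then 1 else nat v - 1"
  show "\<forall>j\<in>{1..n}. ?g \<bar>image_place n j\<bar> = j"
    using assms by (auto simp: image_place_def)
  show "\<forall>v\<in>{1..int n}. \<bar>image_place n (?g v)\<bar> = v"
  proof
    fix v assume v: "v \<in> {1..int n}"
    define w where "w = nat v"
    have w: "v = int w" "1 \<le> w" "w \<le> n" using v by (auto simp: w_def)
    consider "w = 1" | "w = 2" | "w = 3" | "4 \<le> w" using w(2) by linarith
    then show "\<bar>image_place n (?g v)\<bar> = v"
      unfolding w(1) using assms w by cases (auto simp: image_place_def of_nat_diff)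
  qed
  show "(\<lambda>j. \<bar>image_place n j\<bar>) ` {1..n} \<subseteq> {1..int n}"
    using assms by (auto simp: image_place_def)
  show "?g ` {1..int n} \<subseteq> {1..n}" using assms by auto
qed

lemma flipped_perm_in_flip_perms:
  fixes e :: "'a::finite \<Rightarrow> nat"
  assumes n: "5 \<le> CARD('a)" and e: "bij_betw e UNIV {1..CARD('a)}"
  shows "flipped_perm e \<in> flip_perms"
proof -
  let ?n = "CARD('a)"
  have b: "bij_betw (\<lambda>\<alpha>. \<bar>image_place ?n (e \<alpha>)\<bar>) UNIV {1..int ?n}"
    using bij_betw_trans[OF e bij_image_place[OF n]] by (simp add: o_def)
  have "image_place ?n (e \<alpha>) \<in> {- int ?n..-1} \<union> {1..int ?n}" for \<alpha>
  proof -
    have "\<bar>image_place ?n (e \<alpha>)\<bar> \<in> {1..int ?n}" using bij_betwE[OF b] by blast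
    then show ?thesis by auto
  qed
  then have "range (\<lambda>\<alpha>. image_place ?n (e \<alpha>)) \<subseteq> {- int ?n..-1} \<union> {1..int ?n}" by blast
  then have "gen_perm (flipped_perm e)"
    unfolding gen_perm_def flipped_perm_def fst_conv snd_conv using e b by blast
  moreover obtain \<alpha> where "e \<alpha> = ?n"
  proof -
    have "?n \<in> e ` UNIV" using e n by (auto simp: bij_betw_def)
    then show thesis using that by (metis imageE)
  qed
  then have "\<alpha> \<in> flip_set (flipped_perm e)"
    using n by (simp add: flip_set_def flipped_perm_def image_place_def)
  ultimately show ?thesis by (auto simp: flip_perms_def)
qed

text \<open>
  The letter \<open>n - 1\<close> has the same length as \<open>n\<close>, being mapped onto it; the pieces \<open>3, \<dots>, n - 2\<close> share
  the rest of the third interval in any way.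
\<close>
locale flipped_keane = fast_keane m n a b c d
  for m n :: "nat \<Rightarrow> nat" and a b c d :: "nat \<Rightarrow> real" +
  fixes e :: "'a::finite \<Rightarrow> nat" and len :: "nat \<Rightarrow> real"
  assumes card5: "5 \<le> CARD('a)"
    and e: "bij_betw e UNIV {1..CARD('a)}"
    and len_pos: "j \<in> {1..CARD('a)} \<Longrightarrow> 0 < len j"
    and len_1: "len 1 = a 0" and len_2: "len 2 = b 0"
    and len_mid: "(\<Sum>j\<in>{3..<CARD('a) - 1}. len j) = c 0 - d 0"
    and len_last: "len (CARD('a) - 1) = d 0" "len CARD('a) = d 0"
begin

definition l :: "real ^ 'a" where "l = (\<chi> \<alpha>. len (e \<alpha>))"

abbreviation p :: "'a gperm" where "p \<equiv> flipped_perm e"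

definition S :: "nat \<Rightarrow> real" where "S j = (\<Sum>i\<in>{1..<j}. len i)"

definition cut :: real where "cut = a 0 + b 0 + c 0"

text \<open>The involution that reflects the last interval \<open>(cut, 1)\<close> about its centre.\<close>
definition flip :: "real \<Rightarrow> real" where
  "flip y = (if cut < y then cut + 1 - y else y)"

lemma e_range: "e \<alpha> \<in> {1..CARD('a)}"
  using bij_betwE[OF e] by blast

lemma sum_letters: "(\<Sum>\<beta> | Q (e \<beta>). l $ \<beta>) = (\<Sum>j\<in>{j\<in>{1..CARD('a)}. Q j}. len j)"
proof -
  have "inj_on e {\<beta>. Q (e \<beta>)}" using e by (auto simp: bij_betw_def inj_on_def)
  moreover have "e ` {\<beta>. Q (e \<beta>)} = {j\<in>{1..CARD('a)}. Q j}"
  proof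
    show "{j\<in>{1..CARD('a)}. Q j} \<subseteq> e ` {\<beta>. Q (e \<beta>)}"
    proof
      fix j assume j: "j \<in> {j\<in>{1..CARD('a)}. Q j}"
      then have "j \<in> e ` UNIV" using e by (simp add: bij_betw_def)
      then show "j \<in> e ` {\<beta>. Q (e \<beta>)}" using j by auto
    qed
  qed (use e_range in auto)
  ultimately show ?thesis
    using sum.reindex[of e "{\<beta>. Q (e \<beta>)}" len] by (simp add: l_def o_def)
qed

lemma S_values:
  "S 1 = 0" "S 2 = a 0" "S 3 = a 0 + b 0" "S (CARD('a) - 1) = cut - d 0" "S CARD('a) = cut" "S (Suc CARD('a)) = 1"
proof -
  show S1: "S 1 = 0" by (simp add: S_def)
  have S_Suc: "S (Suc j) = S j + len j" if "1 \<le> j" for j using that by (simp add: S_def)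
  show S2: "S 2 = a 0" using S_Suc[of 1] S1 len_1 by (simp add: numeral_2_eq_2)
  show S3: "S 3 = a 0 + b 0" using S_Suc[of 2] S2 len_2 by (simp add: numeral_3_eq_3 numeral_2_eq_2)
  have "{1..<CARD('a) - 1} = {1..<3} \<union> {3..<CARD('a) - 1}" using card5 by auto
  then have "S (CARD('a) - 1) = S 3 + (\<Sum>j\<in>{3..<CARD('a) - 1}. len j)"
    unfolding S_def by (subst sum.union_disjoint[symmetric]) auto
  then show SN1: "S (CARD('a) - 1) = cut - d 0" using S3 len_mid by (simp add: cut_def)
  have "Suc (CARD('a) - 1) = CARD('a)" using card5 by simp
  then show SN: "S CARD('a) = cut" using S_Suc[of "CARD('a) - 1"] card5 SN1 len_last by simp
  show "S (Suc CARD('a)) = 1" using S_Suc[of "CARD('a)"] card5 SN len_last total by (simp add: cut_def)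
qed

lemma S_mono: "i \<le> j \<Longrightarrow> j \<le> Suc CARD('a) \<Longrightarrow> S i \<le> S j"
  unfolding S_def by (rule sum_mono2) (auto intro!: less_imp_le len_pos)

lemma d_less_c: "d 0 < c 0"
proof -
  have "0 < (\<Sum>j\<in>{3..<CARD('a) - 1}. len j)"
    using card5 by (intro sum_pos) (auto intro: len_pos)
  then show ?thesis using len_mid by simp
qed

lemma l_lengths: "l \<in> lengths"
proof -
  have "(\<Sum>\<beta>\<in>UNIV. l $ \<beta>) = (\<Sum>j\<in>{1..CARD('a)}. len j)" 
  proof -
    have "{j \<in> {1..CARD('a)}. True} = {1..CARD('a)}" by auto
    then show ?thesis using sum_letters[of "\<lambda>_. True"] by (simp only: UNIV_def[symmetric])
  qed
  also have "\<dots> = S (Suc CARD('a))" by (simp add: S_def atLeastLessThanSuc_atLeastAtMost)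
  finally show ?thesis using S_values e_range len_pos by (auto simp: lengths_def l_def)
qed

lemma p_flip: "p \<in> flip_perms"
  by (rule flipped_perm_in_flip_perms[OF card5 e])

lemma p_gen: "gen_perm p"
  using p_flip by (simp add: flip_perms_def)

abbreviation f :: "real \<rightharpoonup> real" where "f \<equiv> fiet p l"

lemma left_ends: "(\<Sum>\<beta> | fst p \<beta> < fst p \<alpha>. l $ \<beta>) = S (e \<alpha>)"
proof -
  have "{j\<in>{1..CARD('a)}. j < e \<alpha>} = {1..<e \<alpha>}" using e_range[of \<alpha>] by auto
  then show ?thesis using sum_letters[of "\<lambda>j. j < e \<alpha>"] by (simp add: flipped_perm_def S_def)
qed

lemma branch_values:
  "branch p l \<alpha> x =
    (if e \<alpha> = 1 then x + (d 0 + b 0) else if e \<alpha> = 2 then x + (d 0 - a 0)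
     else if e \<alpha> = CARD('a) - 1 then 2 * cut - x else if e \<alpha> = CARD('a) then 1 - x else x + d 0)"
proof -
  define j where "j = e \<alpha>"
  have j: "1 \<le> j" "j \<le> CARD('a)" using e_range[of \<alpha>] by (auto simp: j_def)
  have flipped: "\<alpha> \<in> flip_set p \<longleftrightarrow> j = CARD('a) - 1 \<or> j = CARD('a)"
    using card5 j by (auto simp: flip_set_def flipped_perm_def image_place_def j_def)
  define before where "before = (\<Sum>i\<in>{i\<in>{1..CARD('a)}. \<bar>image_place CARD('a) i\<bar> < \<bar>image_place CARD('a) j\<bar>}. len i)"
  define upto where "upto = (\<Sum>i\<in>{i\<in>{1..CARD('a)}. \<bar>image_place CARD('a) i\<bar> \<le> \<bar>image_place CARD('a) j\<bar>}. len i)"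
  have "(\<Sum>\<beta> | \<bar>snd p \<beta>\<bar> < \<bar>snd p \<alpha>\<bar>. l $ \<beta>) = before"
    using sum_letters[of "\<lambda>i. \<bar>image_place CARD('a) i\<bar> < \<bar>image_place CARD('a) j\<bar>"]
    by (simp add: flipped_perm_def j_def before_def)
  moreover have "(\<Sum>\<beta> | \<bar>snd p \<beta>\<bar> \<le> \<bar>snd p \<alpha>\<bar>. l $ \<beta>) = upto"
    using sum_letters[of "\<lambda>i. \<bar>image_place CARD('a) i\<bar> \<le> \<bar>image_place CARD('a) j\<bar>"]
    by (simp add: flipped_perm_def j_def upto_def)
  ultimately have br: "branch p l \<alpha> x = (if j = CARD('a) - 1 \<or> j = CARD('a) then (upto + S j) - x else x + (before - S j))"
    unfolding branch_def left_ends[of \<alpha>] j_def[symmetric] flipped by simp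
  have cut1: "d 0 = 1 - cut" using total by (simp add: cut_def)
  note S_at = S_values(1,2,4,5)
  consider "j = 1" | "j = 2" | "3 \<le> j" "j < CARD('a) - 1" | "j = CARD('a) - 1" | "j = CARD('a)" using j by linarith
  then show ?thesis
    unfolding j_def[symmetric]
  proof cases
    case 1
    have "{i\<in>{1..CARD('a)}. \<bar>image_place CARD('a) i\<bar> < \<bar>image_place CARD('a) j\<bar>} = {2, CARD('a)}"
      using card5 1 by (auto simp: image_place_def split: if_splits)
    then have "before = b 0 + d 0" unfolding before_def using card5 len_2 len_last by simp
    moreover have "\<not> (j = CARD('a) - 1 \<or> j = CARD('a))" using 1 card5 by linarith
    ultimately show "branch p l \<alpha> x = (if j = 1 then x + (d 0 + b 0) else if j = 2 then x + (d 0 - a 0)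
      else if j = CARD('a) - 1 then 2 * cut - x else if j = CARD('a) then 1 - x else x + d 0)"
      unfolding br using 1 card5 S_at(1) by simp
  next
    case 2
    have "{i\<in>{1..CARD('a)}. \<bar>image_place CARD('a) i\<bar> < \<bar>image_place CARD('a) j\<bar>} = {CARD('a)}"
      using card5 2 by (auto simp: image_place_def split: if_splits)
    then have "before = d 0" unfolding before_def using len_last by simp
    moreover have "\<not> (j = CARD('a) - 1 \<or> j = CARD('a))" using 2 card5 by linarith
    ultimately show "branch p l \<alpha> x = (if j = 1 then x + (d 0 + b 0) else if j = 2 then x + (d 0 - a 0)
      else if j = CARD('a) - 1 then 2 * cut - x else if j = CARD('a) then 1 - x else x + d 0)"
      unfolding br using 2 S_at(2) by simp
  next
    case 3
    have "{i\<in>{1..CARD('a)}. \<bar>image_place CARD('a) i\<bar> < \<bar>image_place CARD('a) j\<bar>} = {CARD('a)} \<union> {1..<j}"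
      using card5 3 by (auto simp: image_place_def split: if_splits)
    then have "before = d 0 + S j"
      using 3 len_last unfolding before_def by (simp add: S_def)
    then show "branch p l \<alpha> x = (if j = 1 then x + (d 0 + b 0) else if j = 2 then x + (d 0 - a 0)
      else if j = CARD('a) - 1 then 2 * cut - x else if j = CARD('a) then 1 - x else x + d 0)"
      unfolding br using 3 by simp
  next
    case 4
    have "{i\<in>{1..CARD('a)}. \<bar>image_place CARD('a) i\<bar> \<le> \<bar>image_place CARD('a) j\<bar>} = {1..CARD('a)}"
      using card5 4 by (auto simp: image_place_def split: if_splits)
    then have "upto = 1"
      using S_values(6) unfolding upto_def by (simp add: S_def atLeastLessThanSuc_atLeastAtMost)
    moreover have "j \<noteq> 1" "j \<noteq> 2" using 4 card5 by linarith+
    moreover have "S j = cut - d 0" unfolding 4 by (rule S_at(3))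
    ultimately show "branch p l \<alpha> x = (if j = 1 then x + (d 0 + b 0) else if j = 2 then x + (d 0 - a 0)
      else if j = CARD('a) - 1 then 2 * cut - x else if j = CARD('a) then 1 - x else x + d 0)"
      unfolding br using 4 cut1 by simp
  next
    case 5
    have "{i\<in>{1..CARD('a)}. \<bar>image_place CARD('a) i\<bar> \<le> \<bar>image_place CARD('a) j\<bar>} = {CARD('a)}"
      using card5 5 by (auto simp: image_place_def split: if_splits)
    then have "upto = d 0" unfolding upto_def using len_last by simp
    moreover have "j \<noteq> 1" "j \<noteq> 2" "j \<noteq> CARD('a) - 1" using 5 card5 by linarith+
    moreover have "S j = cut" unfolding 5 by (rule S_at(4))
    ultimately show "branch p l \<alpha> x = (if j = 1 then x + (d 0 + b 0) else if j = 2 then x + (d 0 - a 0)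
      else if j = CARD('a) - 1 then 2 * cut - x else if j = CARD('a) then 1 - x else x + d 0)"
      unfolding br using 5 cut1 by simp
  qed
qed

lemma T0_values:
  "0 < x \<Longrightarrow> x < a 0 \<Longrightarrow> T 0 x = x + (d 0 + b 0)"
  "a 0 < x \<Longrightarrow> x < a 0 + b 0 \<Longrightarrow> T 0 x = x + (d 0 - a 0)"
  "a 0 + b 0 < x \<Longrightarrow> x < cut \<Longrightarrow> T 0 x = x + d 0"
  "cut < x \<Longrightarrow> x < 1 \<Longrightarrow> T 0 x = x - cut"
  using T_eq[of x 0 One] T_eq[of x 0 Two] T_eq[of x 0 Three] T_eq[of x 0 Four] total
  by (simp_all add: cut_def L_def)

text \<open>
  Letter by letter, \<open>branch_values\<close> agrees with \<open>T 0\<close> conjugated by \<open>flip\<close>. Only points of the last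
  interval are moved by the inner reflection, and only images of the letter \<open>n - 1\<close> by the outer one.
\<close>
lemma fiet_conjugate:
  assumes "f x = Some y"
  shows "y = flip (T 0 (flip x))" "0 < T 0 (flip x) \<and> T 0 (flip x) < 1"
proof -
  obtain \<alpha> where x: "x \<in> cell (fst p) l \<alpha>" and y: "y = branch p l \<alpha> x"
    using assms fiet_Some_iff[OF p_gen l_lengths] by blast
  define j where "j = e \<alpha>"
  have j: "1 \<le> j" "j \<le> CARD('a)" using e_range[of \<alpha>] by (auto simp: j_def)
  have "offset (fst p) l \<alpha> = S j" using left_ends[of \<alpha>] by (simp add: offset_def j_def)
  moreover have "l $ \<alpha> = len j" by (simp add: l_def j_def)
  ultimately have x: "S j < x" "x < S j + len j" using x by auto
  have cut1: "cut + d 0 = 1" using total by (simp add: cut_def)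
  note facts = cut1 cut_def d_less_c a_pos[of 0] b_pos[of 0] c_pos[of 0] d_pos[of 0]
  note y = y[unfolded branch_values j_def[symmetric]]
  consider "j = 1" | "j = 2" | "3 \<le> j" "j < CARD('a) - 1" | "j = CARD('a) - 1" | "j = CARD('a)" using j by linarith
  then have "y = flip (T 0 (flip x)) \<and> 0 < T 0 (flip x) \<and> T 0 (flip x) < 1"
  proof cases
    case 1
    then have xx: "0 < x" "x < a 0" using x S_values len_1 by auto
    then have "flip x = x" using facts by (simp add: flip_def)
    then show ?thesis using xx T0_values(1)[of x] y 1 facts by (simp add: flip_def)
  next
    case 2
    then have xx: "a 0 < x" "x < a 0 + b 0" using x S_values len_2 by auto
    then have "flip x = x" using facts by (simp add: flip_def)
    then show ?thesis using xx T0_values(2)[of x] y 2 facts by (simp add: flip_def)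
  next
    case 3
    have "S (Suc j) = S j + len j" using 3 by (simp add: S_def)
    moreover have "S (Suc j) \<le> S (CARD('a) - 1)" by (rule S_mono) (use 3 in linarith)+
    ultimately have "x < cut - d 0" using x S_values by linarith
    have "S 3 \<le> S j" by (rule S_mono) (use 3 in linarith)+
    then have "a 0 + b 0 < x" using x S_values by linarith
    have Tx: "T 0 x = x + d 0"
      by (rule T0_values(3)) (use \<open>a 0 + b 0 < x\<close> \<open>x < cut - d 0\<close> facts in linarith)+
    have "j \<noteq> 1" "j \<noteq> 2" "j \<noteq> CARD('a) - 1" "j \<noteq> CARD('a)" using 3 by linarith+
    then have yx: "y = x + d 0" using y by simp
    have "flip x = x" "flip (x + d 0) = x + d 0"
      using \<open>x < cut - d 0\<close> facts by (simp_all add: flip_def)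
    then show ?thesis using Tx yx \<open>a 0 + b 0 < x\<close> \<open>x < cut - d 0\<close> facts by simp
  next
    case 4
    then have xx: "cut - d 0 < x" "x < cut" using x S_values len_last by auto
    then have "flip x = x" using facts by (simp add: flip_def)
    moreover have "j \<noteq> 1" "j \<noteq> 2" using 4 card5 by linarith+
    then have "y = 2 * cut - x" using y 4 by simp
    ultimately show ?thesis using xx T0_values(3)[of x] facts by (simp add: flip_def)
  next
    case 5
    then have xx: "cut < x" "x < 1" using x S_values len_last cut1 by auto
    then have "flip x = cut + 1 - x" by (simp add: flip_def)
    moreover have "j \<noteq> 1" "j \<noteq> 2" "j \<noteq> CARD('a) - 1" using 5 card5 by linarith+
    then have "y = 1 - x" using y 5 by simp
    ultimately show ?thesis using xx T0_values(4)[of "cut + 1 - x"] facts by (simp add: flip_def)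
  qed
  then show "y = flip (T 0 (flip x))" "0 < T 0 (flip x) \<and> T 0 (flip x) < 1" by auto
qed

lemma flip_flip: "y < 1 \<Longrightarrow> flip (flip y) = y"
  by (auto simp: flip_def)

lemma cut_bounds: "0 < cut" "cut < 1"
  using total a_pos[of 0] b_pos[of 0] c_pos[of 0] d_pos[of 0] by (auto simp: cut_def)

lemma flip_range: "0 < y \<Longrightarrow> y < 1 \<Longrightarrow> 0 < flip y \<and> flip y < 1"
  using cut_bounds by (auto simp: flip_def)

lemma flip_semiconjugates: "f x = Some y \<Longrightarrow> flip y = T 0 (flip x)"
  using fiet_conjugate[of x y] flip_flip by simp

lemma flip_vimage:
  assumes "E \<in> sets borel" "E \<subseteq> {0<..<1}"
  shows "flip -` E \<inter> {0<..<1} \<in> sets borel"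
    "emeasure lborel (flip -` E \<inter> {0<..<1}) = emeasure lborel E"
proof -
  let ?R = "(\<lambda>x. (cut + 1) + (-1) * x) -` (E \<inter> {cut<..})"
  have eq: "flip -` E \<inter> {0<..<1} = (E \<inter> {..cut}) \<union> ?R"
    using assms(2) cut_bounds by (auto simp: flip_def split: if_splits)
  have dis: "(E \<inter> {..cut}) \<inter> ?R = {}" using assms(2) by auto
  have "?R \<inter> space borel \<in> sets borel"
    by (rule measurable_sets[where A = borel]) (use assms(1) in auto)
  then have Rm: "?R \<in> sets borel" by simp
  show "flip -` E \<inter> {0<..<1} \<in> sets borel" unfolding eq using Rm assms(1) by auto
  have "emeasure lborel (flip -` E \<inter> {0<..<1}) = emeasure lborel (E \<inter> {..cut}) + emeasure lborel ?R"
    unfolding eq using Rm assms(1) dis by (intro plus_emeasure[symmetric]) auto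
  also have "emeasure lborel ?R = emeasure lborel (E \<inter> {cut<..})"
    by (rule emeasure_lborel_isometry_vimage) (use assms(1) in auto)
  also have "emeasure lborel (E \<inter> {..cut}) + emeasure lborel (E \<inter> {cut<..})
      = emeasure lborel ((E \<inter> {..cut}) \<union> (E \<inter> {cut<..}))"
    using assms(1) by (intro plus_emeasure) auto
  also have "(E \<inter> {..cut}) \<union> (E \<inter> {cut<..}) = E" by auto
  finally show "emeasure lborel (flip -` E \<inter> {0<..<1}) = emeasure lborel E" .
qed

lemma AE_flip:
  assumes "AE z in lborel. Q z"
  shows "AE x in lborel. x \<in> {0<..<1} \<longrightarrow> Q (flip x)"
proof -
  obtain Z where Z: "Z \<in> null_sets lborel" "{z. \<not> Q z} \<subseteq> Z"
    using assms unfolding eventually_ae_filter by auto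
  let ?Z = "Z \<inter> {0<..<1}"
  have "?Z \<in> sets borel" using Z(1) by auto
  moreover have "emeasure lborel ?Z = 0"
    using Z(1) emeasure_mono[of ?Z Z lborel] by (auto simp: null_setsD1)
  ultimately have "flip -` ?Z \<inter> {0<..<1} \<in> null_sets lborel"
    using flip_vimage[of ?Z] by (intro null_setsI) auto
  then show ?thesis
    by (rule AE_I') (use Z(2) flip_range in auto)
qed

lemma not_uniquely_ergodic: "\<not> uniquely_ergodic f"
proof -
  define A where "A = flip -` limit_side \<inter> {0<..<1}"
  have Am: "A \<in> sets borel" "emeasure lborel A = emeasure lborel limit_side"
    unfolding A_def using flip_vimage[OF limit_side_measurable limit_side_subset] by auto
  have co: "{0<..<1} - limit_side \<in> sets borel" using limit_side_measurable by auto
  have "emeasure lborel ({0<..<1} - limit_side) = emeasure lborel (flip -` ({0<..<1} - limit_side) \<inter> {0<..<1})"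
    using flip_vimage(2)[OF co] by auto
  also have "\<dots> \<le> emeasure lborel ({0..<1} - A)"
    using Am by (intro emeasure_mono) (auto simp: A_def)
  finally have B: "emeasure lborel ({0..<1} - A) \<noteq> 0" using limit_side_nontrivial(2) by auto
  have "AE x in lborel. \<forall>y. f x = Some y \<longrightarrow> (y \<in> A \<longleftrightarrow> x \<in> A)"
    using AE_flip[OF limit_side_invariant]
  proof eventually_elim
    case (elim x)
    show ?case
    proof (intro allI impI)
      fix y assume y: "f x = Some y"
      have r: "0 < x" "x < 1" "0 < y" "y < 1"
        using fiet_locally_isometric(1)[OF p_gen l_lengths y] by auto
      then have "T 0 (flip x) \<in> limit_side \<longleftrightarrow> flip x \<in> limit_side"
        using elim flip_range[of x] by auto
      then show "y \<in> A \<longleftrightarrow> x \<in> A"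
        using flip_semiconjugates[OF y] r by (auto simp: A_def)
    qed
  qed
  then show ?thesis
    by (intro not_uniquely_ergodicI[OF p_gen l_lengths Am(1) _ _ B]) (use Am limit_side_nontrivial A_def in auto)
qed

text \<open>
  The hitting property of \<open>T 0\<close> for the reflected set carries over to \<open>f\<close>. One extra step in the segment
  guarantees that all the points that matter lie in the domain of \<open>f\<close>.
\<close>
lemma hits_fiet:
  assumes U: "open U" "U \<inter> {0<..<1} \<noteq> {}"
  shows "\<exists>M E. finite E \<and> hits f E M U"
proof -
  let ?V = "(U \<inter> {..<cut}) \<union> (\<lambda>x. cut + 1 - x) -` (U \<inter> {cut<..<1})"
  have W: "open ((\<lambda>x. cut + 1 - x) -` (U \<inter> {cut<..<1}))"
    using U(1) by (intro open_vimage continuous_intros) auto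
  have V: "open ?V" by (rule open_Un[OF open_Int[OF U(1) open_lessThan] W])
  have "\<not> U \<inter> {0<..<1} \<subseteq> {cut}"
    using U open_Int[OF U(1) open_greaterThanLessThan[of 0 1]] not_open_singleton[of cut]
    by (metis subset_singletonD)
  then obtain v where "v \<in> U \<inter> {0<..<1}" "v \<notin> {cut}" by blast
  then have v: "v \<in> U" "0 < v" "v < 1" "v \<noteq> cut" by auto
  have "flip v \<in> ?V \<inter> {0<..<1}" using v cut_bounds by (auto simp: flip_def)
  then obtain M E where E: "finite E"
    "\<forall>x. (\<forall>i\<le>M. (T 0 ^^ i) x \<in> {0<..<1} - E) \<longrightarrow> (\<exists>i\<le>M. (T 0 ^^ i) x \<in> ?V)"
    using hits_open[OF V] by blast
  have "hits f (flip ` E) (Suc M) U"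
    unfolding hits_def
  proof (intro allI impI, elim conjE)
    fix u assume u: "\<forall>i<Suc M. f (u i) = Some (u (Suc i))" "\<forall>i\<le>Suc M. u i \<notin> flip ` E"
    have r: "0 < u i \<and> u i < 1" if "i \<le> M" for i
      using fiet_locally_isometric(1)[OF p_gen l_lengths, of "u i" "u (Suc i)"] u(1) that by auto
    have it: "(T 0 ^^ i) (flip (u 0)) = flip (u i)" if "i \<le> M" for i
      using that
    proof (induction i)
      case (Suc i)
      then have "f (u i) = Some (u (Suc i))" using u(1) by auto
      then show ?case using Suc flip_semiconjugates by simp
    qed simp
    have inE: "flip (u i) \<in> {0<..<1} - E" if "i \<le> M" for i
    proof -
      have "flip (u i) \<notin> E"
        using u(2)[rule_format, of i] flip_flip[of "u i"] r[OF that] that by (metis imageI le_SucI)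
      then show ?thesis using flip_range[of "u i"] r[OF that] by auto
    qed
    have "\<forall>i\<le>M. (T 0 ^^ i) (flip (u 0)) \<in> {0<..<1} - E"
    proof (intro allI impI)
      fix i assume "i \<le> M"
      from it[OF this] inE[OF this] show "(T 0 ^^ i) (flip (u 0)) \<in> {0<..<1} - E" by (simp only:)
    qed
    then obtain i where i: "i \<le> M" "(T 0 ^^ i) (flip (u 0)) \<in> ?V" using E(2) by blast
    from i(2) have "flip (u i) \<in> ?V" unfolding it[OF i(1)] .
    then have "flip (flip (u i)) \<in> U" by (auto simp: flip_def split: if_splits)
    then have "u i \<in> U" using flip_flip[of "u i"] r[OF i(1)] by simp
    then show "\<exists>i\<le>Suc M. u i \<in> U" using i(1) le_SucI by blast
  qed
  then show ?thesis using E(1) by blast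
qed

lemma minimal_f: "minimal f"
proof -
  interpret hitting_map f
    by unfold_locales (use fiet_locally_isometric(2)[OF p_gen l_lengths] hits_fiet in auto)
  show ?thesis by (rule minimal)
qed

lemma in_NUE: "(p, l) \<in> NUE"
  using p_flip l_lengths minimal_f not_uniquely_ergodic by (simp add: NUE_def)

end

lemma (in fast_keane) c_minus_d: "1 / 4 < c 0 - d 0"
proof -
  have "16 \<le> real (n 0) - 1" using growth_n[of 0] by simp
  then have "16 * d 0 \<le> (real (n 0) - 1) * d 0" using d_pos[of 0] by (intro mult_right_mono) auto
  moreover have "c (Suc 0) \<le> d 0" using d_rec[of 0] a_pos[of "Suc 0"] b_pos[of "Suc 0"] d_pos[of "Suc 0"] by simp
  ultimately have "16 * d 0 \<le> c 0" using rec'(3)[of 0] by (simp add: algebra_simps)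
  then show ?thesis using total balanced by linarith
qed

text \<open>
  The free coordinates are the sum of the first two lengths and the lengths of the pieces
  \<open>3, \<dots>, n - 3\<close>. The piece \<open>n - 2\<close> receives what is left of \<open>c 0 - d 0 > 1/4\<close>, which is positive
  as the \<open>n - 5\<close> free pieces have lengths at most \<open>1 / (4 n)\<close>.
\<close>
lemma many_NUE:
  fixes e :: "'a::finite \<Rightarrow> nat"
  assumes n: "5 \<le> CARD('a)" and e: "bij_betw e UNIV {1..CARD('a)}"
  shows "ereal (real (CARD('a) - 4)) \<le> hausdorff_dim {l. (flipped_perm e, l) \<in> NUE}"
proof -
  let ?n = "CARD('a)"
  define i where "i j = inv_into UNIV e j" for j
  have inj: "inj e" using e by (simp add: bij_betw_def)
  have ie: "i (e \<alpha>) = \<alpha>" for \<alpha> using inj by (simp add: i_def)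
  have ei: "e (i j) = j" if "j \<in> {1..?n}" for j
    using e that unfolding i_def by (simp add: bij_betw_def f_inv_into_f)
  define D where "D = i ` ({1} \<union> {3..<?n - 2})"
  have "inj_on i ({1} \<union> {3..<?n - 2})"
    by (rule inj_on_inverseI[of _ e]) (use ei in auto)
  then have "card D = card ({1} \<union> {3..<?n - 2})" unfolding D_def by (rule card_image)
  also have "\<dots> = ?n - 4" using n by (subst card_Un_disjoint) auto
  finally have card_D: "card D = ?n - 4" .
  define g where "g \<alpha> v = (if \<alpha> = i 1 then v $ i 1 + v $ i 2 else v $ \<alpha>)" for \<alpha> and v :: "real ^ 'a"
  define lo where "lo \<alpha> = (if \<alpha> = i 1 then 1 / 3 else 1 / (8 * real ?n))" for \<alpha>
  define hi where "hi \<alpha> = (if \<alpha> = i 1 then 2 / 3 else 1 / (4 * real ?n))" for \<alpha>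
  have "ereal (real (card D)) \<le> hausdorff_dim {l. (flipped_perm e, l) \<in> NUE}"
  proof (rule hausdorff_dim_ge_card_of_box_image[where g = g and C = 2 and lo = lo and hi = hi])
    fix \<alpha> and u v :: "real ^ 'a"
    have comp: "\<bar>u $ \<beta> - v $ \<beta>\<bar> \<le> dist u v" for \<beta>
      using component_le_norm_cart[of "u - v" \<beta>] by (simp add: dist_norm)
    show "\<bar>g \<alpha> u - g \<alpha> v\<bar> \<le> 2 * dist u v"
      using comp[of "i 1"] comp[of "i 2"] comp[of \<alpha>] zero_le_dist[of u v] unfolding g_def by (smt (verit))
  next
    fix \<alpha> show "lo \<alpha> < hi \<alpha>" using n by (simp add: lo_def hi_def field_simps)
  next
    fix y :: "'a \<Rightarrow> real"
    assume y: "\<And>\<alpha>. \<alpha> \<in> D \<Longrightarrow> lo \<alpha> \<le> y \<alpha> \<and> y \<alpha> \<le> hi \<alpha>"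
    have "i 1 \<in> D" by (simp add: D_def)
    then have "1 / 3 \<le> y (i 1)" "y (i 1) \<le> 2 / 3" using y[of "i 1"] by (auto simp: lo_def hi_def)
    then obtain a b c d where k: "fast_keane m_seq n_seq a b c d" and t: "a 0 + b 0 = y (i 1)"
      using fast_keane_exists by metis
    interpret k: fast_keane m_seq n_seq a b c d by (rule k)
    have mid: "1 / (8 * real ?n) \<le> y (i j) \<and> y (i j) \<le> 1 / (4 * real ?n)" if "j \<in> {3..<?n - 2}" for j
    proof -
      have "i j \<noteq> i 1"
      proof
        assume "i j = i 1"
        then have "e (i j) = e (i 1)" by simp
        moreover have "j \<in> {1..?n}" "1 \<in> {1..?n}" using that n by auto
        ultimately show False using ei[of j] ei[of 1] that by auto
      qed
      then show ?thesis using y[of "i j"] that by (auto simp: D_def lo_def hi_def)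
    qed
    define rest where "rest = c 0 - d 0 - (\<Sum>j\<in>{3..<?n - 2}. y (i j))"
    have "(\<Sum>j\<in>{3..<?n - 2}. y (i j)) \<le> (\<Sum>j\<in>{3..<?n - 2}. 1 / (4 * real ?n))"
      using mid by (intro sum_mono) auto
    also have "\<dots> \<le> real ?n * (1 / (4 * real ?n))" using n by (simp add: field_simps)
    also have "\<dots> = 1 / 4" using n by simp
    finally have rest: "0 < rest" using k.c_minus_d by (simp add: rest_def)
    define len where "len j = (if j = 1 then a 0 else if j = 2 then b 0 else if j = ?n - 2 then rest
        else if j = ?n - 1 \<or> j = ?n then d 0 else y (i j))" for j
    have "{3..<?n - 1} = insert (?n - 2) {3..<?n - 2}" using n by auto
    then have "(\<Sum>j\<in>{3..<?n - 1}. len j) = len (?n - 2) + (\<Sum>j\<in>{3..<?n - 2}. len j)" by simp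
    also have "(\<Sum>j\<in>{3..<?n - 2}. len j) = (\<Sum>j\<in>{3..<?n - 2}. y (i j))"
      by (intro sum.cong) (auto simp: len_def)
    also have "len (?n - 2) = rest"
    proof -
      have "?n - 2 \<noteq> 1" "?n - 2 \<noteq> 2" using n by linarith+
      then show ?thesis by (simp add: len_def)
    qed
    finally have len_mid: "(\<Sum>j\<in>{3..<?n - 1}. len j) = c 0 - d 0"
      by (simp add: rest_def)
    interpret fk: flipped_keane m_seq n_seq a b c d e len
    proof
      show "5 \<le> ?n" "bij_betw e UNIV {1..?n}" by (fact n e)+
      show "len 1 = a 0" "len 2 = b 0" by (simp_all add: len_def)
      show "len (?n - 1) = d 0" "len ?n = d 0" using n by (auto simp: len_def)
      show "(\<Sum>j\<in>{3..<?n - 1}. len j) = c 0 - d 0" by (fact len_mid)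
      fix j assume j: "j \<in> {1..?n}"
      have "0 < y (i j)" if "j \<in> {3..<?n - 2}"
      proof -
        have "0 < 1 / (8 * real ?n)" using n by simp
        then show ?thesis using mid[OF that] by linarith
      qed
      moreover have "j = 1 \<or> j = 2 \<or> j = ?n - 2 \<or> j = ?n - 1 \<or> j = ?n \<or> j \<in> {3..<?n - 2}"
        using j by auto
      ultimately show "0 < len j"
        using k.a_pos[of 0] k.b_pos[of 0] k.d_pos[of 0] rest by (auto simp: len_def)
    qed
    have "g \<alpha> fk.l = y \<alpha>" if \<alpha>: "\<alpha> \<in> D" for \<alpha>
    proof (cases "\<alpha> = i 1")
      case True
      then show ?thesis using t n ei[of 1] ei[of 2] by (simp add: g_def fk.l_def len_def)
    next
      case False
      then obtain j where j: "j \<in> {3..<?n - 2}" "\<alpha> = i j" using \<alpha> by (auto simp: D_def)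
      then have "e \<alpha> = j" using ei[of j] by auto
      then show ?thesis using False j by (auto simp: g_def fk.l_def len_def)
    qed
    then show "\<exists>u\<in>{l. (flipped_perm e, l) \<in> NUE}. \<forall>\<alpha>\<in>D. g \<alpha> u = y \<alpha>"
      using fk.in_NUE by blast
  qed simp
  then show ?thesis by (simp add: card_D)
qed

theorem theorem2:
  fixes n :: nat
  assumes "n \<ge> 2" and "CARD('a::finite) = n"
  shows "ereal (of_int (\<lfloor>(real n - 1) / 2\<rfloor> - 1)) \<le> Hdim (NUE :: ('a gperm \<times> (real ^ 'a)) set)"
proof -
  have le_Hdim: "hausdorff_dim {l. (p, l) \<in> NUE} \<le> Hdim (NUE :: ('a gperm \<times> (real ^ 'a)) set)"
    if "p \<in> flip_perms" for p :: "'a gperm"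
    unfolding Hdim_def using that by (intro Max_ge) (auto simp: finite_flip_perms)
  show ?thesis
  proof (cases "n \<le> 4")
    case True
    then have "\<lfloor>(real n - 1) / 2\<rfloor> \<le> 1" by (simp add: floor_le_iff)
    then have "ereal (of_int (\<lfloor>(real n - 1) / 2\<rfloor> - 1)) \<le> 0" by simp
    also have "0 \<le> Hdim (NUE :: ('a gperm \<times> (real ^ 'a)) set)"
    proof -
      obtain p :: "'a gperm" where "p \<in> flip_perms" using flip_perms_nonempty by blast
      from order.trans[OF hausdorff_dim_nonneg le_Hdim[OF this]] show ?thesis .
    qed
    finally show ?thesis .
  next
    case False
    then have n: "5 \<le> CARD('a)" using assms(2) by simp
    obtain e :: "'a \<Rightarrow> nat" where e: "bij_betw e UNIV {1..CARD('a)}"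
      using finite_same_card_bij[of "UNIV :: 'a set" "{1..CARD('a)}"] by auto
    have "\<lfloor>(real n - 1) / 2\<rfloor> \<le> int (n - 4) + 1" using False by (simp add: floor_le_iff of_nat_diff)
    then have "\<lfloor>(real n - 1) / 2\<rfloor> - 1 \<le> int (n - 4)" by simp
    then have "(of_int (\<lfloor>(real n - 1) / 2\<rfloor> - 1) :: real) \<le> of_int (int (n - 4))" by (simp only: of_int_le_iff)
    then have "ereal (of_int (\<lfloor>(real n - 1) / 2\<rfloor> - 1)) \<le> ereal (real (CARD('a) - 4))"
      using assms(2) by simp
    also have "\<dots> \<le> hausdorff_dim {l. (flipped_perm e, l) \<in> NUE}" by (rule many_NUE[OF n e])
    also have "\<dots> \<le> Hdim (NUE :: ('a gperm \<times> (real ^ 'a)) set)"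
      by (rule le_Hdim[OF flipped_perm_in_flip_perms[OF n e]])
    finally show ?thesis .
  qed
qed

end
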